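(* Let $C: f=0$ be a reduced plane curve in $\mathbb{P}^2$ of degree $d\geq 4$ over $\mathbb{C}$, and let $T=3(d-2)$. The following are equivalent. (i) $C$ is free. (ii) The equality $$m(f)_{2d-5-j}+ar(f)_j=\tau(C)$$ holds for every integer $j$ with $-1\leq j\leq d-2$, and $ar(f)_{d-2}\neq 0$. (iii) One has $$m(f)_{[T/2]}+m(f)_{T-[T/2]}-m(f_s)_{[T/2]}=\tau(C),$$ where $[T/2]$ denotes the integral part of $T/2$. In particular, when (ii) holds, one has $$st(f)=2d-4-mdr(f)=T-ct(f).$$
   Context: Let $S=\mathbb{C}[x,y,z]$ with its standard grading and let $f\in S$ be homogeneous of degree $d$ such that the curve $C: f=0$ in $\mathbb{P}^2$ is reduced. Let $f_x,f_y,f_z$ be the partial derivatives, $J_f=(f_x,f_y,f_z)$ the Jacobian ideal, $M(f)=S/J_f$ the graded Milnor algebra, and $m(f)_k=\dim_{\mathbb{C}} M(f)_k$ for every integer $k$ (zero for $k<0$). $AR(f)\subset S^3$ is the graded $S$-submodule of syzygies: $AR(f)_k$ consists of the triples $(a,b,c)$ with $a,b,c\in S_k$ and $af_x+bf_y+cf_z=0$. Put $ar(f)_k=\dim_{\mathbb{C}} AR(f)_k$ (zero for $k<0$). The curve $C$ is called free if $AR(f)$ is a free graded $S$-module of rank two (equivalently, the rank two bundle of logarithmic vector fields along $C$ splits as a direct sum of two line bundles on $\mathbb{P}^2$). $\tau(C)$ is the total Tjurina number of $C$, i.e. the sum of the Tjurina numbers of the singular points of $C$. $f_s\in S$ denotes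 any homogeneous polynomial of degree $d$ such that $f_s=0$ is a smooth curve; the numbers $m(f_s)_k=\dim_{\mathbb{C}} M(f_s)_k$ depend only on $d$ and $k$. Invariants: - $ct(f)=\max\{q : m(f)_k=m(f_s)_k \text{ for all } k\leq q\}$ (coincidence threshold). - $st(f)=\min\{q : m(f)_k=\tau(C)\text{ for all } k\geq q\}$ (stability threshold). - $mdr(f)=\min\{q : H^2(K^*(f))_{q+2}\neq 0\}$, where $K^*(f)$ is the Koszul complex of $f_x,f_y,f_z$ with its natural grading, i.e. the complex of polynomial differential forms on $\mathbb{C}^3$ with differential $\omega\mapsto df\wedge\omega$, where $dx,dy,dz$ have degree $1$. Thus $H^2(K^*(f))_{q+2}$ is $AR(f)_q$ modulo the degree $q$ part of the submodule generated by the Koszul syzygies $(f_y,-f_x,0)$, $(f_z,0,-f_x)$, $(0,f_z,-f_y)$; in particular it equals $AR(f)_q$ for $q<d-1$. *)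

theory Defs
  imports
    Complex_Main
    "HOL-Library.Poly_Mapping"
    "HOL-Library.Product_Plus"
    "HOL-Library.Numeral_Type"
    "HOL-Computational_Algebra.Formal_Power_Series"
    "HOL-Computational_Algebra.Squarefree"
begin

section \<open>Dimension of a quotient space\<close>

text \<open>For a scalar multiplication \<open>scale\<close> and subspaces \<open>W \<subseteq> V\<close>: the classes of the elements of \<open>B\<close>
  are distinct and form a basis of \<open>V/W\<close>. As for \<open>vector_space.dim\<close>, an infinite-dimensional
  quotient gets dimension 0.\<close>

definition quot_basis ::
  "('a::field \<Rightarrow> 'b::ab_group_add \<Rightarrow> 'b) \<Rightarrow> 'b set \<Rightarrow> 'b set \<Rightarrow> 'b set \<Rightarrow> bool" where
  "quot_basis scale B V W \<longleftrightarrow> B \<subseteq> V \<and> V \<subseteq> module.span scale (B \<union> W) \<and>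
     (\<forall>t u. finite t \<and> t \<subseteq> B \<and> (\<Sum>v\<in>t. scale (u v) v) \<in> W \<longrightarrow> (\<forall>v\<in>t. u v = 0))"

definition quot_dim ::
  "('a::field \<Rightarrow> 'b::ab_group_add \<Rightarrow> 'b) \<Rightarrow> 'b set \<Rightarrow> 'b set \<Rightarrow> nat" where
  "quot_dim scale V W = card (SOME B. quot_basis scale B V W)"


section \<open>The graded ring \<open>S = \<complex>[x,y,z]\<close>\<close>

text \<open>The indices \<open>0, 1, 2 :: 3\<close> stand for the variables \<open>x, y, z\<close>.\<close>

type_synonym mono3 = "3 \<Rightarrow>\<^sub>0 nat"
type_synonym poly3 = "mono3 \<Rightarrow>\<^sub>0 complex"

definition mono_deg :: "mono3 \<Rightarrow> nat" where
  "mono_deg m = (\<Sum>i\<in>UNIV. Poly_Mapping.lookup m i)"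

definition homog :: "int \<Rightarrow> poly3 set" where
  "homog k = {p. \<forall>m\<in>Poly_Mapping.keys p. int (mono_deg m) = k}"

definition pd :: "3 \<Rightarrow> poly3 \<Rightarrow> poly3" where
  "pd i p = (\<Sum>m\<in>Poly_Mapping.keys p.
     Poly_Mapping.single (m - Poly_Mapping.single i 1)
       (of_nat (Poly_Mapping.lookup m i) * Poly_Mapping.lookup p m))"

text \<open>Substitution of elements of a \<open>\<complex>\<close>-algebra with structure map \<open>h\<close>.\<close>

definition subst3 :: "(complex \<Rightarrow> 'a::comm_ring_1) \<Rightarrow> poly3 \<Rightarrow> 'a \<times> 'a \<times> 'a \<Rightarrow> 'a" where
  "subst3 h p = (\<lambda>(a, b, c). \<Sum>m\<in>Poly_Mapping.keys p.
     h (Poly_Mapping.lookup p m) *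
     a ^ Poly_Mapping.lookup m 0 * b ^ Poly_Mapping.lookup m 1 * c ^ Poly_Mapping.lookup m 2)"

definition const3 :: "complex \<Rightarrow> poly3" where
  "const3 c = Poly_Mapping.single 0 c"

lemma const3_add: "const3 (a + b) = const3 a + const3 b"
  by (simp add: const3_def single_add)

lemma const3_mult: "const3 (a * b) = const3 a * const3 b"
  by (simp add: const3_def mult_single)

lemma const3_1: "const3 1 = 1"
  by (simp add: const3_def)

definition scale3 :: "complex \<Rightarrow> poly3 \<Rightarrow> poly3" where
  "scale3 c p = const3 c * p"

global_interpretation S: vector_space scale3
  by unfold_locales (simp_all add: scale3_def const3_add const3_mult const3_1 algebra_simps)


section \<open>The Milnor algebra\<close>

definition jacobian_ideal :: "poly3 \<Rightarrow> poly3 set" where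
  "jacobian_ideal f = {a * pd 0 f + b * pd 1 f + c * pd 2 f | a b c. True}"

definition milnor_dim :: "poly3 \<Rightarrow> int \<Rightarrow> nat" where
  "milnor_dim f k = quot_dim scale3 (homog k) (jacobian_ideal f \<inter> homog k)"


section \<open>Jacobian syzygies, freeness and the Koszul complex\<close>

type_synonym triple3 = "poly3 \<times> poly3 \<times> poly3"

definition smult3 :: "poly3 \<Rightarrow> triple3 \<Rightarrow> triple3" where
  "smult3 p = (\<lambda>(a, b, c). (p * a, p * b, p * c))"

global_interpretation S3: module smult3
  by unfold_locales (auto simp: smult3_def algebra_simps)

global_interpretation S3C: vector_space "\<lambda>c. smult3 (const3 c)"
  by unfold_locales (auto simp: smult3_def const3_add const3_mult const3_1 algebra_simps)

definition homog_triples :: "int \<Rightarrow> triple3 set" where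
  "homog_triples k = homog k \<times> homog k \<times> homog k"

definition AR :: "poly3 \<Rightarrow> triple3 set" where
  "AR f = {(a, b, c). a * pd 0 f + b * pd 1 f + c * pd 2 f = 0}"

definition ar :: "poly3 \<Rightarrow> int \<Rightarrow> nat" where
  "ar f k = S3C.dim (AR f \<inter> homog_triples k)"

text \<open>A graded submodule of \<open>S\<^sup>3\<close> is free as a graded module if it has a basis of homogeneous
  elements.\<close>

definition graded_free :: "nat \<Rightarrow> triple3 set \<Rightarrow> bool" where
  "graded_free r M \<longleftrightarrow> (\<exists>B. finite B \<and> card B = r \<and> (\<forall>b\<in>B. \<exists>k. b \<in> homog_triples k) \<and>
     S3.independent B \<and> S3.span B = M)"

definition free_curve :: "poly3 \<Rightarrow> bool" where
  "free_curve f \<longleftrightarrow> graded_free 2 (AR f)"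

text \<open>The 1-form \<open>a dx + b dy + c dz\<close> and the 2-form \<open>a dy\<and>dz + b dz\<and>dx + c dx\<and>dy\<close> are both written
  \<open>(a, b, c)\<close>. Wedging a 1-form and a 2-form with \<open>df\<close> gives \<open>koszul_d1\<close> and
  (the coefficient of \<open>dx\<and>dy\<and>dz\<close>) \<open>koszul_d2\<close>.\<close>

definition koszul_d1 :: "poly3 \<Rightarrow> triple3 \<Rightarrow> triple3" where
  "koszul_d1 f = (\<lambda>(a, b, c).
     (pd 1 f * c - pd 2 f * b, pd 2 f * a - pd 0 f * c, pd 0 f * b - pd 1 f * a))"

definition koszul_d2 :: "poly3 \<Rightarrow> triple3 \<Rightarrow> poly3" where
  "koszul_d2 f = (\<lambda>(a, b, c). pd 0 f * a + pd 1 f * b + pd 2 f * c)"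

text \<open>As \<open>dx, dy, dz\<close> have degree 1, the 2-forms of degree \<open>n\<close> have coefficients of degree \<open>n - 2\<close>.\<close>

definition koszul_cycles2 :: "poly3 \<Rightarrow> int \<Rightarrow> triple3 set" where
  "koszul_cycles2 f n = {w \<in> homog_triples (n - 2). koszul_d2 f w = 0}"

definition koszul_boundaries2 :: "poly3 \<Rightarrow> int \<Rightarrow> triple3 set" where
  "koszul_boundaries2 f n = range (koszul_d1 f) \<inter> homog_triples (n - 2)"

definition koszul_H2_nonzero :: "poly3 \<Rightarrow> int \<Rightarrow> bool" where
  "koszul_H2_nonzero f n \<longleftrightarrow> \<not> koszul_cycles2 f n \<subseteq> koszul_boundaries2 f n"


section \<open>Singular points and Tjurina numbers\<close>

text \<open>Each point of the projective plane has exactly one representative whose first nonzero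
  homogeneous coordinate is 1.\<close>

definition proj_plane :: "(complex \<times> complex \<times> complex) set" where
  "proj_plane = {(1, b, c) | b c. True} \<union> {(0, 1, c) | c. True} \<union> {(0, 0, 1)}"

definition eval3 :: "poly3 \<Rightarrow> complex \<times> complex \<times> complex \<Rightarrow> complex" where
  "eval3 = subst3 (\<lambda>c. c)"

definition sing_points :: "poly3 \<Rightarrow> (complex \<times> complex \<times> complex) set" where
  "sing_points f = {p \<in> proj_plane. eval3 f p = 0 \<and> (\<forall>i. eval3 (pd i f) p = 0)}"

definition smooth_curve :: "poly3 \<Rightarrow> bool" where
  "smooth_curve f \<longleftrightarrow> sing_points f = {}"

text \<open>The ring \<open>\<complex>[[u,v]]\<close>, with \<open>v\<close> the outer variable. It serves as the completed local ring of
  the plane at a point; an isolated singularity has the same Tjurina algebra over the algebraic,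
  the analytic and the completed local ring.\<close>

type_synonym fps2 = "complex fps fps"

definition fps2_const :: "complex \<Rightarrow> fps2" where
  "fps2_const c = fps_const (fps_const c)"

definition fps2_u :: fps2 where "fps2_u = fps_const fps_X"

definition fps2_v :: fps2 where "fps2_v = fps_X"

definition fps2_du :: "fps2 \<Rightarrow> fps2" where
  "fps2_du g = Abs_fps (\<lambda>n. fps_deriv (fps_nth g n))"

definition fps2_dv :: "fps2 \<Rightarrow> fps2" where
  "fps2_dv g = fps_deriv g"

global_interpretation fps2: vector_space "\<lambda>c. (*) (fps2_const c)"
  by unfold_locales
    (simp_all add: fps2_const_def algebra_simps flip: fps_const_add fps_const_mult)

text \<open>A local equation at a point \<open>p \<in> proj_plane\<close> of the curve \<open>f = 0\<close>: the first nonzero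
  coordinate of \<open>p\<close> is set to 1, and \<open>u\<close>, \<open>v\<close> are the remaining two coordinates, centred at \<open>p\<close>.\<close>

definition local_eq :: "poly3 \<Rightarrow> complex \<times> complex \<times> complex \<Rightarrow> fps2" where
  "local_eq f = (\<lambda>(a, b, c). subst3 fps2_const f
     (if a \<noteq> 0 then (1, fps2_const b + fps2_u, fps2_const c + fps2_v)
      else if b \<noteq> 0 then (fps2_u, 1, fps2_const c + fps2_v)
      else (fps2_u, fps2_v, 1)))"

definition tjurina_ideal :: "fps2 \<Rightarrow> fps2 set" where
  "tjurina_ideal g = {a * g + b * fps2_du g + c * fps2_dv g | a b c. True}"

definition local_tjurina :: "poly3 \<Rightarrow> complex \<times> complex \<times> complex \<Rightarrow> nat" where
  "local_tjurina f p = quot_dim (\<lambda>c. (*) (fps2_const c)) UNIV (tjurina_ideal (local_eq f p))"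

definition total_tjurina :: "poly3 \<Rightarrow> nat" where
  "total_tjurina f = (\<Sum>p\<in>sing_points f. local_tjurina f p)"


section \<open>The numerical invariants\<close>

definition ct :: "poly3 \<Rightarrow> poly3 \<Rightarrow> int" where
  "ct f fs = (GREATEST q. \<forall>k\<le>q. milnor_dim f k = milnor_dim fs k)"

definition st :: "poly3 \<Rightarrow> int" where
  "st f = (LEAST q. \<forall>k\<ge>q. milnor_dim f k = total_tjurina f)"

definition mdr :: "poly3 \<Rightarrow> int" where
  "mdr f = (LEAST q. koszul_H2_nonzero f (q + 2))"

end

theory Submission
  imports
    Defs
    "Subresultants.Subresultant_Gcd"
    "HOL-Computational_Algebra.Field_as_Ring"
    "HOL-Computational_Algebra.Fundamental_Theorem_Algebra"
begin

text \<open>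
  Put \<open>D = d - 1\<close>. On a line \<open>l = 0\<close> transversal to the reduced curve the partial derivatives have no
  common zero, so two combinations \<open>g\<^sub>1, g\<^sub>2\<close> of them form a regular sequence with \<open>l\<close>. The duality that
  one usually draws from the bundle of logarithmic vector fields is replaced by the pairing into the
  socle of the Artinian complete intersection \<open>S/(g\<^sub>1, g\<^sub>2, l\<^sup>N)\<close>: as \<open>m(f)\<^sub>k = \<tau>(C)\<close> for large \<open>k\<close> (compare
  \<open>S/J\<^sub>f\<close> in large degrees with the completed local rings of the singular points), it yields
  \<open>ar(f)\<^sub>j + m(f)\<^bsub>2D-3-j\<^esub> \<ge> \<tau>(C)\<close>.

  Let \<open>r\<close> be the minimal degree of a syzygy. Equality at the middle degree, which is condition (iii),
  forces \<open>2r \<le> D\<close> and \<open>\<tau>(C) \<ge> D\<^sup>2 - r(D - r)\<close>. Then the inequality for \<open>j = D - r\<close> provides a syzygy of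
  degree \<open>D - r\<close> which is no multiple of the minimal one; the cross product of the two is a nonzero
  constant times the gradient of \<open>f\<close>, and \<open>C\<close> is free by Saito's criterion. Conversely, for exponents
  \<open>d\<^sub>1 \<le> d\<^sub>2\<close> comparing \<open>m(f)\<^sub>k\<close> with \<open>\<tau>(C)\<close> for large \<open>k\<close> gives \<open>d\<^sub>1 + d\<^sub>2 = D\<close> and \<open>\<tau>(C) = D\<^sup>2 - d\<^sub>1d\<^sub>2\<close>,
  and the rest is a computation with the Hilbert function of \<open>S\<close>. For the smooth curve \<open>f\<^sub>s\<close> the case
  \<open>\<tau> = 0\<close> excludes syzygies of degree less than \<open>D\<close>.
\<close>

section \<open>Polynomials in three variables\<close>

text \<open>Why transversality suffices: on the line Euler's relation reads d f = g1 + y g2, and g2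
  restricts to the derivative of f along the line, so a common zero of g1 and g2 there would be a
  multiple zero of f. Hence I = (\<open>g1\<close>, \<open>g2\<close>) defines D^2 points, counted
  with multiplicity, all off the line. Where the degree 2D - 3 - j comes from: J = I + (g3), the
  g3-coefficients of syzygies form I : g3, and (I : g3)/I in degree j + N pairs with S/J into the
  socle of S/(I, l^N), which is a line in degree 2D - 3 + N. For large N the left factor has
  dimension \<tau>. Why one middle degree decides: m(f) in degree 2D - 3 - j is determined by ar(f)
  in degree D - 3 - j. For j = [(D - 3)/2] both terms of the inequality become, up to known
  summands, values of ar(f) in nearly equal degrees, and each is bounded below by the multiples of
  one syzygy of degree r. The comparison with the local rings avoids the Nullstellensatz: singular
  points arise as joint eigenvalues of the coordinates x_i/l on S/J localized at l.\<close>

lemma UNIV_3: "(UNIV :: 3 set) = {0, 1, 2}"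
proof -
  have "card {0, 1, 2 :: 3} = CARD(3)" by simp
  then show ?thesis by (intro card_subset_eq[symmetric]) auto
qed

lemma exhaust_3: "(i :: 3) = 0 \<or> i = 1 \<or> i = 2"
  using UNIV_3 by blast

definition var3 :: "3 \<Rightarrow> poly3" where
  "var3 i = Poly_Mapping.single (Poly_Mapping.single i 1) 1"

definition coord :: "3 \<Rightarrow> 'a \<times> 'a \<times> 'a \<Rightarrow> 'a" where
  "coord i w = (if i = 0 then fst w else if i = 1 then fst (snd w) else snd (snd w))"

lemma coord_simps [simp]: "coord 0 (a, b, c) = a" "coord 1 (a, b, c) = b" "coord 2 (a, b, c) = c"
  by (simp_all add: coord_def)

lemma var3_power: "var3 i ^ n = Poly_Mapping.single (Poly_Mapping.single i n) 1"
  by (induction n) (simp_all add: var3_def mult_single single_add[symmetric])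

lemma mono3_eq: "m = Poly_Mapping.single 0 (Poly_Mapping.lookup m 0) + Poly_Mapping.single 1 (Poly_Mapping.lookup m 1)
     + Poly_Mapping.single 2 (Poly_Mapping.lookup m 2)" for m :: mono3
proof (rule poly_mapping_eqI)
  fix k :: 3
  show "Poly_Mapping.lookup m k = Poly_Mapping.lookup (Poly_Mapping.single 0 (Poly_Mapping.lookup m 0) + Poly_Mapping.single 1 (Poly_Mapping.lookup m 1)
     + Poly_Mapping.single 2 (Poly_Mapping.lookup m 2)) k"
    using exhaust_3[of k] by (auto simp: lookup_add lookup_single)
qed

lemma single_eq_var3: "Poly_Mapping.single m c =
    const3 c * var3 0 ^ Poly_Mapping.lookup m 0 * var3 1 ^ Poly_Mapping.lookup m 1 * var3 2 ^ Poly_Mapping.lookup m 2"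
proof -
  have "Poly_Mapping.single (Poly_Mapping.single 0 (Poly_Mapping.lookup m 0) + Poly_Mapping.single 1 (Poly_Mapping.lookup m 1)
     + Poly_Mapping.single 2 (Poly_Mapping.lookup m 2)) c =
    const3 c * var3 0 ^ Poly_Mapping.lookup m 0 * var3 1 ^ Poly_Mapping.lookup m 1 * var3 2 ^ Poly_Mapping.lookup m 2"
    by (simp add: const3_def var3_power mult_single)
  then show ?thesis by (simp flip: mono3_eq)
qed

lemma poly3_eq_sum_single: "p = (\<Sum>m\<in>Poly_Mapping.keys p. Poly_Mapping.single m (Poly_Mapping.lookup p m))" for p :: poly3
proof (rule poly_mapping_eqI)
  fix k
  show "Poly_Mapping.lookup p k = Poly_Mapping.lookup (\<Sum>m\<in>Poly_Mapping.keys p. Poly_Mapping.single m (Poly_Mapping.lookup p m)) k"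
    by (cases "k \<in> Poly_Mapping.keys p")
      (auto simp: lookup_sum lookup_single when_def in_keys_iff)
qed

text \<open>Two maps on S that respect sums and products agree once they agree on constants and
  variables. Most compatibilities of substitutions, derivatives and expansions below are proved this
  way.\<close>

lemma poly3_induct [case_names const var add mult]:
  assumes const: "\<And>c. P (const3 c)" and var: "\<And>i. P (var3 i)"
    and add: "\<And>p q. P p \<Longrightarrow> P q \<Longrightarrow> P (p + q)" and mult: "\<And>p q. P p \<Longrightarrow> P q \<Longrightarrow> P (p * q)"
  shows "P p"
proof -
  have P0: "P 0" using const[of 0] by (simp add: const3_def)
  have pw: "P (q ^ n)" if "P q" for q n
    using that const[of 1] by (induction n) (auto simp: const3_1 intro: mult)
  have ps: "P (Poly_Mapping.single m c)" for m c
    unfolding single_eq_var3 by (intro mult pw var const)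
  have "P (\<Sum>m\<in>A. Poly_Mapping.single m (Poly_Mapping.lookup p m))" if "finite A" for A
    using that(1) by (induction A rule: finite_induct) (auto intro: add P0 ps)
  then show ?thesis
    using poly3_eq_sum_single[of p] by (metis finite_keys)
qed

text \<open>Evaluation at a point, linear substitution, restriction to a line and Taylor expansion
  differ only in \<open>h\<close>, so the homomorphism laws of \<open>subst3 h\<close> are proved
  once.\<close>

locale structure_map =
  fixes h :: "complex \<Rightarrow> 'a::comm_ring_1"
  assumes add: "h (a + b) = h a + h b" and mult: "h (a * b) = h a * h b" and one: "h 1 = 1"
begin

lemma zero: "h 0 = 0"
  using add[of 0 0] by simp

lemma subst3_eq_sum_superset:
  assumes "finite A" "Poly_Mapping.keys p \<subseteq> A"
  shows "subst3 h p w = (\<Sum>m\<in>A. h (Poly_Mapping.lookup p m) * coord 0 w ^ Poly_Mapping.lookup m 0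
     * coord 1 w ^ Poly_Mapping.lookup m 1 * coord 2 w ^ Poly_Mapping.lookup m 2)"
  unfolding subst3_def
  using assms by (auto simp: coord_def case_prod_beta in_keys_iff zero intro!: sum.mono_neutral_left)

lemma subst3_add: "subst3 h (p + q) w = subst3 h p w + subst3 h q w"
proof -
  let ?A = "Poly_Mapping.keys p \<union> Poly_Mapping.keys q"
  have "Poly_Mapping.keys (p + q) \<subseteq> ?A" by (rule keys_add)
  then show ?thesis
    by (simp add: subst3_eq_sum_superset[of ?A] lookup_add add algebra_simps sum.distrib)
qed

lemma subst3_zero [simp]: "subst3 h 0 w = 0"
  by (simp add: subst3_def case_prod_beta)

lemma subst3_sum: "subst3 h (sum p A) w = (\<Sum>x\<in>A. subst3 h (p x) w)"
  by (induction A rule: infinite_finite_induct) (auto simp: subst3_add)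

lemma subst3_single: "subst3 h (Poly_Mapping.single m c) w = h c * coord 0 w ^ Poly_Mapping.lookup m 0
     * coord 1 w ^ Poly_Mapping.lookup m 1 * coord 2 w ^ Poly_Mapping.lookup m 2"
  by (subst subst3_eq_sum_superset[of "{m}"]) (auto simp: zero)

lemma subst3_const [simp]: "subst3 h (const3 c) w = h c"
  by (simp add: const3_def subst3_single)

lemma subst3_one [simp]: "subst3 h 1 w = 1"
  using subst3_const[of 1 w] by (simp add: const3_1 one)

lemma subst3_var: "subst3 h (var3 i) w = coord i w"
  using exhaust_3[of i] by (auto simp: var3_def subst3_single one lookup_single)

lemma subst3_var_simps [simp]: "subst3 h (var3 0) (a, b, c) = a" "subst3 h (var3 1) (a, b, c) = b"
    "subst3 h (var3 2) (a, b, c) = c"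
  by (simp_all add: subst3_var)

lemma subst3_mult: "subst3 h (p * q) w = subst3 h p w * subst3 h q w"
proof -
  have "p * q = (\<Sum>m\<in>Poly_Mapping.keys p. \<Sum>n\<in>Poly_Mapping.keys q.
      Poly_Mapping.single (m + n) (Poly_Mapping.lookup p m * Poly_Mapping.lookup q n))"
    by (subst (1) poly3_eq_sum_single[of p], subst (1) poly3_eq_sum_single[of q])
      (simp add: sum_product mult_single)
  then have "subst3 h (p * q) w = (\<Sum>m\<in>Poly_Mapping.keys p. \<Sum>n\<in>Poly_Mapping.keys q.
      subst3 h (Poly_Mapping.single m (Poly_Mapping.lookup p m)) w * subst3 h (Poly_Mapping.single n (Poly_Mapping.lookup q n)) w)"
    by (simp add: subst3_sum subst3_single lookup_add mult power_add algebra_simps)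
  also have "\<dots> = subst3 h p w * subst3 h q w"
    by (simp add: sum_product[symmetric] subst3_sum[symmetric] flip: poly3_eq_sum_single)
  finally show ?thesis .
qed

lemma subst3_power: "subst3 h (p ^ n) w = subst3 h p w ^ n"
  by (induction n) (auto simp: subst3_mult)

lemma subst3_uminus: "subst3 h (- p) w = - subst3 h p w"
  using subst3_add[of p "- p" w] by (simp add: eq_neg_iff_add_eq_0 add.commute)

lemma subst3_diff: "subst3 h (p - q) w = subst3 h p w - subst3 h q w"
  using subst3_add[of p "- q" w] by (simp add: subst3_uminus)

lemma subst3_prod: "subst3 h (prod p A) w = (\<Prod>x\<in>A. subst3 h (p x) w)"
  by (induction A rule: infinite_finite_induct) (auto simp: subst3_mult)

lemmas subst3_simps = subst3_add subst3_mult subst3_power subst3_diff subst3_uminus subst3_sum subst3_prod subst3_var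

end

lemma const3_zero [simp]: "const3 0 = 0"
  by (simp add: const3_def)

lemma const3_eq_0_iff [simp]: "const3 c = 0 \<longleftrightarrow> c = 0"
  by (metis const3_def const3_zero lookup_single_eq lookup_zero)

lemma const3_uminus: "const3 (- c) = - const3 c"
  by (simp add: const3_def single_uminus)

lemma const3_diff: "const3 (a - b) = const3 a - const3 b"
  by (simp add: const3_def single_diff)

lemma const3_power: "const3 (a ^ n) = const3 a ^ n"
  by (induction n) (auto simp: const3_1 const3_mult)

lemma const3_of_nat: "const3 (of_nat n) = of_nat n"
  by (simp add: const3_def)

lemma const3_inverse: "c \<noteq> 0 \<Longrightarrow> const3 (inverse c) * const3 c = 1"
  by (simp add: const3_mult[symmetric] const3_1)

lemma const3_neq_0_unit: "c \<noteq> 0 \<Longrightarrow> const3 c dvd 1"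
  by (metis const3_inverse dvd_triv_right)

interpretation id_map: structure_map "\<lambda>c::complex. c"
  by unfold_locales auto

lemma eval3_simps: "eval3 (p + q) w = eval3 p w + eval3 q w" "eval3 (p * q) w = eval3 p w * eval3 q w"
  "eval3 (p - q) w = eval3 p w - eval3 q w" "eval3 (- p) w = - eval3 p w" "eval3 (p ^ n) w = eval3 p w ^ n"
  "eval3 (const3 c) w = c" "eval3 (var3 i) w = coord i w" "eval3 0 w = 0" "eval3 1 w = 1"
  "eval3 (sum F A) w = (\<Sum>x\<in>A. eval3 (F x) w)" "eval3 (prod F A) w = (\<Prod>x\<in>A. eval3 (F x) w)"
  by (simp_all add: eval3_def id_map.subst3_simps)


section \<open>Partial derivatives as derivations\<close>

lemma pd_single: "pd i (Poly_Mapping.single m c) =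
    Poly_Mapping.single (m - Poly_Mapping.single i 1) (of_nat (Poly_Mapping.lookup m i) * c)"
  by (cases "c = 0") (simp_all add: pd_def)

lemma pd_eq_sum_superset:
  assumes "finite A" "Poly_Mapping.keys p \<subseteq> A"
  shows "pd i p = (\<Sum>m\<in>A. Poly_Mapping.single (m - Poly_Mapping.single i 1)
       (of_nat (Poly_Mapping.lookup m i) * Poly_Mapping.lookup p m))"
  unfolding pd_def using assms by (auto simp: in_keys_iff intro!: sum.mono_neutral_left)

lemma pd_add: "pd i (p + q) = pd i p + pd i q"
proof -
  let ?A = "Poly_Mapping.keys p \<union> Poly_Mapping.keys q"
  have "Poly_Mapping.keys (p + q) \<subseteq> ?A" by (rule keys_add)
  then show ?thesis
    by (simp add: pd_eq_sum_superset[of ?A] lookup_add algebra_simps sum.distrib single_add)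
qed

lemma pd_zero [simp]: "pd i 0 = 0"
  by (simp add: pd_def)

lemma pd_sum: "pd i (sum F A) = (\<Sum>x\<in>A. pd i (F x))"
  by (induction A rule: infinite_finite_induct) (auto simp: pd_add)

lemma pd_const [simp]: "pd i (const3 c) = 0"
  by (simp add: const3_def pd_single)

lemma pd_var: "pd i (var3 j) = (if i = j then 1 else 0)"
  by (auto simp: var3_def pd_single lookup_single)

lemma pd_single_mult: "pd i (Poly_Mapping.single m a * Poly_Mapping.single n b) =
   pd i (Poly_Mapping.single m a) * Poly_Mapping.single n b + Poly_Mapping.single m a * pd i (Poly_Mapping.single n b)"
proof -
  let ?e = "Poly_Mapping.single i (1::nat)"
  \<comment> \<open>Exponents are subtracted with truncation, so the shift by \<open>?e\<close>
    commutes with adding \<open>n\<close> only where the exponent is nonzero; elsewhere the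
    coefficient of the derivative is zero.\<close>
  have *: "(m - ?e) + n = m + n - ?e" if "Poly_Mapping.lookup m i \<noteq> 0" for m n :: mono3
    using that by (intro poly_mapping_eqI) (auto simp: lookup_add lookup_minus lookup_single when_def)
  show ?thesis
    using *[of m n] *[of n m]
    by (cases "Poly_Mapping.lookup m i = 0"; cases "Poly_Mapping.lookup n i = 0")
      (simp_all add: pd_single mult_single lookup_add algebra_simps flip: single_add)
qed

lemma pd_mult: "pd i (p * q) = pd i p * q + p * pd i q"
proof -
  let ?s = "\<lambda>p m. Poly_Mapping.single m (Poly_Mapping.lookup p m)"
  have "pd i (p * q) = (\<Sum>m\<in>Poly_Mapping.keys p. \<Sum>n\<in>Poly_Mapping.keys q. pd i (?s p m) * ?s q n + ?s p m * pd i (?s q n))"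
    by (subst (1) poly3_eq_sum_single[of p], subst (1) poly3_eq_sum_single[of q])
      (simp add: sum_product pd_sum pd_single_mult)
  also have "\<dots> = pd i (\<Sum>m\<in>Poly_Mapping.keys p. ?s p m) * (\<Sum>n\<in>Poly_Mapping.keys q. ?s q n)
      + (\<Sum>m\<in>Poly_Mapping.keys p. ?s p m) * pd i (\<Sum>n\<in>Poly_Mapping.keys q. ?s q n)"
    by (simp add: sum.distrib sum_product pd_sum)
  finally show ?thesis by (simp flip: poly3_eq_sum_single)
qed

lemma pd_one [simp]: "pd i 1 = 0"
  using pd_const[of i 1] by (simp add: const3_1)

lemma pd_power: "pd i (p ^ n) = of_nat n * p ^ (n - 1) * pd i p"
proof (induction n)
  case (Suc n)
  then show ?case by (cases n) (simp_all add: pd_mult algebra_simps)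
qed simp

section \<open>Finite-dimensional subspaces and quotients\<close>

text \<open>\<open>dim\<close> of an infinite-dimensional space is 0, so dimension counts are
  meaningful only together with this finiteness.\<close>

definition fin_dim :: "('a::field \<Rightarrow> 'b::ab_group_add \<Rightarrow> 'b) \<Rightarrow> 'b set \<Rightarrow> bool" where
  "fin_dim scale V \<longleftrightarrow> (\<exists>B. finite B \<and> V \<subseteq> module.span scale B)"

context vector_space
begin

lemma dim_zero [simp]: "dim {0} = 0"
  using dim_eq_card_independent[OF independent_empty] dim_span[of "{}"] by simp

lemma fin_dim_subset: "fin_dim scale W \<Longrightarrow> V \<subseteq> W \<Longrightarrow> fin_dim scale V"
  unfolding fin_dim_def by blast

lemma fin_dim_independent_finite:
  assumes "fin_dim scale V" "independent B" "B \<subseteq> V"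
  shows "finite B"
  using assms independent_span_bound unfolding fin_dim_def by blast

lemma fin_dim_basis:
  assumes "fin_dim scale V"
  obtains B where "finite B" "B \<subseteq> V" "independent B" "V \<subseteq> span B" "card B = dim V"
  using basis_exists[of V] fin_dim_independent_finite[OF assms] by metis

lemma dim_mono_finite:
  assumes "fin_dim scale W" "V \<subseteq> W"
  shows "dim V \<le> dim W"
proof -
  obtain B where B: "finite B" "W \<subseteq> span B" "card B = dim W"
    using fin_dim_basis[OF assms(1)] by metis
  then show ?thesis using dim_le_card[of V B] assms(2) by auto
qed

lemma subspace_eq_of_dim_ge:
  assumes "subspace V" "fin_dim scale W" "V \<subseteq> W" "dim W \<le> dim V"
  shows "V = W"
proof -
  obtain B where B: "finite B" "B \<subseteq> V" "independent B" "V \<subseteq> span B" "card B = dim V"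
    using fin_dim_basis[OF fin_dim_subset[OF assms(2,3)]] by metis
  obtain C where C: "B \<subseteq> C" "C \<subseteq> W" "independent C" "W \<subseteq> span C"
    using maximal_independent_subset_extend[OF order_trans[OF B(2) assms(3)] B(3)] by blast
  have "card C = dim W" using C by (intro basis_card_eq_dim)
  then have "B = C"
    using C(1) fin_dim_independent_finite[OF assms(2) C(3,2)] assms(4) B(5)
    by (metis card_seteq)
  then show ?thesis using C(4) B(2) assms(1,3) span_minimal by blast
qed

text \<open>Realizes the quotient by W inside the space itself: a basis of W is extended to a basis
  of everything, \<open>\<pi>\<close> kills the part in W and fixes the rest. Thus V/W becomes the
  image of V under \<open>\<pi>\<close>.\<close>

lemma exists_projection:
  assumes W: "subspace W"
  obtains \<pi> where "Vector_Spaces.linear scale scale \<pi>" "\<And>v. v - \<pi> v \<in> W" "\<And>w. w \<in> W \<Longrightarrow> \<pi> w = 0"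
proof -
  interpret vector_space_pair scale scale ..
  obtain D where D: "D \<subseteq> W" "independent D" "W \<subseteq> span D"
    using maximal_independent_subset[of W] by metis
  define E where "E = extend_basis D"
  have E: "D \<subseteq> E" "independent E" "span E = UNIV"
    unfolding E_def using extend_basis_superset independent_extend_basis D(2) by auto
  define \<pi> where "\<pi> = construct E (\<lambda>b. if b \<in> D then 0 else b)"
  have lin: "Vector_Spaces.linear scale scale \<pi>"
    unfolding \<pi>_def by (rule linear_construct[OF E(2)])
  interpret p: Vector_Spaces.linear scale scale \<pi> by (rule lin)
  have base: "\<pi> b = (if b \<in> D then 0 else b)" if "b \<in> E" for b
    unfolding \<pi>_def using construct_basis[OF E(2) that] by simp
  have 1: "v - \<pi> v \<in> W" for v
  proof -
    have "v \<in> span E" using E(3) by simp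
    then show ?thesis
    proof (induction rule: span_induct_alt)
      case (step c x y)
      have "x - \<pi> x \<in> W" using base[OF step(1)] D(1) subspace_0[OF W] by auto
      then have "scale c (x - \<pi> x) + (y - \<pi> y) \<in> W"
        using step(2) W by (intro subspace_add subspace_scale)
      then show ?case by (simp add: p.add p.scale scale_right_diff_distrib algebra_simps)
    qed (simp add: subspace_0[OF W])
  qed
  have 2: "\<pi> w = 0" if "w \<in> W" for w
  proof -
    have "w \<in> span D" using that D(3) by auto
    then show ?thesis
      by (induction rule: span_induct_alt) (use E(1) base in \<open>auto simp: p.add p.scale\<close>)
  qed
  show ?thesis using that[OF lin 1 2] .
qed

text \<open>The kernel of \<open>\<pi>\<close> is W, so a relation among the images is a relation in
  W, and B is carried bijectively to a basis of the image of V. This frees \<open>quot_dim\<close>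
  from the choice of B.\<close>

lemma quot_basis_card:
  assumes lin: "Vector_Spaces.linear scale scale \<pi>" and p1: "\<And>v. v - \<pi> v \<in> W" and p2: "\<And>w. w \<in> W \<Longrightarrow> \<pi> w = 0"
    and B: "quot_basis scale B V W"
  shows "inj_on \<pi> B" "independent (\<pi> ` B)" "card B = dim (\<pi> ` V)"
proof -
  interpret p: Vector_Spaces.linear scale scale \<pi> by (rule lin)
  have B: "B \<subseteq> V" "V \<subseteq> span (B \<union> W)"
     and indB: "\<forall>t u. finite t \<and> t \<subseteq> B \<and> (\<Sum>v\<in>t. scale (u v) v) \<in> W \<longrightarrow> (\<forall>v\<in>t. u v = 0)"
    using B unfolding quot_basis_def by simp_all
  have ind: "u v = 0" if "finite t" "t \<subseteq> B" "(\<Sum>v\<in>t. scale (u v) v) \<in> W" "v \<in> t" for t u v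
    using indB that by metis
  have W: "x \<in> W" if "\<pi> x = 0" for x using p1[of x] that by simp
  show inj: "inj_on \<pi> B"
  proof (rule inj_onI, rule ccontr)
    fix x y assume xy: "x \<in> B" "y \<in> B" "\<pi> x = \<pi> y" "x \<noteq> y"
    define u where "u v = (if v = x then 1 else - 1 :: 'a)" for v
    have "(\<Sum>v\<in>{x,y}. scale (u v) v) = x - y"
      using xy(4) by (simp add: u_def)
    moreover have "x - y \<in> W" using xy by (intro W) (simp add: p.diff)
    ultimately have "u x = 0" using ind[of "{x,y}" u x] xy by auto
    then show False by (simp add: u_def)
  qed
  show indep: "independent (\<pi> ` B)"
    unfolding independent_explicit_finite_subsets
  proof (intro allI ballI impI)
    fix S u v assume S: "S \<subseteq> \<pi> ` B" "finite S" "(\<Sum>v\<in>S. scale (u v) v) = 0" "v \<in> S"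
    obtain t where t: "t \<subseteq> B" "finite t" "S = \<pi> ` t"
      using S(1,2) by (metis finite_subset_image)
    have injt: "inj_on \<pi> t" using inj t(1) inj_on_subset by blast
    have "\<pi> (\<Sum>x\<in>t. scale (u (\<pi> x)) x) = (\<Sum>v\<in>S. scale (u v) v)"
      unfolding t(3) by (simp add: sum.reindex[OF injt] p.sum p.scale)
    then have "(\<Sum>x\<in>t. scale (u (\<pi> x)) x) \<in> W" using S(3) by (intro W) simp
    then have "\<forall>x\<in>t. u (\<pi> x) = 0" using ind[OF t(2,1), of "\<lambda>x. u (\<pi> x)"] by auto
    then show "u v = 0" using S(4) t(3) by auto
  qed
  have "\<pi> ` V \<subseteq> span (\<pi> ` B)"
  proof -
    have "\<pi> ` V \<subseteq> \<pi> ` span (B \<union> W)" using B(2) by auto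
    also have "\<dots> = span (\<pi> ` B \<union> \<pi> ` W)" by (simp add: p.span_image[symmetric] image_Un)
    also have "\<dots> \<subseteq> span (\<pi> ` B)"
      by (intro span_minimal) (auto simp: p2 span_base span_zero)
    finally show ?thesis .
  qed
  then have "card (\<pi> ` B) = dim (\<pi> ` V)"
    using B(1) indep by (intro basis_card_eq_dim) auto
  then show "card B = dim (\<pi> ` V)" by (simp add: card_image[OF inj])
qed

lemma quot_basis_same_card:
  assumes "subspace W" "quot_basis scale B V W" "quot_basis scale C V W"
  shows "card B = card C"
proof -
  obtain \<pi> where "Vector_Spaces.linear scale scale \<pi>" "\<And>v. v - \<pi> v \<in> W" "\<And>w. w \<in> W \<Longrightarrow> \<pi> w = 0"
    using exists_projection[OF assms(1)] by metis
  from quot_basis_card(3)[OF this assms(2)] quot_basis_card(3)[OF this assms(3)] show ?thesis by simp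
qed

lemma quot_dim_eq_card:
  assumes "subspace W" "quot_basis scale B V W"
  shows "quot_dim scale V W = card B"
  unfolding quot_dim_def
  by (rule quot_basis_same_card[OF assms(1) _ assms(2)]) (rule someI[of "\<lambda>B. quot_basis scale B V W", OF assms(2)])

lemma quot_basis_exists:
  assumes "subspace W" "W \<subseteq> V"
  shows "\<exists>B. quot_basis scale B V W"
proof -
  obtain D where D: "D \<subseteq> W" "independent D" "W \<subseteq> span D"
    using maximal_independent_subset[of W] by metis
  obtain E where E: "D \<subseteq> E" "E \<subseteq> V" "independent E" "V \<subseteq> span E"
    using maximal_independent_subset_extend[OF order_trans[OF D(1) assms(2)] D(2)] by blast
  have "quot_basis scale (E - D) V W"
    unfolding quot_basis_def
  proof (intro conjI allI impI ballI)
    show "E - D \<subseteq> V" using E by auto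
    have "span E \<subseteq> span (E - D \<union> W)"
      by (rule span_mono) (use D(1) in auto)
    then show "V \<subseteq> span (E - D \<union> W)" using E(4) by auto
    fix t u v assume t: "finite t \<and> t \<subseteq> E - D \<and> (\<Sum>v\<in>t. scale (u v) v) \<in> W" and v: "v \<in> t"
    then have "(\<Sum>v\<in>t. scale (u v) v) \<in> span D" using D by auto
    then obtain r where r: "finite {x. r x \<noteq> 0}" "\<And>x. r x \<noteq> 0 \<Longrightarrow> x \<in> D"
       "(\<Sum>v\<in>t. scale (u v) v) = (\<Sum>x | r x \<noteq> 0. scale (r x) x)"
      unfolding span_explicit' by force
    let ?S = "t \<union> {x. r x \<noteq> 0}"
    define w where "w x = (if x \<in> t then u x else - r x)" for x
    have disj: "t \<inter> {x. r x \<noteq> 0} = {}" using t r(2) by auto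
    have "(\<Sum>x\<in>?S. scale (w x) x) = (\<Sum>x\<in>t. scale (w x) x) + (\<Sum>x | r x \<noteq> 0. scale (w x) x)"
      using t r(1) disj by (intro sum.union_disjoint) auto
    also have "(\<Sum>x\<in>t. scale (w x) x) = (\<Sum>v\<in>t. scale (u v) v)"
      by (intro sum.cong) (auto simp: w_def)
    also have "(\<Sum>x | r x \<noteq> 0. scale (w x) x) = - (\<Sum>x | r x \<noteq> 0. scale (r x) x)"
      unfolding sum_negf[symmetric] using disj by (intro sum.cong) (auto simp: w_def)
    finally have "(\<Sum>x\<in>?S. scale (w x) x) = 0" using r(3) by simp
    then have "w v = 0"
      using independentD[OF E(3), of ?S w v] t r v E(1) by auto
    then show "u v = 0" using v by (simp add: w_def)
  qed
  then show ?thesis by blast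
qed

text \<open>Equal values of \<open>e\<close> at two indices would be a relation with coefficients 1
  and -1, so the family is injective and its image is a basis of the quotient. In this indexed form
  a basis can be assembled from several local ones.\<close>

lemma quot_dim_family:
  assumes W: "subspace W" "W \<subseteq> V" and I: "finite I" and e: "\<And>i. i \<in> I \<Longrightarrow> e i \<in> V"
    and sp: "\<And>v. v \<in> V \<Longrightarrow> \<exists>c. v - (\<Sum>i\<in>I. scale (c i) (e i)) \<in> W"
    and ind: "\<And>c i. (\<Sum>i\<in>I. scale (c i) (e i)) \<in> W \<Longrightarrow> i \<in> I \<Longrightarrow> c i = 0"
  shows "quot_dim scale V W = card I"
proof -
  have inj: "inj_on e I"
  proof (rule inj_onI, rule ccontr)
    fix x y assume xy: "x \<in> I" "y \<in> I" "e x = e y" "x \<noteq> y"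
    define c where "c i = (if i = x then 1 else if i = y then - 1 else 0 :: 'a)" for i
    have "(\<Sum>i\<in>I. scale (c i) (e i)) = (\<Sum>i\<in>{x,y}. scale (c i) (e i))"
      using xy I by (intro sum.mono_neutral_right) (auto simp: c_def)
    also have "\<dots> = 0" using xy by (simp add: c_def)
    finally have "c x = 0" using ind[of c x] xy subspace_0[OF W(1)] by auto
    then show False by (simp add: c_def)
  qed
  have "quot_basis scale (e ` I) V W"
    unfolding quot_basis_def
  proof (intro conjI allI impI ballI)
    show "e ` I \<subseteq> V" using e by auto
    show "V \<subseteq> span (e ` I \<union> W)"
    proof
      fix v assume "v \<in> V"
      then obtain c where c: "v - (\<Sum>i\<in>I. scale (c i) (e i)) \<in> W" using sp by blast
      have "(v - (\<Sum>i\<in>I. scale (c i) (e i))) + (\<Sum>i\<in>I. scale (c i) (e i)) \<in> span (e ` I \<union> W)"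
        using c by (intro span_add span_sum span_scale) (auto intro: span_base)
      then show "v \<in> span (e ` I \<union> W)" by simp
    qed
    fix t u v assume t: "finite t \<and> t \<subseteq> e ` I \<and> (\<Sum>v\<in>t. scale (u v) v) \<in> W" and v: "v \<in> t"
    define c where "c i = (if e i \<in> t then u (e i) else 0)" for i
    have "(\<Sum>i\<in>I. scale (c i) (e i)) = (\<Sum>x\<in>e ` I. scale (if x \<in> t then u x else 0) x)"
      by (simp add: sum.reindex[OF inj] c_def)
    also have "\<dots> = (\<Sum>x\<in>t. scale (if x \<in> t then u x else 0) x)"
      using t I by (intro sum.mono_neutral_right) auto
    also have "\<dots> = (\<Sum>x\<in>t. scale (u x) x)" by (intro sum.cong) auto
    finally have "(\<Sum>i\<in>I. scale (c i) (e i)) \<in> W" using t by simp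
    moreover obtain i where "i \<in> I" "v = e i" using t v by auto
    ultimately show "u v = 0" using ind[of c i] v by (auto simp: c_def)
  qed
  from quot_dim_eq_card[OF W(1) this] show ?thesis by (simp add: card_image[OF inj])
qed

lemma quot_basis_finite:
  assumes W: "subspace W" and B: "quot_basis scale B V W" and S: "finite S" "V \<subseteq> span (S \<union> W)"
  shows "finite B"
proof -
  obtain \<pi> where p: "Vector_Spaces.linear scale scale \<pi>" "\<And>v. v - \<pi> v \<in> W" "\<And>w. w \<in> W \<Longrightarrow> \<pi> w = 0"
    using exists_projection[OF W] by metis
  interpret p: Vector_Spaces.linear scale scale \<pi> by (rule p(1))
  note qb = quot_basis_card[OF p B]
  have "\<pi> ` B \<subseteq> \<pi> ` span (S \<union> W)" using B S(2) unfolding quot_basis_def by auto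
  also have "\<dots> = span (\<pi> ` S \<union> \<pi> ` W)" by (simp add: p.span_image[symmetric] image_Un)
  also have "\<dots> \<subseteq> span (\<pi> ` S)"
    by (intro span_minimal) (auto simp: p(3) span_base span_zero)
  finally have "finite (\<pi> ` B)" using independent_span_bound[of "\<pi> ` S" "\<pi> ` B"] qb S(1) by auto
  then show ?thesis using qb(1) finite_imageD by blast
qed

lemma quot_basis_family:
  assumes W: "subspace W" and B: "quot_basis scale B V W" "finite B"
  shows "v \<in> V \<Longrightarrow> \<exists>c. v - (\<Sum>b\<in>B. scale (c b) b) \<in> W"
    and "(\<Sum>b\<in>B. scale (c b) b) \<in> W \<Longrightarrow> b \<in> B \<Longrightarrow> c b = 0"
proof -
  show "\<exists>c. v - (\<Sum>b\<in>B. scale (c b) b) \<in> W" if "v \<in> V"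
  proof -
    have "v \<in> span (B \<union> W)" using B that unfolding quot_basis_def by auto
    then obtain x y where xy: "v = x + y" "x \<in> span B" "y \<in> span W"
      unfolding span_Un by auto
    obtain c where "x = (\<Sum>b\<in>B. scale (c b) b)" using xy(2) span_finite[OF B(2)] by auto
    moreover have "y \<in> W" using xy(3) span_minimal[OF order_refl W] by auto
    ultimately show ?thesis using xy(1) by (intro exI[of _ c]) simp
  qed
  show "c b = 0" if "(\<Sum>b\<in>B. scale (c b) b) \<in> W" "b \<in> B"
  proof -
    have "\<forall>t u. finite t \<and> t \<subseteq> B \<and> (\<Sum>v\<in>t. scale (u v) v) \<in> W \<longrightarrow> (\<forall>v\<in>t. u v = 0)"
      using B unfolding quot_basis_def by simp
    then show ?thesis using that B(2) by blast
  qed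
qed

end

context Vector_Spaces.linear
begin

lemma fin_dim_image: "fin_dim s1 U \<Longrightarrow> fin_dim s2 (f ` U)"
  unfolding fin_dim_def fin_dim_def using spans_image by (metis finite_imageI)

lemma rank_nullity:
  assumes U: "vs1.subspace U" "fin_dim s1 U"
  shows "vs1.dim U = vs1.dim {u \<in> U. f u = 0} + vs2.dim (f ` U)"
proof -
  let ?N = "{u \<in> U. f u = 0}"
  obtain B where B: "finite B" "B \<subseteq> ?N" "vs1.independent B" "?N \<subseteq> vs1.span B" "card B = vs1.dim ?N"
    using vs1.fin_dim_basis[OF vs1.fin_dim_subset[OF U(2)]] by (metis (no_types, lifting) mem_Collect_eq subsetI)
  obtain C where C: "B \<subseteq> C" "C \<subseteq> U" "vs1.independent C" "U \<subseteq> vs1.span C"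
    using vs1.maximal_independent_subset_extend[of B U] B by blast
  have fC: "finite C" using vs1.fin_dim_independent_finite[OF U(2) C(3,2)] .
  have spU: "vs1.span (C - B) \<subseteq> U" using C(2) U(1) by (intro vs1.span_minimal) auto
  have inj: "inj_on f (vs1.span (C - B))"
    unfolding inj_on_iff_eq_0[OF vs1.subspace_span]
  proof (intro ballI impI)
    fix x assume x: "x \<in> vs1.span (C - B)" "f x = 0"
    then have "x \<in> vs1.span B" using B(4) spU by auto
    then obtain r where r: "x = (\<Sum>v\<in>B. s1 (r v) v)" using vs1.span_finite[OF B(1)] by auto
    obtain q where q: "x = (\<Sum>v\<in>C - B. s1 (q v) v)" using x(1) vs1.span_finite[of "C - B"] fC by auto
    define w where "w v = (if v \<in> B then r v else - q v)" for v
    have "(\<Sum>v\<in>C. s1 (w v) v) = (\<Sum>v\<in>B. s1 (w v) v) + (\<Sum>v\<in>C - B. s1 (w v) v)"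
      using sum.subset_diff[OF C(1) fC, of "\<lambda>v. s1 (w v) v"] by (simp add: add.commute)
    also have "(\<Sum>v\<in>B. s1 (w v) v) = x" unfolding r by (intro sum.cong) (auto simp: w_def)
    also have "(\<Sum>v\<in>C - B. s1 (w v) v) = - x" unfolding q sum_negf[symmetric] by (intro sum.cong) (auto simp: w_def)
    finally have "w v = 0" if "v \<in> C" for v
      using vs1.independentD[OF C(3) fC, of w v] that by auto
    then have "\<forall>v\<in>B. r v = 0" using C(1) by (force simp: w_def)
    then show "x = 0" by (simp add: r)
  qed
  have injC: "inj_on f (C - B)" using inj vs1.span_superset inj_on_subset by blast
  have ind: "vs2.independent (f ` (C - B))"
    using independent_injective_image[OF vs1.independent_mono[OF C(3)] inj] by auto
  have "f ` U \<subseteq> vs2.span (f ` (C - B))"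
  proof -
    have "f ` U \<subseteq> vs2.span (f ` C)" using spans_image[OF C(4)] .
    also have "\<dots> \<subseteq> vs2.span (f ` (C - B))"
    proof (intro vs2.span_minimal image_subsetI)
      fix x assume "x \<in> C"
      then show "f x \<in> vs2.span (f ` (C - B))"
        using B(2) vs2.span_zero by (cases "x \<in> B") (auto intro: vs2.span_base)
    qed auto
    finally show ?thesis .
  qed
  then have "card (f ` (C - B)) = vs2.dim (f ` U)"
    using C(2) ind by (intro vs2.basis_card_eq_dim) auto
  moreover have "card C = vs1.dim U" using C by (intro vs1.basis_card_eq_dim)
  moreover have "card (f ` (C - B)) = card C - card B"
    using card_image[OF injC] card_Diff_subset[OF B(1) C(1)] by simp
  moreover have "card B \<le> card C" using fC C(1) by (rule card_mono)
  ultimately show ?thesis using B(5) by simp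
qed

lemma dim_image_inj:
  assumes "vs1.subspace U" "fin_dim s1 U" "\<And>u. u \<in> U \<Longrightarrow> f u = 0 \<Longrightarrow> u = 0"
  shows "vs2.dim (f ` U) = vs1.dim U"
proof -
  have "{u \<in> U. f u = 0} = {0}" using assms(1,3) vs1.subspace_0 by auto
  then show ?thesis using rank_nullity[OF assms(1,2)] by simp
qed

text \<open>Rank-nullity is applied twice: to \<open>\<pi>\<close> on f U + W, with kernel W, and to
  \<open>\<pi>\<close> after f on U, with the same image. Most of the Hilbert functions below are
  computed by this count.\<close>

lemma dim_image_plus:
  assumes U: "vs1.subspace U" "fin_dim s1 U" and W: "vs2.subspace W" "fin_dim s2 W"
  shows "vs2.dim {f u + w | u w. u \<in> U \<and> w \<in> W} + vs1.dim {u \<in> U. f u \<in> W} = vs1.dim U + vs2.dim W"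
proof -
  obtain \<pi> where p: "Vector_Spaces.linear s2 s2 \<pi>" "\<And>v. v - \<pi> v \<in> W" "\<And>w. w \<in> W \<Longrightarrow> \<pi> w = 0"
    using vs2.exists_projection[OF W(1)] by metis
  have ker: "\<pi> v = 0 \<longleftrightarrow> v \<in> W" for v using p(2)[of v] p(3)[of v] by auto
  interpret p: Vector_Spaces.linear s2 s2 \<pi> by (rule p(1))
  interpret c: Vector_Spaces.linear s1 s2 "\<pi> \<circ> f"
    by (rule Vector_Spaces.linear_compose) (unfold_locales)
  let ?V = "{f u + w | u w. u \<in> U \<and> w \<in> W}"
  have Veq: "?V = {x + y |x y. x \<in> f ` U \<and> y \<in> W}" by blast
  have sV: "vs2.subspace ?V" unfolding Veq
    by (intro vs2.subspace_sums subspace_image U W)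
  have fV: "fin_dim s2 ?V"
  proof -
    obtain A B where "finite A" "f ` U \<subseteq> vs2.span A" "finite B" "W \<subseteq> vs2.span B"
      using fin_dim_image[OF U(2)] W(2) unfolding fin_dim_def by auto
    then have "?V \<subseteq> vs2.span (A \<union> B)" "finite (A \<union> B)" unfolding Veq vs2.span_Un by blast+
    then show ?thesis unfolding fin_dim_def by blast
  qed
  have "{v \<in> ?V. \<pi> v = 0} = W"
  proof -
    have "w \<in> ?V" if "w \<in> W" for w
      using that vs1.subspace_0[OF U(1)] zero by (metis (mono_tags, lifting) add_0 mem_Collect_eq)
    then show ?thesis by (auto simp: ker)
  qed
  moreover have "\<pi> ` ?V = (\<pi> \<circ> f) ` U"
  proof (intro equalityI subsetI)
    fix x assume "x \<in> \<pi> ` ?V"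
    then show "x \<in> (\<pi> \<circ> f) ` U" by (auto simp: p.add p(3))
  next
    fix x assume "x \<in> (\<pi> \<circ> f) ` U"
    then obtain u where "u \<in> U" "x = \<pi> (f u + 0)" by auto
    then show "x \<in> \<pi> ` ?V" using vs2.subspace_0[OF W(1)] by blast
  qed
  moreover have "{u \<in> U. (\<pi> \<circ> f) u = 0} = {u \<in> U. f u \<in> W}" by (simp add: ker)
  ultimately show ?thesis using p.rank_nullity[OF sV fV] c.rank_nullity[OF U] by simp
qed

end

context vector_space
begin

lemma dim_quot:
  assumes V: "subspace V" "fin_dim scale V" and W: "subspace W" "W \<subseteq> V"
  shows "dim V = dim W + quot_dim scale V W"
proof -
  obtain B where B: "quot_basis scale B V W" using quot_basis_exists[OF W] by blast
  obtain \<pi> where p: "Vector_Spaces.linear scale scale \<pi>" "\<And>v. v - \<pi> v \<in> W" "\<And>w. w \<in> W \<Longrightarrow> \<pi> w = 0"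
    using exists_projection[OF W(1)] by metis
  interpret p: Vector_Spaces.linear scale scale \<pi> by (rule p(1))
  have "{v \<in> V. \<pi> v = 0} = W"
  proof (intro equalityI subsetI CollectI conjI)
    fix v assume "v \<in> {v \<in> V. \<pi> v = 0}"
    then show "v \<in> W" using p(2)[of v] by simp
  qed (use p(3) W(2) in auto)
  then show ?thesis
    using p.rank_nullity[OF V] quot_dim_eq_card[OF W(1) B] quot_basis_card(3)[OF p B] by simp
qed

end

section \<open>Forms\<close>

lemma mono_deg_eq: "mono_deg m = Poly_Mapping.lookup m 0 + Poly_Mapping.lookup m 1 + Poly_Mapping.lookup m 2"
  unfolding mono_deg_def UNIV_3 by simp

lemma mono_deg_add: "mono_deg (m + n) = mono_deg m + mono_deg n"
  by (simp add: mono_deg_eq lookup_add)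

lemma homog_zero [simp]: "0 \<in> homog k"
  by (simp add: homog_def)

lemma homog_add: "p \<in> homog k \<Longrightarrow> q \<in> homog k \<Longrightarrow> p + q \<in> homog k"
  using keys_add[of p q] by (auto simp: homog_def)

lemma homog_mult: "p \<in> homog j \<Longrightarrow> q \<in> homog k \<Longrightarrow> p * q \<in> homog (j + k)"
  using keys_mult[of p q] by (force simp: homog_def mono_deg_add)

lemma homog_const: "const3 c \<in> homog 0"
  by (auto simp: homog_def const3_def mono_deg_eq)

lemma homog_one: "1 \<in> homog 0"
  using homog_const[of 1] by (simp add: const3_1)

lemma homog_var: "var3 i \<in> homog 1"
  using exhaust_3[of i] by (auto simp: homog_def var3_def mono_deg_eq lookup_single)

lemma homog_const_mult: "p \<in> homog k \<Longrightarrow> const3 c * p \<in> homog k"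
  using homog_mult[OF homog_const, of p k c] by simp

lemma homog_uminus: "p \<in> homog k \<Longrightarrow> - p \<in> homog k"
  by (simp add: homog_def in_keys_iff)

lemma homog_diff: "p \<in> homog k \<Longrightarrow> q \<in> homog k \<Longrightarrow> p - q \<in> homog k"
  using homog_add[of p k "- q"] homog_uminus by simp

lemma homog_sum: "(\<And>x. x \<in> A \<Longrightarrow> F x \<in> homog k) \<Longrightarrow> sum F A \<in> homog k"
  by (induction A rule: infinite_finite_induct) (auto intro: homog_add)

lemma homog_power: "p \<in> homog k \<Longrightarrow> p ^ n \<in> homog (int n * k)"
proof (induction n)
  case (Suc n)
  then show ?case using homog_mult[of p k "p ^ n" "int n * k"] by (simp add: algebra_simps)
qed (simp add: homog_one)

lemma homog_prod: "(\<And>x. x \<in> A \<Longrightarrow> F x \<in> homog (k x)) \<Longrightarrow> prod F A \<in> homog (sum k A)"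
  by (induction A rule: infinite_finite_induct) (auto intro: homog_mult simp: homog_one)

lemma subspace_homog: "S.subspace (homog k)"
  by (rule S.subspaceI) (auto simp: scale3_def homog_add homog_const_mult)

lemma homog_neg: "k < 0 \<Longrightarrow> homog k = {0}"
proof -
  assume "k < 0"
  then have "Poly_Mapping.keys p = {}" if "p \<in> homog k" for p :: poly3
    using that by (fastforce simp: homog_def)
  then show ?thesis by auto
qed

lemma homog_0_const:
  assumes "p \<in> homog 0"
  shows "p = const3 (Poly_Mapping.lookup p 0)"
proof -
  have "m = 0" if "Poly_Mapping.lookup p m \<noteq> 0" for m
  proof -
    have "mono_deg m = 0" using that assms by (auto simp: homog_def in_keys_iff)
    then show ?thesis by (subst mono3_eq[of m]) (simp add: mono_deg_eq)
  qed
  then show ?thesis by (intro poly_mapping_eqI) (auto simp: const3_def lookup_single when_def)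
qed

lemma homog_pd: "p \<in> homog k \<Longrightarrow> pd i p \<in> homog (k - 1)"
proof -
  assume p: "p \<in> homog k"
  have "Poly_Mapping.single (m - Poly_Mapping.single i 1) (of_nat (Poly_Mapping.lookup m i) * Poly_Mapping.lookup p m) \<in> homog (k - 1)"
    if m: "m \<in> Poly_Mapping.keys p" for m
  proof (cases "Poly_Mapping.lookup m i = 0")
    case False
    let ?n = "m - Poly_Mapping.single i 1"
    have "?n + Poly_Mapping.single i 1 = m"
      using False by (intro poly_mapping_eqI) (auto simp: lookup_add lookup_minus lookup_single when_def)
    then have "mono_deg m = mono_deg ?n + mono_deg (Poly_Mapping.single i 1)"
      by (metis mono_deg_add)
    moreover have "mono_deg (Poly_Mapping.single i 1) = 1"
      using exhaust_3[of i] by (auto simp: mono_deg_eq lookup_single)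
    moreover have "int (mono_deg m) = k" using p m by (auto simp: homog_def)
    ultimately show ?thesis by (auto simp: homog_def)
  qed simp
  then show ?thesis unfolding pd_def by (intro homog_sum)
qed

text \<open>Unlike \<open>poly3_induct\<close> it never leaves the degree k, as required by
  statements that involve the degree, such as Euler's relation.\<close>

lemma homog_induct [consumes 1, case_names zero add monomial]:
  assumes "p \<in> homog k" and "P 0"
    and add: "\<And>p q. p \<in> homog k \<Longrightarrow> q \<in> homog k \<Longrightarrow> P p \<Longrightarrow> P q \<Longrightarrow> P (p + q)"
    and mon: "\<And>c a b e. int a + int b + int e = k \<Longrightarrow> P (const3 c * var3 0 ^ a * var3 1 ^ b * var3 2 ^ e)"
  shows "P p"
proof -
  let ?s = "\<lambda>m. Poly_Mapping.single m (Poly_Mapping.lookup p m)"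
  have "P (\<Sum>m\<in>A. ?s m)" if "finite A" "A \<subseteq> Poly_Mapping.keys p" for A
    using that
  proof (induction A rule: finite_induct)
    case (insert m A)
    have h: "?s m \<in> homog k" if "m \<in> Poly_Mapping.keys p" for m
      using that assms(1) by (auto simp: homog_def)
    have "int (mono_deg m) = k" using insert assms(1) by (auto simp: homog_def)
    then have "P (?s m)" unfolding single_eq_var3 by (intro mon) (simp add: mono_deg_eq)
    then show ?case using insert h by (auto intro!: add homog_sum)
  qed (simp add: assms(2))
  from this[OF finite_keys order_refl] show ?thesis by (simp flip: poly3_eq_sum_single)
qed

lemma euler: "p \<in> homog k \<Longrightarrow> var3 0 * pd 0 p + var3 1 * pd 1 p + var3 2 * pd 2 p = const3 (of_int k) * p"
proof (induction rule: homog_induct)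
  case (add p q)
  have "var3 0 * pd 0 (p + q) + var3 1 * pd 1 (p + q) + var3 2 * pd 2 (p + q) =
      (var3 0 * pd 0 p + var3 1 * pd 1 p + var3 2 * pd 2 p) + (var3 0 * pd 0 q + var3 1 * pd 1 q + var3 2 * pd 2 q)"
    by (simp add: pd_add algebra_simps)
  then show ?case using add by (simp add: distrib_left)
next
  case (monomial c a b e)
  have x: "var3 i * pd i (var3 i ^ n) = of_nat n * var3 i ^ n" for i n
    unfolding pd_power by (cases n) (simp_all add: pd_var ac_simps)
  have y: "pd i (var3 j ^ n) = 0" if "i \<noteq> j" for i j n
    using that by (simp add: pd_power pd_var)
  let ?m = "const3 c * var3 0 ^ a * var3 1 ^ b * var3 2 ^ e"
  have "var3 0 * pd 0 ?m = of_nat a * ?m"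
  proof -
    have "var3 0 * pd 0 ?m = const3 c * (var3 0 * pd 0 (var3 0 ^ a)) * var3 1 ^ b * var3 2 ^ e"
      by (simp add: pd_mult y ac_simps)
    then show ?thesis by (simp only: x ac_simps)
  qed
  moreover have "var3 1 * pd 1 ?m = of_nat b * ?m"
  proof -
    have "var3 1 * pd 1 ?m = const3 c * var3 0 ^ a * (var3 1 * pd 1 (var3 1 ^ b)) * var3 2 ^ e"
      by (simp add: pd_mult y ac_simps)
    then show ?thesis by (simp only: x ac_simps)
  qed
  moreover have "var3 2 * pd 2 ?m = of_nat e * ?m"
  proof -
    have "var3 2 * pd 2 ?m = const3 c * var3 0 ^ a * var3 1 ^ b * (var3 2 * pd 2 (var3 2 ^ e))"
      by (simp add: pd_mult y ac_simps)
    then show ?thesis by (simp only: x ac_simps)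
  qed
  moreover have "const3 (of_int k) = of_nat a + of_nat b + of_nat e"
    using monomial by (simp add: const3_add const3_of_nat flip: monomial)
  ultimately show ?case by (simp only: distrib_right)
qed auto

section \<open>Homogeneous components and the top degree\<close>

definition hcomp :: "int \<Rightarrow> poly3 \<Rightarrow> poly3" where
  "hcomp k p = Poly_Mapping.Abs_poly_mapping (\<lambda>m. Poly_Mapping.lookup p m when int (mono_deg m) = k)"

lemma lookup_hcomp: "Poly_Mapping.lookup (hcomp k p) m = (Poly_Mapping.lookup p m when int (mono_deg m) = k)"
proof -
  have "finite {m. (Poly_Mapping.lookup p m when int (mono_deg m) = k) \<noteq> 0}"
    by (rule finite_subset[OF _ finite_keys[of p]]) (auto simp: in_keys_iff when_def)
  then show ?thesis unfolding hcomp_def by simp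
qed

lemma hcomp_homog: "hcomp k p \<in> homog k"
  by (auto simp: homog_def in_keys_iff lookup_hcomp when_def split: if_splits)

lemma hcomp_add: "hcomp k (p + q) = hcomp k p + hcomp k q"
  by (rule poly_mapping_eqI) (simp add: lookup_hcomp lookup_add when_def)

lemma hcomp_zero [simp]: "hcomp k 0 = 0"
  by (rule poly_mapping_eqI) (simp add: lookup_hcomp)

lemma hcomp_diff: "hcomp k (p - q) = hcomp k p - hcomp k q"
  by (rule poly_mapping_eqI) (simp add: lookup_hcomp lookup_minus when_def)

lemma hcomp_sum: "hcomp k (sum F A) = (\<Sum>x\<in>A. hcomp k (F x))"
  by (induction A rule: infinite_finite_induct) (auto simp: hcomp_add)

lemma hcomp_of_homog: "p \<in> homog j \<Longrightarrow> hcomp k p = (if k = j then p else 0)"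
  by (rule poly_mapping_eqI) (auto simp: lookup_hcomp when_def homog_def in_keys_iff)

lemma hcomp_homog_id: "p \<in> homog k \<Longrightarrow> hcomp k p = p"
  by (simp add: hcomp_of_homog)

lemma poly3_eq_sum_hcomp:
  assumes "finite A" "(\<lambda>m. int (mono_deg m)) ` Poly_Mapping.keys p \<subseteq> A"
  shows "p = (\<Sum>k\<in>A. hcomp k p)"
proof (rule poly_mapping_eqI)
  fix m
  have "(\<Sum>k\<in>A. Poly_Mapping.lookup p m when int (mono_deg m) = k) = Poly_Mapping.lookup p m"
  proof (cases "Poly_Mapping.lookup p m = 0")
    case False
    then have "int (mono_deg m) \<in> A" using assms(2) by (auto simp: in_keys_iff)
    then show ?thesis using assms(1) by (simp add: when_def)
  qed simp
  then show "Poly_Mapping.lookup p m = Poly_Mapping.lookup (\<Sum>k\<in>A. hcomp k p) m"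
    by (simp add: lookup_sum lookup_hcomp)
qed

lemma poly3_decomp: obtains n where "p = (\<Sum>k\<in>{0..int n}. hcomp k p)" "\<And>k. k \<notin> {0..int n} \<Longrightarrow> hcomp k p = 0"
proof -
  define n where "n = (\<Sum>m\<in>Poly_Mapping.keys p. mono_deg m)"
  have le: "mono_deg m \<le> n" if "m \<in> Poly_Mapping.keys p" for m
    unfolding n_def using that by (intro member_le_sum) auto
  have "p = (\<Sum>k\<in>{0..int n}. hcomp k p)"
    by (rule poly3_eq_sum_hcomp) (use le in auto)
  moreover have "hcomp k p = 0" if "k \<notin> {0..int n}" for k
    using that le by (intro poly_mapping_eqI) (force simp: lookup_hcomp when_def in_keys_iff)
  ultimately show ?thesis using that by blast
qed

lemma hcomp_eq_0_imp: "(\<And>k. hcomp k p = 0) \<Longrightarrow> p = 0"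
  using poly3_decomp[of p] by (metis sum.neutral)

lemma hcomp_mult_homog:
  assumes "q \<in> homog j"
  shows "hcomp k (p * q) = hcomp (k - j) p * q"
proof -
  obtain n where n: "p = (\<Sum>i\<in>{0..int n}. hcomp i p)" "\<And>i. i \<notin> {0..int n} \<Longrightarrow> hcomp i p = 0"
    using poly3_decomp[of p] by metis
  have "hcomp k (p * q) = hcomp k ((\<Sum>i\<in>{0..int n}. hcomp i p) * q)"
    using n(1) by simp
  also have "\<dots> = (\<Sum>i\<in>{0..int n}. hcomp k (hcomp i p * q))"
    by (simp add: sum_distrib_right hcomp_sum)
  also have "\<dots> = (\<Sum>i\<in>{0..int n}. if i = k - j then hcomp i p * q else 0)"
    using hcomp_of_homog[OF homog_mult[OF hcomp_homog assms]] by (intro sum.cong) auto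
  also have "\<dots> = hcomp (k - j) p * q"
    using n(2)[of "k - j"] by (simp add: sum.delta)
  finally show ?thesis .
qed

lemma hcomp_homog_mult: "q \<in> homog j \<Longrightarrow> hcomp k (q * p) = q * hcomp (k - j) p"
  using hcomp_mult_homog[of q j k p] by (simp add: mult.commute)

text \<open>Components of p in degrees other than j are annihilated by q, and S is a domain.\<close>

lemma homog_cancel:
  assumes "p * q \<in> homog (j + k)" "q \<in> homog k" "q \<noteq> 0"
  shows "p \<in> homog j"
proof -
  have "hcomp i p = 0" if "i \<noteq> j" for i
  proof -
    have "hcomp i p * q = hcomp (i + k) (p * q)" using hcomp_mult_homog[OF assms(2), of "i + k" p] by simp
    also have "\<dots> = 0" using hcomp_of_homog[OF assms(1)] that by simp
    finally show ?thesis using assms(3) by simp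
  qed
  then have "hcomp i (p - hcomp j p) = 0" for i
    using hcomp_of_homog[OF hcomp_homog, of i j p] by (simp add: hcomp_diff)
  then have "p = hcomp j p" using hcomp_eq_0_imp[of "p - hcomp j p"] by simp
  then show ?thesis using hcomp_homog by metis
qed

text \<open>For \<open>p = 0\<close> the set is empty and the maximum arbitrary; only nonzero
  polynomials are measured below.\<close>

definition top_deg :: "poly3 \<Rightarrow> int" where
  "top_deg p = Max {k. hcomp k p \<noteq> 0}"

lemma top_deg:
  assumes "p \<noteq> 0"
  shows "hcomp (top_deg p) p \<noteq> 0" "k > top_deg p \<Longrightarrow> hcomp k p = 0" "top_deg p \<ge> 0"
proof -
  obtain n where n: "\<And>k. k \<notin> {0..int n} \<Longrightarrow> hcomp k p = 0"
    using poly3_decomp[of p] by metis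
  then have "{k. hcomp k p \<noteq> 0} \<subseteq> {0..int n}" by blast
  then have fin: "finite {k. hcomp k p \<noteq> 0}" using finite_subset by blast
  have ne: "{k. hcomp k p \<noteq> 0} \<noteq> {}" using hcomp_eq_0_imp[of p] assms by blast
  show "hcomp (top_deg p) p \<noteq> 0" using Max_in[OF fin ne] by (simp add: top_deg_def)
  then show "top_deg p \<ge> 0" using n[of "top_deg p"] by (metis atLeastAtMost_iff)
  show "hcomp k p = 0" if "k > top_deg p"
    using Max_ge[OF fin, of k] that by (auto simp: top_deg_def)
qed

lemma top_deg_le_0_imp_const:
  assumes "p \<noteq> 0" "top_deg p \<le> 0"
  shows "p dvd 1"
proof -
  obtain n where n: "p = (\<Sum>k\<in>{0..int n}. hcomp k p)" using poly3_decomp by metis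
  also have "\<dots> = (\<Sum>k\<in>{0}. hcomp k p)"
    using top_deg(2)[OF assms(1)] assms(2) by (intro sum.mono_neutral_right) auto
  finally have "p \<in> homog 0" using hcomp_homog[of 0 p] by simp
  from homog_0_const[OF this] show ?thesis using const3_neq_0_unit assms(1) by (metis const3_zero)
qed

text \<open>With upper bounds a, b in place of the exact degrees the result can be applied again to
  a product, and a zero component causes no separate case.\<close>

lemma hcomp_mult_top:
  assumes "\<And>k. k > a \<Longrightarrow> hcomp k p = 0" "\<And>k. k > b \<Longrightarrow> hcomp k q = 0"
  shows "hcomp (a + b) (p * q) = hcomp a p * hcomp b q" "k > a + b \<Longrightarrow> hcomp k (p * q) = 0"
proof -
  obtain n where n: "p = (\<Sum>i\<in>{0..int n}. hcomp i p)" "\<And>i. i \<notin> {0..int n} \<Longrightarrow> hcomp i p = 0"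
    using poly3_decomp[of p] by metis
  have e: "hcomp k (p * q) = (\<Sum>i\<in>{0..int n}. hcomp i p * hcomp (k - i) q)" for k
  proof -
    have "hcomp k (p * q) = hcomp k ((\<Sum>i\<in>{0..int n}. hcomp i p) * q)" using n(1) by simp
    then show ?thesis by (simp add: sum_distrib_right hcomp_sum hcomp_homog_mult[OF hcomp_homog])
  qed
  have "hcomp (a + b) (p * q) = (\<Sum>i\<in>{0..int n}. if i = a then hcomp a p * hcomp b q else 0)"
    unfolding e
  proof (intro sum.cong refl)
    fix i
    show "hcomp i p * hcomp (a + b - i) q = (if i = a then hcomp a p * hcomp b q else 0)"
      using assms(1)[of i] assms(2)[of "a + b - i"] by (cases "i > a"; cases "i = a") auto
  qed
  then show "hcomp (a + b) (p * q) = hcomp a p * hcomp b q" using n(2)[of a] by (simp add: sum.delta)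
  assume "k > a + b"
  then have "hcomp i p * hcomp (k - i) q = 0" for i
    using assms(1)[of i] assms(2)[of "k - i"] by (cases "i > a") auto
  then show "hcomp k (p * q) = 0" by (simp only: e sum.neutral_const)
qed

lemma fin_dim_homog: "fin_dim scale3 (homog k)"
  and dim_homog: "int (S.dim (homog k)) = (if k < 0 then 0 else (k + 1) * (k + 2) div 2)"
proof -
  let ?M = "{m. int (mono_deg m) = k}"
  let ?e = "\<lambda>m. Poly_Mapping.single m (1::complex)"
  \<comment> \<open>A monomial of degree k is determined by its exponents at 0 and 1.\<close>
  define g where "g = (\<lambda>(i, j). Poly_Mapping.single (0::3) i + Poly_Mapping.single 1 j + Poly_Mapping.single 2 (nat k - i - j))"
  define A where "A = (SIGMA i:{..nat k}. {..nat k - i})"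
  have bij: "bij_betw g A ?M" if "k \<ge> 0"
  proof (rule bij_betwI[where g = "\<lambda>m. (Poly_Mapping.lookup m 0, Poly_Mapping.lookup m 1)"])
    show "g \<in> A \<rightarrow> ?M" using that by (auto simp: g_def A_def mono_deg_eq lookup_add lookup_single)
    show "(\<lambda>m. (Poly_Mapping.lookup m 0, Poly_Mapping.lookup m 1)) \<in> ?M \<rightarrow> A"
      by (auto simp: A_def mono_deg_eq)
    show "(Poly_Mapping.lookup (g x) 0, Poly_Mapping.lookup (g x) 1) = x" for x
      by (auto simp: g_def lookup_add lookup_single split: prod.split)
    fix m assume "m \<in> ?M"
    then have "nat k - Poly_Mapping.lookup m 0 - Poly_Mapping.lookup m 1 = Poly_Mapping.lookup m 2" by (auto simp: mono_deg_eq)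
    then show "g (Poly_Mapping.lookup m 0, Poly_Mapping.lookup m 1) = m" by (simp add: g_def flip: mono3_eq)
  qed
  have M0: "?M = {}" if "k < 0" using that by auto
  have finM: "finite ?M"
  proof (cases "k \<ge> 0")
    case True
    then show ?thesis using bij bij_betw_finite[of g A ?M] by (simp add: A_def)
  qed (use M0 in simp)
  have inj: "inj ?e"
    by (rule injI) (metis keys_single zero_neq_one singleton_inject)
  have sc: "scale3 c (?e m) = Poly_Mapping.single m c" for c m
    by (simp add: scale3_def const3_def mult_single)
  have sp: "homog k \<subseteq> S.span (?e ` ?M)"
  proof
    fix p assume p: "p \<in> homog k"
    have "(\<Sum>m\<in>Poly_Mapping.keys p. scale3 (Poly_Mapping.lookup p m) (?e m)) \<in> S.span (?e ` ?M)"
      using p by (intro S.span_sum S.span_scale S.span_base) (auto simp: homog_def)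
    then show "p \<in> S.span (?e ` ?M)" by (simp add: sc flip: poly3_eq_sum_single)
  qed
  show "fin_dim scale3 (homog k)"
    unfolding fin_dim_def using sp finM by blast
  have ind: "S.independent (?e ` ?M)"
    unfolding S.independent_explicit_finite_subsets
  proof (intro allI ballI impI)
    fix T u v assume T: "T \<subseteq> ?e ` ?M" "finite T" "(\<Sum>v\<in>T. scale3 (u v) v) = 0" "v \<in> T"
    obtain N where N: "T = ?e ` N" using T(1) unfolding subset_image_iff by blast
    have inN: "inj_on ?e N" by (rule inj_on_subset[OF inj subset_UNIV])
    have fN: "finite N" using T(2) unfolding N by (rule finite_imageD[OF _ inN])
    have "(\<Sum>m\<in>N. Poly_Mapping.single m (u (?e m))) = 0"
      using T(3) unfolding N by (simp add: sum.reindex[OF inN] sc)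
    moreover obtain m where m: "m \<in> N" "v = ?e m" using T(4) N by auto
    moreover have "Poly_Mapping.lookup (\<Sum>m\<in>N. Poly_Mapping.single m (u (?e m))) m = u (?e m)"
      using m(1) fN by (simp add: lookup_sum lookup_single when_def)
    ultimately show "u v = 0" by simp
  qed
  have "card (?e ` ?M) = S.dim (homog k)"
    by (rule S.basis_card_eq_dim) (use sp ind in \<open>auto simp: homog_def\<close>)
  then have d: "S.dim (homog k) = card ?M" using card_image[OF inj_on_subset[OF inj subset_UNIV], of ?M] by simp
  show "int (S.dim (homog k)) = (if k < 0 then 0 else (k + 1) * (k + 2) div 2)"
  proof (cases "k < 0")
    case False
    define n where "n = nat k"
    have k: "k = int n" using False by (simp add: n_def)
    have "card ?M = card A" using bij False bij_betw_same_card[of g A ?M] by simp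
    also have "\<dots> = (\<Sum>i\<le>n. n - i + 1)" unfolding A_def n_def by simp
    also have "\<dots> = (\<Sum>i\<le>n. i + 1)" by (rule sum.reindex_bij_witness[of _ "\<lambda>i. n - i" "\<lambda>i. n - i"]) auto
    also have "int \<dots> = (int n + 1) * (int n + 2) div 2"
    proof (induction n)
      case (Suc n)
      have "even ((int n + 1) * (int n + 2))" by simp
      then show ?case using Suc by (auto simp: algebra_simps elim!: evenE)
    qed simp
    finally show ?thesis using False d by (simp add: k)
  qed (use M0 d in simp)
qed

section \<open>A line transversal to the curve\<close>

interpretation const3_map: structure_map const3
  by unfold_locales (auto simp: const3_add const3_mult const3_1)

lemma (in structure_map) subst3_subst3:
  "subst3 h (subst3 const3 p (a, b, c)) w = subst3 h p (subst3 h a w, subst3 h b w, subst3 h c w)"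
proof (induction p rule: poly3_induct)
  case (var i)
  show ?case using exhaust_3[of i] by (auto simp: const3_map.subst3_var subst3_var coord_def)
qed (auto simp: const3_map.subst3_simps subst3_simps)

lemma subst3_const3_id: "subst3 const3 p (var3 0, var3 1, var3 2) = p"
proof (induction p rule: poly3_induct)
  case (var i)
  show ?case using exhaust_3[of i] by (auto simp: const3_map.subst3_var coord_def)
qed (auto simp: const3_map.subst3_simps)

lemma homog_subst3:
  assumes "p \<in> homog k" "a \<in> homog 1" "b \<in> homog 1" "c \<in> homog 1"
  shows "subst3 const3 p (a, b, c) \<in> homog k"
  using assms(1)
proof (induction rule: homog_induct)
  case (monomial t i j l)
  have "const3 t * a ^ i * b ^ j * c ^ l \<in> homog (0 + int i * 1 + int j * 1 + int l * 1)"
    by (intro homog_mult homog_power homog_const assms)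
  then show ?case using monomial by (simp add: const3_map.subst3_simps)
qed (auto simp: const3_map.subst3_simps homog_add)

text \<open>The forms M invert the linear change of coordinates L, so q is p in the new coordinates.
  Divisibility by one of the L can then be read off monomial by monomial.\<close>

lemma homog_expand:
  assumes p: "p \<in> homog k"
    and L: "M0 \<in> homog 1" "M1 \<in> homog 1" "M2 \<in> homog 1"
    and inv: "subst3 const3 M0 (L0, L1, L2) = var3 0" "subst3 const3 M1 (L0, L1, L2) = var3 1" "subst3 const3 M2 (L0, L1, L2) = var3 2"
  obtains q where "q \<in> homog k"
    "p = (\<Sum>m\<in>Poly_Mapping.keys q. const3 (Poly_Mapping.lookup q m) * L0 ^ Poly_Mapping.lookup m 0 * L1 ^ Poly_Mapping.lookup m 1 * L2 ^ Poly_Mapping.lookup m 2)"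
    "\<And>m. m \<in> Poly_Mapping.keys q \<Longrightarrow> int (Poly_Mapping.lookup m 0) + int (Poly_Mapping.lookup m 1) + int (Poly_Mapping.lookup m 2) = k"
proof -
  define q where "q = subst3 const3 p (M0, M1, M2)"
  have "subst3 const3 q (L0, L1, L2) = p"
    unfolding q_def by (simp add: const3_map.subst3_subst3 inv subst3_const3_id)
  moreover have "q \<in> homog k" unfolding q_def by (rule homog_subst3[OF p L])
  ultimately show ?thesis
    by (intro that[of q]) (auto simp: subst3_def homog_def mono_deg_eq)
qed

text \<open>One step of the universal property of an iterated polynomial ring; three such steps
  invert \<open>nested\<close>.\<close>

lemma comm_ring_hom_eval_map:
  assumes "comm_ring_hom h"
  shows "comm_ring_hom (\<lambda>p. poly (map_poly h p) a)"
proof -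
  interpret h: comm_ring_hom h by (rule assms)
  interpret m: map_poly_comm_ring_hom h ..
  show ?thesis by unfold_locales (simp_all add: hom_distribs)
qed

lemma coeff_mult_sum_bounds:
  assumes "degree P \<le> i" "degree Q \<le> j"
  shows "coeff (P * Q) (i + j) = coeff P i * coeff Q j"
proof -
  have "coeff (P * Q) (i + j) = (\<Sum>k\<le>i + j. coeff P k * coeff Q (i + j - k))"
    by (simp add: coeff_mult)
  also have "\<dots> = (\<Sum>k\<in>{i}. coeff P k * coeff Q (i + j - k))"
  proof (intro sum.mono_neutral_right ballI)
    fix k assume "k \<in> {..i + j} - {i}"
    then show "coeff P k * coeff Q (i + j - k) = 0"
      using assms by (cases "k < i") (simp_all add: coeff_eq_0)
  qed auto
  finally show ?thesis by simp
qed

text \<open>The restriction to the line through the points \<open>(a, 0, c)\<close> and \<open>(\<alpha>, 1, \<gamma>)\<close>; for generic \<open>a, c\<close>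
  it is the identity in other coordinates.\<close>

definition line_poly :: "(complex \<Rightarrow> 'a::comm_ring_1) \<Rightarrow> 'a \<Rightarrow> 'a \<Rightarrow> complex \<Rightarrow> complex \<Rightarrow> poly3 \<Rightarrow> 'a poly" where
  "line_poly h a c \<alpha> \<gamma> p = subst3 (\<lambda>t. [:h t:]) p ([:a, h \<alpha>:], [:0, 1:], [:c, h \<gamma>:])"

context structure_map
begin

lemma structure_map_pCons: "structure_map (\<lambda>t. [:h t:])"
  by unfold_locales (simp_all add: add mult one)

lemma line_poly_simps:
  "line_poly h a c \<alpha> \<gamma> (p + q) = line_poly h a c \<alpha> \<gamma> p + line_poly h a c \<alpha> \<gamma> q"
  "line_poly h a c \<alpha> \<gamma> (p - q) = line_poly h a c \<alpha> \<gamma> p - line_poly h a c \<alpha> \<gamma> q"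
  "line_poly h a c \<alpha> \<gamma> (- p) = - line_poly h a c \<alpha> \<gamma> p"
  "line_poly h a c \<alpha> \<gamma> (p * q) = line_poly h a c \<alpha> \<gamma> p * line_poly h a c \<alpha> \<gamma> q"
  "line_poly h a c \<alpha> \<gamma> (p ^ n) = line_poly h a c \<alpha> \<gamma> p ^ n"
  "line_poly h a c \<alpha> \<gamma> (sum F A) = (\<Sum>x\<in>A. line_poly h a c \<alpha> \<gamma> (F x))"
  "line_poly h a c \<alpha> \<gamma> 0 = 0" "line_poly h a c \<alpha> \<gamma> 1 = 1"
  "line_poly h a c \<alpha> \<gamma> (const3 t) = [:h t:]"
  "line_poly h a c \<alpha> \<gamma> (var3 0) = [:a, h \<alpha>:]" "line_poly h a c \<alpha> \<gamma> (var3 1) = [:0, 1:]"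
  "line_poly h a c \<alpha> \<gamma> (var3 2) = [:c, h \<gamma>:]"
proof -
  interpret c: structure_map "\<lambda>t. [:h t:]" by (rule structure_map_pCons)
  show "line_poly h a c \<alpha> \<gamma> (p + q) = line_poly h a c \<alpha> \<gamma> p + line_poly h a c \<alpha> \<gamma> q"
  "line_poly h a c \<alpha> \<gamma> (p - q) = line_poly h a c \<alpha> \<gamma> p - line_poly h a c \<alpha> \<gamma> q"
  "line_poly h a c \<alpha> \<gamma> (- p) = - line_poly h a c \<alpha> \<gamma> p"
  "line_poly h a c \<alpha> \<gamma> (p * q) = line_poly h a c \<alpha> \<gamma> p * line_poly h a c \<alpha> \<gamma> q"
  "line_poly h a c \<alpha> \<gamma> (p ^ n) = line_poly h a c \<alpha> \<gamma> p ^ n"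
  "line_poly h a c \<alpha> \<gamma> (sum F A) = (\<Sum>x\<in>A. line_poly h a c \<alpha> \<gamma> (F x))"
  "line_poly h a c \<alpha> \<gamma> 0 = 0" "line_poly h a c \<alpha> \<gamma> 1 = 1"
  "line_poly h a c \<alpha> \<gamma> (const3 t) = [:h t:]"
  "line_poly h a c \<alpha> \<gamma> (var3 0) = [:a, h \<alpha>:]" "line_poly h a c \<alpha> \<gamma> (var3 1) = [:0, 1:]"
  "line_poly h a c \<alpha> \<gamma> (var3 2) = [:c, h \<gamma>:]"
    by (simp_all add: line_poly_def c.subst3_simps)
qed

text \<open>A degree bound together with the coefficient at the bound is multiplicative over any
  commutative ring, even with zero divisors. The coefficient is the value at (\<alpha>, 1,
  \<gamma>), the point of the line reached when the parameter tends to infinity.\<close>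

lemma line_poly_degree:
  assumes "p \<in> homog (int n)"
  shows "degree (line_poly h a c \<alpha> \<gamma> p) \<le> n" "coeff (line_poly h a c \<alpha> \<gamma> p) n = h (eval3 p (\<alpha>, 1, \<gamma>))"
proof -
  have mul: "degree (P * Q) \<le> i + j \<and> coeff (P * Q) (i + j) = u * v"
    if "degree P \<le> i \<and> coeff P i = u" "degree Q \<le> j \<and> coeff Q j = v" for P Q :: "'a poly" and i j u v
    using that coeff_mult_sum_bounds[of P i Q j] degree_mult_le[of P Q] by auto
  have pw: "degree (P ^ k) \<le> k * i \<and> coeff (P ^ k) (k * i) = u ^ k" if "degree P \<le> i \<and> coeff P i = u" for P :: "'a poly" and i k u
  proof (induction k)
    case (Suc k)
    then show ?case using mul[OF that Suc] by simp
  qed simp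
  have hp: "h (x ^ k) = h x ^ k" for x k by (induction k) (auto simp: one mult)
  have "degree (line_poly h a c \<alpha> \<gamma> p) \<le> n \<and> coeff (line_poly h a c \<alpha> \<gamma> p) n = h (eval3 p (\<alpha>, 1, \<gamma>))"
    using assms
  proof (induction rule: homog_induct)
    case zero
    then show ?case by (simp add: line_poly_simps eval3_simps structure_map.zero[OF structure_map_axioms])
  next
    case (add p q)
    then show ?case by (auto simp: line_poly_simps eval3_simps structure_map.add[OF structure_map_axioms] intro: degree_add_le)
  next
    case (monomial t i j l)
    have "degree ([:h t:] * [:a, h \<alpha>:] ^ i * [:0, 1:] ^ j * [:c, h \<gamma>:] ^ l) \<le> 0 + i * 1 + j * 1 + l * 1 \<and>
       coeff ([:h t:] * [:a, h \<alpha>:] ^ i * [:0, 1:] ^ j * [:c, h \<gamma>:] ^ l) (0 + i * 1 + j * 1 + l * 1) = h t * h \<alpha> ^ i * 1 ^ j * h \<gamma> ^ l"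
      by (intro mul pw) auto
    moreover have "0 + i * 1 + j * 1 + l * 1 = n" using monomial by simp
    ultimately show ?case by (simp add: line_poly_simps eval3_simps mult hp)
  qed
  then show "degree (line_poly h a c \<alpha> \<gamma> p) \<le> n" "coeff (line_poly h a c \<alpha> \<gamma> p) n = h (eval3 p (\<alpha>, 1, \<gamma>))" by auto
qed

lemma line_poly_map:
  assumes "comm_ring_hom k"
  shows "map_poly k (line_poly h a c \<alpha> \<gamma> p) = line_poly (\<lambda>t. k (h t)) (k a) (k c) \<alpha> \<gamma> p"
proof -
  interpret k: comm_ring_hom k by (rule assms)
  interpret m: map_poly_comm_ring_hom k ..
  interpret kh: structure_map "\<lambda>t. k (h t)" by unfold_locales (auto simp: add mult one k.hom_add k.hom_mult)
  show ?thesis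
  proof (induction p rule: poly3_induct)
    case (var i)
    show ?case using exhaust_3[of i] by (auto simp: line_poly_simps kh.line_poly_simps k.map_poly_pCons_hom)
  qed (auto simp: line_poly_simps kh.line_poly_simps hom_distribs)
qed

end

text \<open>The chain rule: the parameter moves the point in the direction (\<alpha>, 1,
  \<gamma>).\<close>

lemma pderiv_line_poly:
  fixes h :: "complex \<Rightarrow> 'a::idom"
  assumes "structure_map h"
  shows "pderiv (line_poly h a c \<alpha> \<gamma> p) = line_poly h a c \<alpha> \<gamma> (const3 \<alpha> * pd 0 p + pd 1 p + const3 \<gamma> * pd 2 p)"
proof -
  interpret structure_map h by (rule assms)
  show ?thesis
  proof (induction p rule: poly3_induct)
    case (var i)
    show ?case using exhaust_3[of i] by (auto simp: line_poly_simps pd_var pderiv_pCons)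
  next
    case (add p q)
    then show ?case by (simp add: line_poly_simps pd_add pderiv_add algebra_simps)
  next
    case (mult p q)
    then show ?case by (simp add: line_poly_simps pd_mult pderiv_mult algebra_simps)
  qed (auto simp: line_poly_simps pderiv_pCons)
qed

section \<open>Factoriality of S and the choice of the line\<close>

abbreviation nested_const :: "complex \<Rightarrow> complex poly poly" where
  "nested_const \<equiv> \<lambda>t. [:[:t:]:]"

lemma structure_map_nested_const: "structure_map nested_const"
  by unfold_locales simp_all

text \<open>An isomorphism of \<open>S\<close> with an iterated polynomial ring, which is known to be factorial.\<close>

definition nested :: "complex \<Rightarrow> complex \<Rightarrow> poly3 \<Rightarrow> complex poly poly poly" where
  "nested = line_poly nested_const [:[:0, 1:]:] [:0, 1:]"

interpretation nested_const: structure_map nested_const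
  by (rule structure_map_nested_const)

lemmas nested_simps = nested_const.line_poly_simps[of "[:[:0, 1:]:]" "[:0, 1:]", folded nested_def]

lemma surj_nested: "\<exists>p. nested \<alpha> \<gamma> p = P"
proof -
  let ?R = "range (nested \<alpha> \<gamma>)"
  have add: "P + Q \<in> ?R" if "P \<in> ?R" "Q \<in> ?R" for P Q
    using that by (auto simp: nested_simps(1)[symmetric])
  have mult: "P * Q \<in> ?R" if "P \<in> ?R" "Q \<in> ?R" for P Q
    using that by (auto simp: nested_simps(4)[symmetric])
  have const: "[:[:[:t:]:]:] \<in> ?R" for t
    using nested_simps(9)[of \<alpha> \<gamma> t, symmetric] by (rule range_eqI)
  have y: "[:0, 1:] \<in> ?R" using nested_simps(11)[of \<alpha> \<gamma>, symmetric] by (rule range_eqI)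
  have x: "[:[:[:0, 1:]:]:] \<in> ?R"
  proof -
    have "nested \<alpha> \<gamma> (var3 0 - const3 \<alpha> * var3 1) = [:[:[:0, 1:]:]:]"
      by (simp add: nested_simps)
    then show ?thesis by (intro range_eqI[OF sym])
  qed
  have z: "[:[:0, 1:]:] \<in> ?R"
  proof -
    have "nested \<alpha> \<gamma> (var3 2 - const3 \<gamma> * var3 1) = [:[:0, 1:]:]"
      by (simp add: nested_simps)
    then show ?thesis by (intro range_eqI[OF sym])
  qed
  have 1: "[:[:p:]:] \<in> ?R" for p :: "complex poly"
  proof (induction p)
    case 0
    show ?case using const[of 0] by simp
  next
    case (pCons t p)
    have "[:[:pCons t p:]:] = [:[:[:t:]:]:] + [:[:[:0, 1:]:]:] * [:[:p:]:]" by simp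
    then show ?case using add[OF const mult[OF x pCons(2)]] by simp
  qed
  have 2: "[:p:] \<in> ?R" for p :: "complex poly poly"
  proof (induction p)
    case 0
    show ?case using const[of 0] by simp
  next
    case (pCons t p)
    have "[:pCons t p:] = [:[:t:]:] + [:[:0, 1:]:] * [:p:]" by simp
    then show ?case using add[OF 1 mult[OF z pCons(2)]] by simp
  qed
  have "P \<in> ?R"
  proof (induction P)
    case 0
    show ?case using const[of 0] by simp
  next
    case (pCons t p)
    have "pCons t p = [:t:] + [:0, 1:] * p" by simp
    then show ?case using add[OF 2 mult[OF y pCons(2)]] by simp
  qed
  then show ?thesis by auto
qed

text \<open>The inverse is built from three evaluations: the innermost variable goes to x - \<alpha>
  y, the middle one to z - \<gamma> y, the outer one to y.\<close>

lemma nested_inverse: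
  obtains \<theta> where "comm_ring_hom \<theta>" "\<And>p. \<theta> (nested \<alpha> \<gamma> p) = p"
proof -
  have h0: "comm_ring_hom const3"
    by unfold_locales (auto simp: const3_add const3_mult const3_1)
  define \<theta>1 where "\<theta>1 p = poly (map_poly const3 p) (var3 0 - const3 \<alpha> * var3 1)" for p
  have h1: "comm_ring_hom \<theta>1" unfolding \<theta>1_def by (rule comm_ring_hom_eval_map[OF h0])
  define \<theta>2 where "\<theta>2 p = poly (map_poly \<theta>1 p) (var3 2 - const3 \<gamma> * var3 1)" for p
  have h2: "comm_ring_hom \<theta>2" unfolding \<theta>2_def by (rule comm_ring_hom_eval_map[OF h1])
  define \<theta> where "\<theta> p = poly (map_poly \<theta>2 p) (var3 1)" for p
  have h3: "comm_ring_hom \<theta>" unfolding \<theta>_def by (rule comm_ring_hom_eval_map[OF h2])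
  interpret h0: comm_ring_hom const3 by (rule h0)
  interpret h1: comm_ring_hom \<theta>1 by (rule h1)
  interpret h2: comm_ring_hom \<theta>2 by (rule h2)
  interpret h3: comm_ring_hom \<theta> by (rule h3)
  have c1: "\<theta>1 [:t:] = const3 t" "\<theta>1 [:0, 1:] = var3 0 - const3 \<alpha> * var3 1" for t
    by (simp_all add: \<theta>1_def h0.map_poly_pCons_hom)
  have c2: "\<theta>2 [:p:] = \<theta>1 p" "\<theta>2 [:0, 1:] = var3 2 - const3 \<gamma> * var3 1" for p
    by (simp_all add: \<theta>2_def h1.map_poly_pCons_hom)
  have c3: "\<theta> [:p:] = \<theta>2 p" "\<theta> [:p, q:] = \<theta>2 p + var3 1 * \<theta>2 q" for p q
    by (simp_all add: \<theta>_def h2.map_poly_pCons_hom)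
  have "\<theta> (nested \<alpha> \<gamma> p) = p" for p
  proof (induction p rule: poly3_induct)
    case (const c)
    show ?case by (simp add: nested_simps c1 c2 c3)
  next
    case (var i)
    note c = c1[simplified] c2[simplified] c3[simplified] c3(2)[of _ 1, simplified]
    show ?case using exhaust_3[of i] by (auto simp: nested_simps c algebra_simps)
  qed (simp_all add: nested_simps h3.hom_add h3.hom_mult)
  then show ?thesis using that h3 by blast
qed

lemma nested_inj: "nested \<alpha> \<gamma> p = nested \<alpha> \<gamma> q \<longleftrightarrow> p = q"
  using nested_inverse by metis

lemma nested_eq_0_iff: "nested \<alpha> \<gamma> p = 0 \<longleftrightarrow> p = 0"
  using nested_inj[of \<alpha> \<gamma> p 0] by (simp add: nested_simps)

lemma nested_dvd_iff: "nested \<alpha> \<gamma> p dvd nested \<alpha> \<gamma> q \<longleftrightarrow> p dvd q"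
proof
  assume "nested \<alpha> \<gamma> p dvd nested \<alpha> \<gamma> q"
  then obtain R where "nested \<alpha> \<gamma> q = nested \<alpha> \<gamma> p * R" by auto
  moreover obtain r where "nested \<alpha> \<gamma> r = R" using surj_nested by blast
  ultimately have "nested \<alpha> \<gamma> q = nested \<alpha> \<gamma> (p * r)" by (simp add: nested_simps)
  then show "p dvd q" by (simp add: nested_inj)
next
  assume "p dvd q"
  then obtain r where "q = p * r" by auto
  then show "nested \<alpha> \<gamma> p dvd nested \<alpha> \<gamma> q" by (simp only: nested_simps dvd_triv_left)
qed

lemma squarefree_nested:
  assumes "squarefree f"
  shows "squarefree (nested \<alpha> \<gamma> f)"
proof (rule squarefreeI)
  fix P assume P: "P ^ 2 dvd nested \<alpha> \<gamma> f"
  obtain p where p: "nested \<alpha> \<gamma> p = P" using surj_nested by blast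
  have "p ^ 2 dvd f" using P unfolding p[symmetric] nested_simps(5)[symmetric] nested_dvd_iff .
  then have "p dvd 1" using assms squarefreeD by blast
  then show "P dvd 1" using nested_dvd_iff[of \<alpha> \<gamma> p 1] p by (simp add: nested_simps)
qed

text \<open>A nonzero polynomial over a domain has finitely many roots, whereas \<open>h\<close> has
  infinitely many values. Used to specialize the variables of an iterated polynomial one at a
  time.\<close>

lemma poly_nonvanishing:
  fixes P :: "'a::idom poly" and h :: "complex \<Rightarrow> 'a"
  assumes "P \<noteq> 0" "inj h"
  obtains t where "poly P (h t) \<noteq> 0"
proof -
  have "finite {x. poly P x = 0}" by (rule poly_roots_finite[OF assms(1)])
  moreover have "infinite (range h)" using assms(2) infinite_UNIV_char_0[where ?'a = complex] by (simp add: finite_image_iff)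
  ultimately have "\<not> range h \<subseteq> {x. poly P x = 0}" by (metis finite_subset)
  then show ?thesis using that by blast
qed

lemma poly3_nonvanishing:
  assumes "p \<noteq> 0"
  obtains a b c where "eval3 p (a, b, c) \<noteq> 0"
proof -
  have "nested 0 0 p \<noteq> 0" using assms nested_eq_0_iff by blast
  then obtain b where "poly (nested 0 0 p) [:[:b:]:] \<noteq> 0"
    using poly_nonvanishing[of "nested 0 0 p" nested_const] by (auto simp: inj_def)
  then obtain c where "poly (poly (nested 0 0 p) [:[:b:]:]) [:c:] \<noteq> 0"
    using poly_nonvanishing[of _ "\<lambda>t. [:t:]"] by (auto simp: inj_def)
  then obtain a where "poly (poly (poly (nested 0 0 p) [:[:b:]:]) [:c:]) a \<noteq> 0"
    using poly_nonvanishing[of _ "\<lambda>t. t"] by (auto simp: inj_def)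
  moreover have "poly (poly (poly (nested 0 0 p) [:[:b:]:]) [:c:]) a = eval3 p (a, b, c)"
  proof (induction p rule: poly3_induct)
    case (var i)
    show ?case using exhaust_3[of i] by (auto simp: nested_simps eval3_simps)
  qed (auto simp: nested_simps eval3_simps)
  ultimately show ?thesis using that by simp
qed

text \<open>A prime q dividing P and its derivative has positive degree, because the leading
  coefficient of P is a unit. Writing P = q G, q divides q' G but for degree reasons not q'; hence
  it divides G, and q^2 divides P.\<close>

lemma pderiv_coprime_of_squarefree:
  fixes P :: "'a::{factorial_ring_gcd,semiring_gcd_mult_normalize,ring_char_0} poly"
  assumes "squarefree P" "lead_coeff P dvd 1"
  shows "degree (gcd P (pderiv P)) = 0"
proof (rule ccontr)
  assume deg: "degree (gcd P (pderiv P)) \<noteq> 0"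
  have P0: "P \<noteq> 0" using assms(1) by auto
  define h where "h = gcd P (pderiv P)"
  have "h \<noteq> 0" using P0 by (simp add: h_def)
  moreover have "\<not> h dvd 1"
    using deg unfolding h_def[symmetric] is_unit_poly_iff by (metis degree_pCons_0)
  ultimately obtain q where q: "prime q" "q dvd h" using prime_divisor_exists by blast
  have qP: "q dvd P" "q dvd pderiv P" using q(2) by (auto simp: h_def)
  have dq: "degree q \<noteq> 0"
  proof
    assume "degree q = 0"
    then obtain t where t: "q = [:t:]" by (metis degree_eq_zeroE)
    then have "t dvd lead_coeff P" using qP(1) by (simp add: const_poly_dvd_iff)
    then have "t dvd 1" using assms(2) dvd_trans by blast
    then have "q dvd 1" by (simp add: t is_unit_const_poly_iff)
    then show False using q(1) by (simp add: not_prime_unit)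
  qed
  obtain G where G: "P = q * G" using qP(1) by auto
  have "q dvd pderiv q * G"
    using qP(2) unfolding G pderiv_mult by (simp add: dvd_add_right_iff mult.commute)
  moreover have "\<not> q dvd pderiv q"
  proof
    assume "q dvd pderiv q"
    moreover have "pderiv q \<noteq> 0" using dq by (simp add: pderiv_eq_0_iff)
    ultimately have "degree q \<le> degree (pderiv q)" by (rule dvd_imp_degree_le)
    then show False using dq degree_pderiv[of q] by simp
  qed
  ultimately have "q dvd G" using q(1) prime_dvd_multD by blast
  then have "q ^ 2 dvd P" unfolding G power2_eq_square by (rule mult_dvd_mono[OF dvd_refl])
  then have "q dvd 1" using assms(1) squarefreeD by blast
  then show False using q(1) by (simp add: not_prime_unit)
qed

abbreviation restrict_line :: "complex \<Rightarrow> complex \<Rightarrow> complex \<Rightarrow> complex \<Rightarrow> poly3 \<Rightarrow> complex poly" where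
  "restrict_line \<equiv> line_poly (\<lambda>t. t)"

lemma var3_neq_0: "var3 i \<noteq> 0"
  unfolding var3_def by (metis keys_single keys_zero insert_not_empty zero_neq_one)

lemma exists_transversal_line:
  assumes f: "f \<in> homog (int d)" "squarefree f" and d: "d \<ge> 1"
  obtains \<alpha> \<gamma> a c where "eval3 f (\<alpha>, 1, \<gamma>) \<noteq> 0"
    "coprime (restrict_line a c \<alpha> \<gamma> f) (pderiv (restrict_line a c \<alpha> \<gamma> f))"
proof -
  have "f \<noteq> 0" using f(2) by auto
  moreover have "var3 1 \<noteq> 0" by (rule var3_neq_0)
  \<comment> \<open>The factor \<open>var3 1\<close> forces the second coordinate of the point to be
    nonzero, so that it can be scaled to 1.\<close>
  ultimately have "f * var3 1 \<noteq> 0" by simp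
  then obtain a b c where "eval3 (f * var3 1) (a, b, c) \<noteq> 0" using poly3_nonvanishing by blast
  then have abc: "eval3 f (a, b, c) \<noteq> 0" "b \<noteq> 0" by (auto simp: eval3_simps)
  have "eval3 f (a, b, c) = b ^ d * eval3 f (a / b, 1, c / b)"
    using f(1)
  proof (induction rule: homog_induct)
    case (monomial t i j l)
    then have "d = i + j + l" by simp
    then show ?case using abc(2) by (simp add: eval3_simps power_divide power_add)
  qed (auto simp: eval3_simps algebra_simps)
  then obtain \<alpha> \<gamma> where ag: "eval3 f (\<alpha>, 1, \<gamma>) \<noteq> 0" using abc by auto
  define P where "P = nested \<alpha> \<gamma> f"
  note pd = nested_const.line_poly_degree[OF f(1), of "[:[:0, 1:]:]" "[:0, 1:]" \<alpha> \<gamma>, folded nested_def P_def]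
  have degP: "degree P = d" using pd ag by (intro antisym le_degree) auto
  have lcP: "lead_coeff P dvd 1" using pd ag degP by (simp add: is_unit_const_poly_iff dvd_field_iff)
  have "degree (gcd P (pderiv P)) = 0"
    using pderiv_coprime_of_squarefree[OF squarefree_nested[OF f(2)]] lcP unfolding P_def by blast
  \<comment> \<open>This resultant is essentially a discriminant, a nonzero polynomial in the two
    inner variables; c and a are chosen off its zero set.\<close>
  then have res: "resultant P (pderiv P) \<noteq> 0" using resultant_0_gcd by blast
  then obtain c where c: "poly (resultant P (pderiv P)) [:c:] \<noteq> 0"
    using poly_nonvanishing[of _ "\<lambda>t. [:t:]"] by (auto simp: inj_def)
  then obtain a where a: "poly (poly (resultant P (pderiv P)) [:c:]) a \<noteq> 0"
    using poly_nonvanishing[of _ "\<lambda>t. t"] by (auto simp: inj_def)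
  define k where "k r = poly (poly r [:c:]) a" for r
  have k: "comm_ring_hom k" unfolding k_def by unfold_locales auto
  interpret k: comm_ring_hom k by (rule k)
  interpret ki: idom_hom k ..
  define F where "F = restrict_line a c \<alpha> \<gamma> f"
  have "map_poly k P = line_poly (\<lambda>t. k (nested_const t)) (k [:[:0, 1:]:]) (k [:0, 1:]) \<alpha> \<gamma> f"
    unfolding P_def nested_def by (rule nested_const.line_poly_map[OF k])
  also have "\<dots> = F" by (simp add: F_def k_def)
  finally have kP: "map_poly k P = F" .
  note fd = id_map.line_poly_degree[OF f(1), of a c \<alpha> \<gamma>, folded F_def]
  have degF: "degree F = d" using fd ag by (intro antisym le_degree) auto
  have kP': "map_poly k (pderiv P) = pderiv F"
    unfolding kP[symmetric] by (simp add: ki.map_poly_pderiv)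
  \<comment> \<open>The leading coefficient of P is a nonzero constant, so specialization preserves
    both degrees and commutes with the resultant.\<close>
  have "resultant F (pderiv F) = k (resultant P (pderiv P))"
    unfolding kP[symmetric] kP'[unfolded kP[symmetric], symmetric]
    using kP kP' degP degF by (intro k.resultant_map_poly) (auto simp: degree_pderiv)
  then have "resultant F (pderiv F) \<noteq> 0" using a by (simp add: k_def)
  then have "degree (gcd F (pderiv F)) = 0" using resultant_0_gcd by blast
  moreover have "gcd F (pderiv F) \<noteq> 0" using degF d by auto
  ultimately have "coprime F (pderiv F)" 
    using is_unit_iff_degree is_unit_gcd by blast
  then show ?thesis using that[OF ag] by (simp add: F_def)
qed

section \<open>Dimension counts for multiplication by a form\<close>

lemma linear_mult_right: "Vector_Spaces.linear scale3 scale3 (\<lambda>p. p * q)"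
  unfolding Vector_Spaces.linear_iff by (auto simp: S.vector_space_axioms scale3_def algebra_simps)

lemma subspace_mult_image: "S.subspace U \<Longrightarrow> S.subspace ((\<lambda>p. p * q) ` U)"
proof -
  interpret l: Vector_Spaces.linear scale3 scale3 "\<lambda>p. p * q" by (rule linear_mult_right)
  show "S.subspace U \<Longrightarrow> S.subspace ((\<lambda>p. p * q) ` U)" by (rule l.subspace_image)
qed

lemma dim_mult_image:
  assumes "S.subspace U" "fin_dim scale3 U" "q \<noteq> 0"
  shows "S.dim ((\<lambda>p. p * q) ` U) = S.dim U"
proof -
  interpret l: Vector_Spaces.linear scale3 scale3 "\<lambda>p. p * q" by (rule linear_mult_right)
  show ?thesis by (rule l.dim_image_inj[OF assms(1,2)]) (use assms(3) in auto)
qed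

lemma dim_mult_plus:
  assumes "S.subspace U" "fin_dim scale3 U" "S.subspace W" "fin_dim scale3 W"
  shows "S.dim {u * q + w | u w. u \<in> U \<and> w \<in> W} + S.dim {u \<in> U. u * q \<in> W} = S.dim U + S.dim W"
proof -
  interpret l: Vector_Spaces.linear scale3 scale3 "\<lambda>p. p * q" by (rule linear_mult_right)
  show ?thesis by (rule l.dim_image_plus[OF assms])
qed

lemma subspace_mult_plus:
  assumes "S.subspace U" "S.subspace W"
  shows "S.subspace {u * q + w | u w. u \<in> U \<and> w \<in> W}"
proof -
  have "{u * q + w | u w. u \<in> U \<and> w \<in> W} = {x + y | x y. x \<in> (\<lambda>p. p * q) ` U \<and> y \<in> W}" by blast
  then show ?thesis using S.subspace_sums[OF subspace_mult_image[OF assms(1)] assms(2)] by simp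
qed

abbreviation sdim :: "int \<Rightarrow> int" where
  "sdim k \<equiv> int (S.dim (homog k))"

lemma sdim_neg: "k < 0 \<Longrightarrow> sdim k = 0"
  by (simp add: dim_homog)

text \<open>The quadratic vanishes at -1 and -2, so it is correct down to -2. These two extra values
  account for bounds such as 2 D - 2 below.\<close>

lemma sdim_double: "k \<ge> - 2 \<Longrightarrow> 2 * sdim k = (k + 1) * (k + 2)"
proof -
  assume k: "k \<ge> - 2"
  have "even ((k + 1) * (k + 2))" by simp
  moreover have "k = - 1 \<or> k = - 2" if "k < 0" using k that by auto
  ultimately show ?thesis by (auto simp: dim_homog)
qed

text \<open>The line runs through (a, 0, c) and (\<alpha>, 1, \<gamma>). The last two assumptions
  say that it meets the curve in d distinct points, none of them (\<alpha>, 1, \<gamma>).\<close>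

locale transversal_line =
  fixes f :: poly3 and d :: nat and \<alpha> \<gamma> a c :: complex
  assumes f_homog: "f \<in> homog (int d)" and d_ge: "d \<ge> 2"
    and f_top: "eval3 f (\<alpha>, 1, \<gamma>) \<noteq> 0"
    and f_transversal: "coprime (restrict_line a c \<alpha> \<gamma> f) (pderiv (restrict_line a c \<alpha> \<gamma> f))"
begin

definition D :: int where "D = int d - 1"
definition \<rho> :: "poly3 \<Rightarrow> complex poly" where "\<rho> = restrict_line a c \<alpha> \<gamma>"
text \<open>\<open>g1\<close> and \<open>g2\<close> are the derivatives of f in the directions of
  the two points that span the line; \<open>g3\<close> completes them to generators of the Jacobian
  ideal.\<close>

definition g1 where "g1 = const3 a * pd 0 f + const3 c * pd 2 f"
definition g2 where "g2 = const3 \<alpha> * pd 0 f + pd 1 f + const3 \<gamma> * pd 2 f"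
definition g3 where "g3 = (if a \<noteq> 0 then pd 2 f else pd 0 f)"
text \<open>On the line \<open>u\<close> is 1 and \<open>l\<close> is 0, so u, y, l are linear
  coordinates in which \<open>\<rho>\<close> sets u to 1 and l to 0.\<close>

definition u where "u = (if a \<noteq> 0 then const3 (1 / a) * (var3 0 - const3 \<alpha> * var3 1)
    else const3 (1 / c) * (var3 2 - const3 \<gamma> * var3 1))"
definition l where "l = const3 c * var3 0 + const3 (\<gamma> * a - \<alpha> * c) * var3 1 - const3 a * var3 2"

lemmas \<rho>_simps = id_map.line_poly_simps[of a c \<alpha> \<gamma>, folded \<rho>_def]

lemma D_ge: "D \<ge> 1" using d_ge by (simp add: D_def)

lemma pd_f_homog: "pd i f \<in> homog D"
  using homog_pd[OF f_homog] by (simp add: D_def)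

lemma g_homog: "g1 \<in> homog D" "g2 \<in> homog D" "g3 \<in> homog D"
  by (auto simp: g1_def g2_def g3_def intro!: homog_add homog_const_mult pd_f_homog)

lemma u_homog: "u \<in> homog 1" and l_homog: "l \<in> homog 1"
  by (auto simp: u_def l_def intro!: homog_add homog_diff homog_const_mult homog_var)

lemma \<rho>_g2: "\<rho> g2 = pderiv (\<rho> f)"
  using pderiv_line_poly[OF id_map.structure_map_axioms, of a c \<alpha> \<gamma> f]
  by (simp add: \<rho>_def g2_def)

lemma \<rho>_euler: "smult (of_nat d) (\<rho> f) = \<rho> g1 + [:0, 1:] * \<rho> g2"
proof -
  have "smult (of_nat d) (\<rho> f) = \<rho> (const3 (of_int (int d)) * f)"
    by (simp add: \<rho>_simps)
  also have "\<dots> = \<rho> (var3 0 * pd 0 f + var3 1 * pd 1 f + var3 2 * pd 2 f)"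
    using euler[OF f_homog] by simp
  also have "\<dots> = \<rho> g1 + [:0, 1:] * \<rho> g2"
  proof -
    have "[:a, \<alpha>:] = [:a:] + [:0, 1:] * [:\<alpha>:]" "[:c, \<gamma>:] = [:c:] + [:0, 1:] * [:\<gamma>:]" by simp_all
    then show ?thesis
      unfolding g1_def g2_def \<rho>_simps by (simp only: algebra_simps)
  qed
  finally show ?thesis .
qed

text \<open>By Euler's relation a common divisor also divides the restriction of f, and
  \<open>\<rho> g2\<close> is the derivative of that restriction.\<close>

lemma coprime_\<rho>: "coprime (\<rho> g1) (\<rho> g2)"
proof (rule coprimeI)
  fix t assume t: "t dvd \<rho> g1" "t dvd \<rho> g2"
  then have "t dvd smult (of_nat d) (\<rho> f)" unfolding \<rho>_euler by (intro dvd_add dvd_mult)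
  then have "t dvd \<rho> f" using d_ge by (simp add: dvd_smult_iff)
  then show "is_unit t" using t(2) f_transversal
    by (metis \<rho>_def \<rho>_g2 coprime_common_divisor)
qed

lemma degree_\<rho>_le: "p \<in> homog (int k) \<Longrightarrow> degree (\<rho> p) \<le> k"
  unfolding \<rho>_def by (rule id_map.line_poly_degree)

lemma degree_\<rho>_g2: "int (degree (\<rho> g2)) = D"
proof -
  have "of_nat d * eval3 f (\<alpha>, 1, \<gamma>) = eval3 (const3 (of_int (int d)) * f) (\<alpha>, 1, \<gamma>)"
    by (simp add: eval3_simps)
  also have "\<dots> = eval3 (var3 0 * pd 0 f + var3 1 * pd 1 f + var3 2 * pd 2 f) (\<alpha>, 1, \<gamma>)"
    using euler[OF f_homog] by simp
  also have "\<dots> = eval3 g2 (\<alpha>, 1, \<gamma>)" by (simp add: eval3_simps g2_def)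
  finally have "eval3 g2 (\<alpha>, 1, \<gamma>) \<noteq> 0" using f_top d_ge by auto
  moreover have D: "D = int (d - 1)" using d_ge by (simp add: D_def)
  ultimately have "coeff (\<rho> g2) (d - 1) \<noteq> 0"
    using id_map.line_poly_degree(2)[of g2 "d - 1" a c \<alpha> \<gamma>] g_homog(2) by (simp add: \<rho>_def)
  then have "degree (\<rho> g2) = d - 1"
    using degree_\<rho>_le[of g2 "d - 1"] g_homog(2) D by (intro antisym le_degree) auto
  then show ?thesis using D by simp
qed

lemma \<rho>_g2_neq_0: "\<rho> g2 \<noteq> 0" using degree_\<rho>_g2 D_ge by auto

lemma g2_neq_0: "g2 \<noteq> 0" using \<rho>_g2_neq_0 by (auto simp: \<rho>_simps)

lemma ac: "a \<noteq> 0 \<or> c \<noteq> 0"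
proof (rule ccontr)
  assume "\<not> ?thesis"
  then have "const3 a = 0" "const3 c = 0" by simp_all
  then have "g1 = 0" unfolding g1_def by (simp only: mult_zero_left add_0)
  then have "\<rho> g1 = 0" by (simp add: \<rho>_simps)
  then have "is_unit (\<rho> g2)" using coprime_\<rho> by simp
  then have "degree (\<rho> g2) = 0" by (simp add: is_unit_iff_degree[OF \<rho>_g2_neq_0])
  then show False using degree_\<rho>_g2 D_ge by simp
qed

lemma u_eq: "a \<noteq> 0 \<Longrightarrow> u = const3 (1 / a) * (var3 0 - const3 \<alpha> * var3 1)"
    "a = 0 \<Longrightarrow> u = const3 (1 / c) * (var3 2 - const3 \<gamma> * var3 1)"
  and l_eq: "a = 0 \<Longrightarrow> l = const3 c * (var3 0 - const3 \<alpha> * var3 1)"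
  unfolding u_def l_def by (simp_all add: const3_uminus const3_mult algebra_simps)

lemma \<rho>_l: "\<rho> l = 0"
  by (simp add: l_def \<rho>_simps algebra_simps)

lemma \<rho>_u: "\<rho> u = 1"
proof (cases "a = 0")
  case False
  then show ?thesis by (simp add: u_def \<rho>_simps)
next
  case True
  then have c: "c \<noteq> 0" using ac by simp
  have "\<rho> u = smult (1 / c) [:c:]" by (simp add: u_eq(2)[OF True] \<rho>_simps)
  then show ?thesis using c by simp
qed

lemma l_neq_0: "l \<noteq> 0"
proof
  assume "l = 0"
  then have "eval3 l (1, 0, 0) = 0" "eval3 l (0, 0, 1) = 0" by (simp_all add: eval3_simps)
  moreover have "eval3 l (1, 0, 0) = c" "eval3 l (0, 0, 1) = - a" by (simp_all add: l_def eval3_simps)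
  ultimately show False using ac by simp
qed

lemma homog_expand_line:
  assumes "p \<in> homog k"
  obtains q where "q \<in> homog k"
    "p = (\<Sum>m\<in>Poly_Mapping.keys q. const3 (Poly_Mapping.lookup q m) * u ^ Poly_Mapping.lookup m 0 * var3 1 ^ Poly_Mapping.lookup m 1 * l ^ Poly_Mapping.lookup m 2)"
    "\<And>m. m \<in> Poly_Mapping.keys q \<Longrightarrow> int (Poly_Mapping.lookup m 0) + int (Poly_Mapping.lookup m 1) + int (Poly_Mapping.lookup m 2) = k"
proof (cases "a = 0")
  case False
  define M0 where "M0 = const3 a * var3 0 + const3 \<alpha> * var3 1"
  define M2 where "M2 = const3 (1 / a) * (const3 c * M0 + const3 (\<gamma> * a - \<alpha> * c) * var3 1 - var3 2)"
  have ca: "const3 a * const3 (1 / a) = 1" "const3 (1 / a) * const3 a = 1"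
    using False by (simp_all flip: const3_mult add: const3_1)
  have 0: "subst3 const3 M0 (u, var3 1, l) = var3 0"
  proof -
    have "subst3 const3 M0 (u, var3 1, l) = (const3 a * const3 (1 / a)) * (var3 0 - const3 \<alpha> * var3 1) + const3 \<alpha> * var3 1"
      by (simp add: M0_def const3_map.subst3_simps u_eq(1)[OF False])
    then show ?thesis by (simp add: ca)
  qed
  have 2: "subst3 const3 M2 (u, var3 1, l) = var3 2"
  proof -
    have "subst3 const3 M2 (u, var3 1, l) = const3 (1 / a) * (const3 c * subst3 const3 M0 (u, var3 1, l) + const3 (\<gamma> * a - \<alpha> * c) * var3 1 - l)"
      by (simp add: M2_def const3_map.subst3_simps)
    also have "\<dots> = (const3 (1 / a) * const3 a) * var3 2"
      unfolding 0 by (simp add: l_def algebra_simps)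
    finally show ?thesis by (simp add: ca)
  qed
  have h: "M0 \<in> homog 1" "M2 \<in> homog 1"
    by (auto simp: M0_def M2_def intro!: homog_add homog_diff homog_const_mult homog_var)
  show ?thesis
    by (rule homog_expand[OF assms h(1) homog_var[of 1] h(2), of u "var3 1" l]) (use 0 2 that in \<open>auto simp: const3_map.subst3_simps\<close>)
next
  case True
  then have c: "c \<noteq> 0" using ac by simp
  define M0 where "M0 = const3 (1 / c) * var3 2 + const3 \<alpha> * var3 1"
  define M2 where "M2 = const3 c * var3 0 + const3 \<gamma> * var3 1"
  have cc: "const3 c * const3 (1 / c) = 1" "const3 (1 / c) * const3 c = 1"
    using c by (simp_all flip: const3_mult add: const3_1)
  have 2: "subst3 const3 M2 (u, var3 1, l) = var3 2"
  proof -
    have "subst3 const3 M2 (u, var3 1, l) = (const3 c * const3 (1 / c)) * (var3 2 - const3 \<gamma> * var3 1) + const3 \<gamma> * var3 1"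
      by (simp add: M2_def const3_map.subst3_simps u_eq(2)[OF True])
    then show ?thesis by (simp add: cc)
  qed
  have 0: "subst3 const3 M0 (u, var3 1, l) = var3 0"
  proof -
    have "subst3 const3 M0 (u, var3 1, l) = (const3 (1 / c) * const3 c) * (var3 0 - const3 \<alpha> * var3 1) + const3 \<alpha> * var3 1"
      by (simp add: M0_def const3_map.subst3_simps l_eq[OF True] algebra_simps)
    then show ?thesis by (simp add: cc)
  qed
  have h: "M0 \<in> homog 1" "M2 \<in> homog 1"
    by (auto simp: M0_def M2_def intro!: homog_add homog_diff homog_const_mult homog_var)
  show ?thesis
    by (rule homog_expand[OF assms h(1) homog_var[of 1] h(2), of u "var3 1" l]) (use 0 2 that in \<open>auto simp: const3_map.subst3_simps\<close>)
qed

text \<open>In the coordinates u, y, l the monomials without l restrict, within one degree, to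
  distinct powers of the parameter; if the restriction is zero, every monomial contains l.\<close>

lemma \<rho>_eq_0_imp:
  assumes p: "p \<in> homog k" and "\<rho> p = 0"
  obtains r where "r \<in> homog (k - 1)" "p = r * l"
proof -
  obtain q where q: "q \<in> homog k"
    "p = (\<Sum>m\<in>Poly_Mapping.keys q. const3 (Poly_Mapping.lookup q m) * u ^ Poly_Mapping.lookup m 0 * var3 1 ^ Poly_Mapping.lookup m 1 * l ^ Poly_Mapping.lookup m 2)"
    "\<And>m. m \<in> Poly_Mapping.keys q \<Longrightarrow> int (Poly_Mapping.lookup m 0) + int (Poly_Mapping.lookup m 1) + int (Poly_Mapping.lookup m 2) = k"
    by (rule homog_expand_line[OF p], rule that)
  have mon: "[:0, 1:] ^ n = monom (1::complex) n" for n
    by (simp add: monom_altdef)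
  have rp: "\<rho> p = (\<Sum>m\<in>Poly_Mapping.keys q. if Poly_Mapping.lookup m 2 = 0 then monom (Poly_Mapping.lookup q m) (Poly_Mapping.lookup m 1) else 0)"
    unfolding q(2) \<rho>_simps \<rho>_u \<rho>_l mon
    by (intro sum.cong) (auto simp: smult_monom)
  have "Poly_Mapping.lookup m 2 \<noteq> 0" if m: "m \<in> Poly_Mapping.keys q" for m
  proof
    assume m2: "Poly_Mapping.lookup m 2 = 0"
    have "coeff (\<rho> p) (Poly_Mapping.lookup m 1) = (\<Sum>n\<in>Poly_Mapping.keys q. if n = m then Poly_Mapping.lookup q m else 0)"
      unfolding rp coeff_sum
    proof (intro sum.cong refl)
      fix n assume n: "n \<in> Poly_Mapping.keys q"
      have "n = m" if "Poly_Mapping.lookup n 2 = 0" "Poly_Mapping.lookup n 1 = Poly_Mapping.lookup m 1"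
      proof -
        have "Poly_Mapping.lookup n 0 = Poly_Mapping.lookup m 0" using q(3)[OF n] q(3)[OF m] that m2 by simp
        then show ?thesis using that m2 by (subst mono3_eq[of n], subst mono3_eq[of m]) simp
      qed
      then show "coeff (if Poly_Mapping.lookup n 2 = 0 then monom (Poly_Mapping.lookup q n) (Poly_Mapping.lookup n 1) else 0) (Poly_Mapping.lookup m 1) =
         (if n = m then Poly_Mapping.lookup q m else 0)"
        using m2 by (cases "n = m") auto
    qed
    also have "\<dots> = Poly_Mapping.lookup q m" using m by simp
    finally show False using assms(2) m by (simp add: in_keys_iff)
  qed
  then have "l dvd p" unfolding q(2)
    by (intro dvd_sum dvd_mult) (metis dvd_power_same dvd_triv_left power_one_right le_imp_power_dvd less_one linorder_not_less)
  then obtain r where r: "p = r * l" by (metis dvd_def mult.commute)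
  then have "r \<in> homog (k - 1)" using homog_cancel[of r l "k - 1" 1] p l_homog l_neq_0 by simp
  then show ?thesis using that r by blast
qed

text \<open>Powers of u, which restrict to 1, fill up every monomial to degree k.\<close>

lemma \<rho>_surj:
  assumes "int (degree q) \<le> k"
  obtains p where "p \<in> homog k" "\<rho> p = q"
proof
  let ?p = "\<Sum>i\<le>degree q. const3 (coeff q i) * (var3 1 ^ i * u ^ (nat k - i))"
  have "var3 1 ^ i * u ^ (nat k - i) \<in> homog k" if "i \<le> degree q" for i
  proof -
    have "var3 1 ^ i * u ^ (nat k - i) \<in> homog (int i * 1 + int (nat k - i) * 1)"
      by (intro homog_mult homog_power homog_var u_homog)
    then show ?thesis using that assms by (simp add: of_nat_diff)
  qed
  then show "?p \<in> homog k" by (intro homog_sum homog_const_mult) auto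
  have mon: "[:0, 1:] ^ n = monom (1::complex) n" for n
    by (simp add: monom_altdef)
  have "\<rho> ?p = (\<Sum>i\<le>degree q. smult (coeff q i) ([:0, 1:] ^ i))"
    by (simp add: \<rho>_simps \<rho>_u)
  also have "\<dots> = (\<Sum>i\<le>degree q. monom (coeff q i) i)"
    unfolding mon by (simp add: smult_monom)
  finally show "\<rho> ?p = q" by (simp add: poly_as_sum_of_monoms)
qed

text \<open>Coprimality gives the factor q as a polynomial in the parameter; the exact degree of
  \<open>\<rho> g2\<close> bounds the degree of q, so q lifts to a form of degree m - D.\<close>

lemma regular_mod_l:
  assumes A: "A \<in> homog m" "B \<in> homog m" and eq: "\<rho> A * \<rho> g1 + \<rho> B * \<rho> g2 = 0"
  obtains e where "e \<in> homog (m - D)" "\<rho> A = \<rho> e * \<rho> g2" "\<rho> B = - \<rho> e * \<rho> g1"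
proof -
  have "\<rho> g2 dvd \<rho> A * \<rho> g1" using eq by (metis dvd_triv_right dvd_add_left_iff dvd_0_right)
  then have "\<rho> g2 dvd \<rho> A" using coprime_\<rho> by (metis coprime_commute coprime_dvd_mult_left_iff)
  then obtain q where q: "\<rho> A = q * \<rho> g2" by (metis dvd_def mult.commute)
  have "\<rho> g2 * (q * \<rho> g1 + \<rho> B) = 0" using eq unfolding q by (simp add: algebra_simps)
  then have qB: "\<rho> B = - q * \<rho> g1" using \<rho>_g2_neq_0 by (simp add: eq_neg_iff_add_eq_0 add.commute)
  show ?thesis
  proof (cases "q = 0")
    case True
    then show ?thesis using that[of 0] q qB by (simp add: \<rho>_simps)
  next
    case False
    then have "A \<noteq> 0" using q \<rho>_g2_neq_0 by (auto simp: \<rho>_simps)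
    then have m: "m \<ge> 0" using homog_neg[of m] A(1) by (cases "m < 0") auto
    have "degree (\<rho> A) \<le> nat m" using degree_\<rho>_le[of A "nat m"] A(1) m by simp
    then have "int (degree q) \<le> m - D"
      using degree_\<rho>_g2 degree_mult_eq[OF False \<rho>_g2_neq_0] q m by simp
    then obtain e where "e \<in> homog (m - D)" "\<rho> e = q" using \<rho>_surj by blast
    then show ?thesis using that q qB by simp
  qed
qed

text \<open>The relation is solved on the line, the lifted solution subtracted and the remainder
  divided by l; this lowers the degree by 1.\<close>

lemma regular:
  assumes "A \<in> homog m" "B \<in> homog m" "A * g1 + B * g2 = 0"
  shows "\<exists>e\<in>homog (m - D). A = e * g2 \<and> B = - e * g1"
  using assms
\<comment> \<open>The measure is 0 exactly for negative m, where the only form is 0.\<close>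
proof (induction "nat (m + 1)" arbitrary: m A B)
  case 0
  then have "A = 0" "B = 0" using homog_neg[of m] by auto
  then show ?case by (intro bexI[of _ 0]) auto
next
  case (Suc n)
  have "\<rho> A * \<rho> g1 + \<rho> B * \<rho> g2 = 0" using Suc.prems(3) by (metis \<rho>_simps(1,4,7))
  then obtain e where e: "e \<in> homog (m - D)" "\<rho> A = \<rho> e * \<rho> g2" "\<rho> B = - \<rho> e * \<rho> g1"
    using regular_mod_l[OF Suc.prems(1,2)] by metis
  have eg: "e * g2 \<in> homog m" "e * g1 \<in> homog m"
    using homog_mult[OF e(1) g_homog(2)] homog_mult[OF e(1) g_homog(1)] by simp_all
  have "A - e * g2 \<in> homog m" "\<rho> (A - e * g2) = 0" using Suc.prems(1) eg e by (auto intro: homog_diff simp: \<rho>_simps)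
  then obtain A' where A': "A' \<in> homog (m - 1)" "A - e * g2 = A' * l" using \<rho>_eq_0_imp by metis
  have "B + e * g1 \<in> homog m" "\<rho> (B + e * g1) = 0" using Suc.prems(2) eg e by (auto intro: homog_add simp: \<rho>_simps)
  then obtain B' where B': "B' \<in> homog (m - 1)" "B + e * g1 = B' * l" using \<rho>_eq_0_imp by metis
  have AB: "A = e * g2 + A' * l" "B = - (e * g1) + B' * l" using A'(2) B'(2) by (simp_all add: algebra_simps)
  have "l * (A' * g1 + B' * g2) = 0" using Suc.prems(3) unfolding AB by (simp add: algebra_simps)
  then have "A' * g1 + B' * g2 = 0" using l_neq_0 by simp
  then obtain e' where e': "e' \<in> homog (m - 1 - D)" "A' = e' * g2" "B' = - e' * g1"
    using Suc.hyps(1)[OF _ A'(1) B'(1)] Suc.hyps(2) by fastforce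
  have "e + e' * l \<in> homog (m - D)"
    using homog_mult[OF e'(1) l_homog] e(1) by (intro homog_add) (simp_all add: algebra_simps)
  moreover have "A = (e + e' * l) * g2" "B = - (e + e' * l) * g1"
    unfolding AB e' by (simp_all add: algebra_simps)
  ultimately show ?case by blast
qed

end

section \<open>Hilbert functions\<close>

lemma linear_coord:
  "Vector_Spaces.linear (\<lambda>c. smult3 (const3 c)) scale3 (\<lambda>t. p * fst t + q * fst (snd t) + r * snd (snd t))"
  unfolding Vector_Spaces.linear_iff
  by (intro conjI allI S.vector_space_axioms S3C.vector_space_axioms)
    (auto simp: scale3_def smult3_def algebra_simps split: prod.splits)

lemma subspace_homog_triples: "S3C.subspace (homog_triples k)"
  by (rule S3C.subspaceI) (auto simp: homog_triples_def smult3_def zero_prod_def homog_add homog_const_mult)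

lemma fin_dim_homog_triples: "fin_dim (\<lambda>c. smult3 (const3 c)) (homog_triples k)"
  and dim_homog_triples: "S3C.dim (homog_triples k) = 3 * S.dim (homog k)"
proof -
  obtain B where B: "finite B" "homog k \<subseteq> S.span B" using fin_dim_homog[of k] unfolding fin_dim_def by blast
  let ?B = "(\<lambda>b. (b, 0, 0)) ` B \<union> (\<lambda>b. (0, b, 0)) ` B \<union> (\<lambda>b. (0, 0, b)) ` B :: triple3 set"
  have 1: "(p, 0, 0) \<in> S3C.span ?B" "(0, p, 0) \<in> S3C.span ?B" "(0, 0, p) \<in> S3C.span ?B" if "p \<in> homog k" for p
  proof -
    have "p \<in> S.span B" using that B by auto
    then have "(p, 0, 0) \<in> S3C.span ?B \<and> (0, p, 0) \<in> S3C.span ?B \<and> (0, 0, p) \<in> S3C.span ?B"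
    proof (induction rule: S.span_induct_alt)
      case base
      then show ?case using S3C.span_zero by (simp add: zero_prod_def)
    next
      case (step c x y)
      have "smult3 (const3 c) (x, 0, 0) + (y, 0, 0) \<in> S3C.span ?B" "smult3 (const3 c) (0, x, 0) + (0, y, 0) \<in> S3C.span ?B"
         "smult3 (const3 c) (0, 0, x) + (0, 0, y) \<in> S3C.span ?B"
        using step by (auto intro!: S3C.span_add S3C.span_scale intro: S3C.span_base)
      then show ?case by (simp add: smult3_def scale3_def)
    qed
    then show "(p, 0, 0) \<in> S3C.span ?B" "(0, p, 0) \<in> S3C.span ?B" "(0, 0, p) \<in> S3C.span ?B" by auto
  qed
  have hs: "homog_triples k \<subseteq> S3C.span ?B"
  proof
    fix t assume "t \<in> homog_triples k"
    then obtain p q r where t: "t = (p, q, r)" "p \<in> homog k" "q \<in> homog k" "r \<in> homog k"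
      by (auto simp: homog_triples_def)
    have "(p, 0, 0) + (0, q, 0) + (0, 0, r) \<in> S3C.span ?B"
      using 1 t by (intro S3C.span_add) auto
    then show "t \<in> S3C.span ?B" by (simp add: t)
  qed
  have "finite ?B" using B(1) by simp
  then show fin: "fin_dim (\<lambda>c. smult3 (const3 c)) (homog_triples k)"
    unfolding fin_dim_def using hs by (intro exI[of _ ?B] conjI)
  interpret l0: Vector_Spaces.linear "\<lambda>c. smult3 (const3 c)" scale3 "\<lambda>t. 1 * fst t + 0 * fst (snd t) + 0 * snd (snd t)"
    by (rule linear_coord)
  interpret l1: Vector_Spaces.linear "\<lambda>c. smult3 (const3 c)" scale3 "\<lambda>t. 0 * fst t + 1 * fst (snd t) + 0 * snd (snd t)"
    by (rule linear_coord)
  interpret l2: Vector_Spaces.linear "\<lambda>c. smult3 (const3 c)" scale3 "\<lambda>t. 0 * fst t + 0 * fst (snd t) + 1 * snd (snd t)"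
    by (rule linear_coord)
  define U1 where "U1 = {t \<in> homog_triples k. 1 * fst t + 0 * fst (snd t) + 0 * snd (snd t) = 0}"
  define U2 where "U2 = {t \<in> U1. 0 * fst t + 1 * fst (snd t) + 0 * snd (snd t) = 0}"
  have sub1: "S3C.subspace U1"
    using S3C.subspace_inter[OF subspace_homog_triples l0.subspace_kernel, of k] by (simp add: U1_def Int_def)
  have sub2: "S3C.subspace U2"
    using S3C.subspace_inter[OF sub1 l1.subspace_kernel] by (simp add: U2_def Int_def)
  note sub = sub1 sub2
  have f: "fin_dim (\<lambda>c. smult3 (const3 c)) U1" "fin_dim (\<lambda>c. smult3 (const3 c)) U2"
    by (auto intro!: S3C.fin_dim_subset[OF fin] simp: U1_def U2_def)
  have im0: "(\<lambda>t. 1 * fst t + 0 * fst (snd t) + 0 * snd (snd t)) ` homog_triples k = homog k"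
  proof (intro equalityI subsetI)
    fix p assume "p \<in> homog k"
    then have "(p, 0, 0) \<in> homog_triples k" by (simp add: homog_triples_def)
    then show "p \<in> (\<lambda>t. 1 * fst t + 0 * fst (snd t) + 0 * snd (snd t)) ` homog_triples k" by force
  qed (auto simp: homog_triples_def)
  have im1: "(\<lambda>t. 0 * fst t + 1 * fst (snd t) + 0 * snd (snd t)) ` U1 = homog k"
  proof (intro equalityI subsetI)
    fix p assume "p \<in> homog k"
    then have "(0, p, 0) \<in> U1" by (simp add: homog_triples_def U1_def)
    then show "p \<in> (\<lambda>t. 0 * fst t + 1 * fst (snd t) + 0 * snd (snd t)) ` U1" by force
  qed (auto simp: homog_triples_def U1_def)
  have im2: "(\<lambda>t. 0 * fst t + 0 * fst (snd t) + 1 * snd (snd t)) ` U2 = homog k"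
  proof (intro equalityI subsetI)
    fix p assume "p \<in> homog k"
    then have "(0, 0, p) \<in> U2" by (simp add: homog_triples_def U1_def U2_def)
    then show "p \<in> (\<lambda>t. 0 * fst t + 0 * fst (snd t) + 1 * snd (snd t)) ` U2" by force
  qed (auto simp: homog_triples_def U1_def U2_def)
  have "S3C.dim (homog_triples k) = S3C.dim U1 + S.dim (homog k)"
    using l0.rank_nullity[OF subspace_homog_triples fin] unfolding im0 U1_def .
  moreover have "S3C.dim U1 = S3C.dim U2 + S.dim (homog k)"
    using l1.rank_nullity[OF sub(1) f(1)] unfolding im1 U2_def .
  moreover have "S.dim (homog k) = S3C.dim U2"
    using l2.dim_image_inj[OF sub(2) f(2)] unfolding im2 by (auto simp: U1_def U2_def zero_prod_def prod_eq_iff)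
  ultimately show "S3C.dim (homog_triples k) = 3 * S.dim (homog k)" by simp
qed

lemma jacobian_add: "x \<in> jacobian_ideal f \<Longrightarrow> y \<in> jacobian_ideal f \<Longrightarrow> x + y \<in> jacobian_ideal f"
proof -
  assume "x \<in> jacobian_ideal f" "y \<in> jacobian_ideal f"
  then obtain a b c a' b' c' where "x = a * pd 0 f + b * pd 1 f + c * pd 2 f" "y = a' * pd 0 f + b' * pd 1 f + c' * pd 2 f"
    unfolding jacobian_ideal_def by blast
  then have "x + y = (a + a') * pd 0 f + (b + b') * pd 1 f + (c + c') * pd 2 f" by (simp add: algebra_simps)
  then show "x + y \<in> jacobian_ideal f" unfolding jacobian_ideal_def by blast
qed

lemma jacobian_mult: "x \<in> jacobian_ideal f \<Longrightarrow> p * x \<in> jacobian_ideal f"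
proof -
  assume "x \<in> jacobian_ideal f"
  then obtain a b c where "x = a * pd 0 f + b * pd 1 f + c * pd 2 f"
    unfolding jacobian_ideal_def by blast
  then have "p * x = (p * a) * pd 0 f + (p * b) * pd 1 f + (p * c) * pd 2 f" by (simp add: algebra_simps)
  then show "p * x \<in> jacobian_ideal f" unfolding jacobian_ideal_def by blast
qed

lemma subspace_jacobian: "S.subspace (jacobian_ideal f \<inter> homog k)"
proof (rule S.subspace_inter[OF S.subspaceI subspace_homog])
  show "0 \<in> jacobian_ideal f" unfolding jacobian_ideal_def by (auto intro!: exI[of _ 0])
qed (auto simp: scale3_def intro: jacobian_add jacobian_mult)

text \<open>The three partial derivatives have the same degree, so replacing the coefficients by
  their components of the right degree keeps the equation.\<close>

lemma jacobian_homog: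
  assumes "f \<in> homog (int d)" "x \<in> jacobian_ideal f" "x \<in> homog k"
  obtains a b c where "a \<in> homog (k - (int d - 1))" "b \<in> homog (k - (int d - 1))" "c \<in> homog (k - (int d - 1))"
    "x = a * pd 0 f + b * pd 1 f + c * pd 2 f"
proof -
  obtain a b c where "x = a * pd 0 f + b * pd 1 f + c * pd 2 f"
    using assms(2) unfolding jacobian_ideal_def by blast
  then have "hcomp k x = hcomp (k - (int d - 1)) a * pd 0 f + hcomp (k - (int d - 1)) b * pd 1 f + hcomp (k - (int d - 1)) c * pd 2 f"
    by (simp add: hcomp_add hcomp_mult_homog[OF homog_pd[OF assms(1)]])
  then show ?thesis using that hcomp_homog hcomp_homog_id[OF assms(3)] by metis
qed

lemma ar_jacobian:
  assumes "f \<in> homog (int d)"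
  shows "int (ar f j) + int (S.dim (jacobian_ideal f \<inter> homog (j + int d - 1))) = 3 * sdim j"
proof -
  let ?\<phi> = "\<lambda>t. pd 0 f * fst t + pd 1 f * fst (snd t) + pd 2 f * snd (snd t)"
  interpret l: Vector_Spaces.linear "\<lambda>c. smult3 (const3 c)" scale3 ?\<phi> by (rule linear_coord)
  have "{t \<in> homog_triples j. ?\<phi> t = 0} = AR f \<inter> homog_triples j"
    by (auto simp: AR_def mult.commute)
  moreover have "?\<phi> ` homog_triples j = jacobian_ideal f \<inter> homog (j + int d - 1)"
  proof (intro equalityI subsetI)
    fix x assume "x \<in> ?\<phi> ` homog_triples j"
    then obtain a b c where abc: "a \<in> homog j" "b \<in> homog j" "c \<in> homog j" "x = a * pd 0 f + b * pd 1 f + c * pd 2 f"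
      by (auto simp: homog_triples_def mult.commute)
    have pm: "p * pd i f \<in> homog (j + int d - 1)" if "p \<in> homog j" for p i
      using homog_mult[OF that homog_pd[OF assms, of i]] by (simp add: algebra_simps)
    have "x \<in> homog (j + int d - 1)" unfolding abc(4) by (intro homog_add pm abc)
    then show "x \<in> jacobian_ideal f \<inter> homog (j + int d - 1)" using abc unfolding jacobian_ideal_def by blast
  next
    fix x assume "x \<in> jacobian_ideal f \<inter> homog (j + int d - 1)"
    then obtain a b c where abc: "a \<in> homog j" "b \<in> homog j" "c \<in> homog j" "x = a * pd 0 f + b * pd 1 f + c * pd 2 f"
      using jacobian_homog[OF assms, of x "j + int d - 1"] by auto
    then show "x \<in> ?\<phi> ` homog_triples j"
      by (intro image_eqI[of _ _ "(a, b, c)"]) (auto simp: homog_triples_def mult.commute)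
  qed
  ultimately show ?thesis
    using l.rank_nullity[OF subspace_homog_triples fin_dim_homog_triples, of j]
    by (simp add: dim_homog_triples ar_def)
qed

lemma milnor_dim_jacobian: "int (milnor_dim f k) + int (S.dim (jacobian_ideal f \<inter> homog k)) = sdim k"
  unfolding milnor_dim_def using S.dim_quot[OF subspace_homog fin_dim_homog subspace_jacobian, of f k] by simp

text \<open>The exact sequence that leads from AR(f) through S^3 and S to M(f). It lets every value
  of m(f) be traded for one of ar(f).\<close>

lemma milnor_dim_eq:
  assumes "f \<in> homog (int d)"
  shows "int (milnor_dim f k) = sdim k - 3 * sdim (k - (int d - 1)) + int (ar f (k - (int d - 1)))"
  using milnor_dim_jacobian[of f k] ar_jacobian[OF assms, of "k - (int d - 1)"] by simp

lemma sdim_mono: "j \<le> k \<Longrightarrow> sdim j \<le> sdim k"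
proof -
  assume jk: "j \<le> k"
  show ?thesis
  proof (cases "j < 0")
    case False
    have "(j + 1) * (j + 2) \<le> (k + 1) * (k + 2)" using jk False by (intro mult_mono) auto
    then show ?thesis using sdim_double[of j] sdim_double[of k] jk False by simp
  qed (simp add: sdim_neg)
qed

section \<open>The complete intersection ideal (g1, g2) and its colon ideal\<close>

context transversal_line
begin

text \<open>The degree k part of I = (g1, g2), written in the shape to which
  \<open>dim_mult_plus\<close> applies.\<close>

definition Ik :: "int \<Rightarrow> poly3 set" where
  "Ik k = {p * g1 + w | p w. p \<in> homog (k - D) \<and> w \<in> (\<lambda>p. p * g2) ` homog (k - D)}"

lemma IkI: "A \<in> homog (k - D) \<Longrightarrow> B \<in> homog (k - D) \<Longrightarrow> A * g1 + B * g2 \<in> Ik k"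
  unfolding Ik_def by blast

lemma IkE:
  assumes "x \<in> Ik k"
  obtains A B where "A \<in> homog (k - D)" "B \<in> homog (k - D)" "x = A * g1 + B * g2"
  using assms unfolding Ik_def by blast

lemma Ik_homog: "Ik k \<subseteq> homog k"
proof
  fix x assume "x \<in> Ik k"
  then obtain A B where "A \<in> homog (k - D)" "B \<in> homog (k - D)" "x = A * g1 + B * g2" by (rule IkE)
  then show "x \<in> homog k" using homog_mult[of A "k - D" g1 D] homog_mult[of B "k - D" g2 D] g_homog by (auto intro: homog_add)
qed

lemma Ik_subspace: "S.subspace (Ik k)"
  unfolding Ik_def by (rule subspace_mult_plus[OF subspace_homog subspace_mult_image[OF subspace_homog]])

lemma Ik_fin_dim: "fin_dim scale3 (Ik k)"
  by (rule S.fin_dim_subset[OF fin_dim_homog Ik_homog])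

lemma Ik_mult:
  assumes "p \<in> homog j" "x \<in> Ik k"
  shows "p * x \<in> Ik (j + k)" "x * p \<in> Ik (k + j)"
proof -
  obtain A B where AB: "A \<in> homog (k - D)" "B \<in> homog (k - D)" "x = A * g1 + B * g2" using assms(2) by (rule IkE)
  have "(p * A) * g1 + (p * B) * g2 \<in> Ik (j + k)"
    using homog_mult[OF assms(1) AB(1)] homog_mult[OF assms(1) AB(2)] by (intro IkI) (simp_all add: algebra_simps)
  then show "p * x \<in> Ik (j + k)" by (simp add: AB algebra_simps)
  then show "x * p \<in> Ik (k + j)" by (simp add: mult.commute add.commute)
qed

text \<open>By \<open>regular\<close> the only relations between g1 and g2 are the Koszul ones,
  which are parametrized by forms of degree k - 2 D.\<close>

lemma dim_Ik: "int (S.dim (Ik k)) = 2 * sdim (k - D) - sdim (k - 2 * D)"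
proof -
  let ?W = "(\<lambda>p. p * g2) ` homog (k - D)"
  have W: "S.subspace ?W" by (rule subspace_mult_image[OF subspace_homog])
  have dW: "S.dim ?W = S.dim (homog (k - D))" by (rule dim_mult_image[OF subspace_homog fin_dim_homog g2_neq_0])
  have "?W \<subseteq> homog k" using homog_mult[OF _ g_homog(2), of _ "k - D"] by auto
  then have fW: "fin_dim scale3 ?W" using S.fin_dim_subset[OF fin_dim_homog] by blast
  have "{p \<in> homog (k - D). p * g1 \<in> ?W} = (\<lambda>p. p * g2) ` homog (k - 2 * D)"
  proof (intro equalityI subsetI)
    fix p assume "p \<in> {p \<in> homog (k - D). p * g1 \<in> ?W}"
    then obtain q where q: "p \<in> homog (k - D)" "q \<in> homog (k - D)" "p * g1 = q * g2" by auto
    then have "p * g1 + (- q) * g2 = 0" by simp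
    then show "p \<in> (\<lambda>p. p * g2) ` homog (k - 2 * D)"
      using regular[OF q(1) homog_uminus[OF q(2)]] by (auto simp: algebra_simps)
  next
    fix p assume "p \<in> (\<lambda>p. p * g2) ` homog (k - 2 * D)"
    then obtain e where e: "e \<in> homog (k - 2 * D)" "p = e * g2" by auto
    have "e * g1 \<in> homog (k - D)" "p \<in> homog (k - D)"
      using homog_mult[OF e(1) g_homog(1)] homog_mult[OF e(1) g_homog(2)] e(2) by (simp_all add: algebra_simps)
    moreover have "p * g1 = (e * g1) * g2" by (simp add: e algebra_simps)
    ultimately show "p \<in> {p \<in> homog (k - D). p * g1 \<in> ?W}" by blast
  qed
  then have "S.dim {p \<in> homog (k - D). p * g1 \<in> ?W} = S.dim (homog (k - 2 * D))"
    using dim_mult_image[OF subspace_homog fin_dim_homog g2_neq_0] by simp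
  then show ?thesis
    using dim_mult_plus[OF subspace_homog fin_dim_homog W fW, of g1 "k - D"] dW unfolding Ik_def by simp
qed

text \<open>On the line the relation s l = A g1 + B g2 becomes a Koszul relation. After subtracting
  its lift, A and B are divisible by l, and l cancels.\<close>

lemma Ik_cancel_l:
  assumes s: "s \<in> homog k" and "s * l \<in> Ik (k + 1)"
  shows "s \<in> Ik k"
proof -
  obtain A B where AB: "A \<in> homog (k + 1 - D)" "B \<in> homog (k + 1 - D)" "s * l = A * g1 + B * g2" using assms(2) by (rule IkE)
  have "\<rho> A * \<rho> g1 + \<rho> B * \<rho> g2 = \<rho> (s * l)" unfolding AB(3) by (simp add: \<rho>_simps)
  also have "\<dots> = 0" by (simp add: \<rho>_simps \<rho>_l)
  finally obtain e where e: "e \<in> homog (k + 1 - D - D)" "\<rho> A = \<rho> e * \<rho> g2" "\<rho> B = - \<rho> e * \<rho> g1"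
    using regular_mod_l[OF AB(1,2)] by metis
  have eg: "e * g2 \<in> homog (k + 1 - D)" "e * g1 \<in> homog (k + 1 - D)"
    using homog_mult[OF e(1) g_homog(2)] homog_mult[OF e(1) g_homog(1)] by simp_all
  have "A - e * g2 \<in> homog (k + 1 - D)" "\<rho> (A - e * g2) = 0" using AB(1) eg e by (auto intro: homog_diff simp: \<rho>_simps)
  then obtain A' where A': "A' \<in> homog (k + 1 - D - 1)" "A - e * g2 = A' * l" using \<rho>_eq_0_imp by metis
  have "B + e * g1 \<in> homog (k + 1 - D)" "\<rho> (B + e * g1) = 0" using AB(2) eg e by (auto intro: homog_add simp: \<rho>_simps)
  then obtain B' where B': "B' \<in> homog (k + 1 - D - 1)" "B + e * g1 = B' * l" using \<rho>_eq_0_imp by metis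
  have AB2: "A = e * g2 + A' * l" "B = - (e * g1) + B' * l" using A'(2) B'(2) by (simp_all add: algebra_simps)
  have "s * l = (A' * g1 + B' * g2) * l" unfolding AB(3) AB2 by (simp add: algebra_simps)
  then have "s = A' * g1 + B' * g2" using l_neq_0 by simp
  then show ?thesis using IkI[of A' k B'] A'(1) B'(1) by simp
qed

lemma Ik_cancel_l_power: "s \<in> homog k \<Longrightarrow> s * l ^ n \<in> Ik (k + int n) \<Longrightarrow> s \<in> Ik k"
proof (induction n)
  case (Suc n)
  have "s * l ^ n \<in> homog (k + int n)" using homog_mult[OF Suc.prems(1) homog_power[OF l_homog, of n]] by simp
  moreover have "s * l ^ n * l \<in> Ik (k + int n + 1)" using Suc.prems(2) by (simp add: algebra_simps)
  ultimately show ?case using Ik_cancel_l Suc by blast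
qed simp

lemma pd_f_combination: "\<exists>r s t. pd i f = const3 r * g1 + const3 s * g2 + const3 t * g3"
proof -
  have "\<exists>r0 t0 r2 t2. pd 0 f = const3 r0 * g1 + const3 t0 * g3 \<and> pd 2 f = const3 r2 * g1 + const3 t2 * g3"
  proof (cases "a = 0")
    case False
    have "const3 (1 / a) * (const3 a * pd 0 f) = pd 0 f" using False
      by (simp flip: const3_mult mult.assoc add: const3_1)
    then have "pd 0 f = const3 (1 / a) * g1 + const3 (- c / a) * g3"
      by (simp add: g1_def g3_def False distrib_left const3_uminus flip: mult.assoc const3_mult)
    moreover have "pd 2 f = const3 0 * g1 + const3 1 * g3" by (simp add: g3_def False const3_1)
    ultimately show ?thesis by blast
  next
    case True
    then have "c \<noteq> 0" using ac by simp
    then have "const3 (1 / c) * (const3 c * pd 2 f) = pd 2 f"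
      by (simp flip: const3_mult mult.assoc add: const3_1)
    then have "pd 2 f = const3 (1 / c) * g1 + const3 0 * g3"
      unfolding g1_def g3_def using True by simp
    moreover have "pd 0 f = const3 0 * g1 + const3 1 * g3" unfolding g3_def using True by (simp add: const3_1)
    ultimately show ?thesis by blast
  qed
  then obtain r0 t0 r2 t2 where e: "pd 0 f = const3 r0 * g1 + const3 t0 * g3" "pd 2 f = const3 r2 * g1 + const3 t2 * g3" by blast
  have "pd 1 f = g2 - const3 \<alpha> * pd 0 f - const3 \<gamma> * pd 2 f" by (simp add: g2_def)
  also have "\<dots> = const3 (- \<alpha> * r0 - \<gamma> * r2) * g1 + const3 1 * g2 + const3 (- \<alpha> * t0 - \<gamma> * t2) * g3"
    unfolding e by (simp add: const3_diff const3_uminus const3_mult const3_1 algebra_simps)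
  finally have e1: "pd 1 f = const3 (- \<alpha> * r0 - \<gamma> * r2) * g1 + const3 1 * g2 + const3 (- \<alpha> * t0 - \<gamma> * t2) * g3" .
  consider "i = 0" | "i = 1" | "i = 2" using exhaust_3 by blast
  then show ?thesis
  proof cases
    case 1
    have "pd 0 f = const3 r0 * g1 + const3 0 * g2 + const3 t0 * g3" by (simp add: e)
    then show ?thesis using 1 by blast
  next
    case 2
    then show ?thesis using e1 by blast
  next
    case 3
    have "pd 2 f = const3 r2 * g1 + const3 0 * g2 + const3 t2 * g3" by (simp add: e)
    then show ?thesis using 3 by blast
  qed
qed

lemma g_in_jacobian: "g1 \<in> jacobian_ideal f" "g2 \<in> jacobian_ideal f" "g3 \<in> jacobian_ideal f"
proof -
  have "g1 = const3 a * pd 0 f + 0 * pd 1 f + const3 c * pd 2 f" by (simp add: g1_def)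
  then show "g1 \<in> jacobian_ideal f" unfolding jacobian_ideal_def by blast
  have "g2 = const3 \<alpha> * pd 0 f + 1 * pd 1 f + const3 \<gamma> * pd 2 f" by (simp add: g2_def)
  then show "g2 \<in> jacobian_ideal f" unfolding jacobian_ideal_def by blast
  have "g3 = (if a \<noteq> 0 then 0 else 1) * pd 0 f + 0 * pd 1 f + (if a \<noteq> 0 then 1 else 0) * pd 2 f" by (simp add: g3_def)
  then show "g3 \<in> jacobian_ideal f" unfolding jacobian_ideal_def by blast
qed

lemma Ik_jacobian: "Ik k \<subseteq> jacobian_ideal f"
  by (auto elim!: IkE intro!: jacobian_add jacobian_mult g_in_jacobian)

lemma jacobian_eq: "jacobian_ideal f \<inter> homog k = {s * g3 + w | s w. s \<in> homog (k - D) \<and> w \<in> Ik k}"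
proof (intro equalityI subsetI)
  fix x assume "x \<in> jacobian_ideal f \<inter> homog k"
  then obtain A B C where x: "A \<in> homog (k - D)" "B \<in> homog (k - D)" "C \<in> homog (k - D)" "x = A * pd 0 f + B * pd 1 f + C * pd 2 f"
    using jacobian_homog[OF f_homog, of x k] unfolding D_def by auto
  obtain r0 s0 t0 where 0: "pd 0 f = const3 r0 * g1 + const3 s0 * g2 + const3 t0 * g3" using pd_f_combination by blast
  obtain r1 s1 t1 where 1: "pd 1 f = const3 r1 * g1 + const3 s1 * g2 + const3 t1 * g3" using pd_f_combination by blast
  obtain r2 s2 t2 where 2: "pd 2 f = const3 r2 * g1 + const3 s2 * g2 + const3 t2 * g3" using pd_f_combination by blast
  have "x = (const3 t0 * A + const3 t1 * B + const3 t2 * C) * g3 +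
     ((const3 r0 * A + const3 r1 * B + const3 r2 * C) * g1 + (const3 s0 * A + const3 s1 * B + const3 s2 * C) * g2)"
    unfolding x(4) 0 1 2 by (simp add: algebra_simps)
  moreover have "const3 t0 * A + const3 t1 * B + const3 t2 * C \<in> homog (k - D)" for t0 t1 t2
    by (intro homog_add homog_const_mult x)
  ultimately show "x \<in> {s * g3 + w | s w. s \<in> homog (k - D) \<and> w \<in> Ik k}" using IkI by blast
next
  fix x assume "x \<in> {s * g3 + w | s w. s \<in> homog (k - D) \<and> w \<in> Ik k}"
  then obtain s w where sw: "s \<in> homog (k - D)" "w \<in> Ik k" "x = s * g3 + w" by blast
  have "s * g3 \<in> homog k" using homog_mult[OF sw(1) g_homog(3)] by simp
  then have "x \<in> homog k" using sw(2,3) Ik_homog[of k] by (auto intro: homog_add)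
  moreover have "x \<in> jacobian_ideal f"
    unfolding sw(3) using sw(2) Ik_jacobian by (intro jacobian_add jacobian_mult g_in_jacobian) auto
  ultimately show "x \<in> jacobian_ideal f \<inter> homog k" by blast
qed

text \<open>The degree j part of the colon ideal I : g3, that is, the g3-coefficients of relations
  among g1, g2, g3. It sees the syzygies of f up to multiples of the Koszul relation of g1 and g2,
  whence \<open>dim_Ck\<close>.\<close>

definition Ck :: "int \<Rightarrow> poly3 set" where
  "Ck j = {s \<in> homog j. s * g3 \<in> Ik (j + D)}"

lemma Ck_subspace: "S.subspace (Ck j)"
proof (rule S.subspaceI)
  fix x y assume "x \<in> Ck j" "y \<in> Ck j"
  then show "x + y \<in> Ck j"
    using S.subspace_add[OF Ik_subspace] by (auto simp: Ck_def distrib_right intro: homog_add)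
next
  fix t x assume "x \<in> Ck j"
  then show "scale3 t x \<in> Ck j"
    using S.subspace_scale[OF Ik_subspace, of "x * g3" "j + D" t]
    by (auto simp: Ck_def scale3_def mult.assoc intro: homog_const_mult)
qed (use S.subspace_0[OF Ik_subspace] in \<open>auto simp: Ck_def\<close>)

lemma Ck_fin_dim: "fin_dim scale3 (Ck j)"
  by (rule S.fin_dim_subset[OF fin_dim_homog]) (auto simp: Ck_def)

lemma dim_Ck: "int (S.dim (Ck j)) = int (ar f j) - sdim (j - D)"
proof -
  have "S.dim (jacobian_ideal f \<inter> homog (j + D)) + S.dim (Ck j) = S.dim (homog j) + S.dim (Ik (j + D))"
    using dim_mult_plus[OF subspace_homog fin_dim_homog Ik_subspace Ik_fin_dim, of g3 j "j + D"]
    unfolding jacobian_eq Ck_def by simp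
  moreover have e: "j + int d - 1 = j + D" by (simp add: D_def)
  ultimately show ?thesis using dim_Ik[of "j + D"] ar_jacobian[OF f_homog, of j, unfolded e] by simp
qed

text \<open>Bezout's number of points. The bound says k - 2 D \<ge> - 2, from where on all
  dimensions involved are given by the quadratic.\<close>

lemma hilbert_Ik: "k \<ge> 2 * D - 2 \<Longrightarrow> sdim k - int (S.dim (Ik k)) = D ^ 2"
  using sdim_double[of k] sdim_double[of "k - D"] sdim_double[of "k - 2 * D"] D_ge
  by (simp add: dim_Ik power2_eq_square algebra_simps)

text \<open>Multiplication by l on S/I is injective, and source and target have the same dimension
  D^2, so it is surjective.\<close>

lemma homog_eq_l:
  assumes "k \<ge> 2 * D - 1"
  shows "homog k = {s * l + w | s w. s \<in> homog (k - 1) \<and> w \<in> Ik k}"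
proof -
  let ?V = "{s * l + w | s w. s \<in> homog (k - 1) \<and> w \<in> Ik k}"
  have ker: "{s \<in> homog (k - 1). s * l \<in> Ik k} = Ik (k - 1)"
    using Ik_cancel_l[of _ "k - 1"] Ik_mult(2)[OF l_homog, of _ "k - 1"] Ik_homog[of "k - 1"] by auto
  have "int (S.dim ?V) + int (S.dim (Ik (k - 1))) = sdim (k - 1) + int (S.dim (Ik k))"
    using dim_mult_plus[OF subspace_homog fin_dim_homog Ik_subspace Ik_fin_dim, of l "k - 1" k] unfolding ker by linarith
  then have d: "S.dim (homog k) \<le> S.dim ?V"
    using hilbert_Ik[of k] hilbert_Ik[of "k - 1"] assms by linarith
  have "?V \<subseteq> homog k"
    using homog_mult[OF _ l_homog, of _ "k - 1"] Ik_homog[of k] by (auto intro!: homog_add)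
  then show ?thesis
    using S.subspace_eq_of_dim_ge[OF subspace_mult_plus[OF subspace_homog Ik_subspace] fin_dim_homog _ d] by auto
qed

lemma milnor_dim_bounded: "k \<ge> 2 * D - 2 \<Longrightarrow> int (milnor_dim f k) \<le> D ^ 2"
proof -
  assume k: "k \<ge> 2 * D - 2"
  have "S.dim (Ik k) \<le> S.dim (jacobian_ideal f \<inter> homog k)"
    using Ik_jacobian Ik_homog by (intro S.dim_mono_finite S.fin_dim_subset[OF fin_dim_homog]) auto
  then show ?thesis using hilbert_Ik[OF k] milnor_dim_jacobian[of f k] by linarith
qed

end

section \<open>Duality in an Artinian complete intersection\<close>

context transversal_line
begin

text \<open>The degree k part of (g1, g2, l^N).\<close>

definition Bk :: "nat \<Rightarrow> int \<Rightarrow> poly3 set" where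
  "Bk N k = {s * l ^ N + w | s w. s \<in> homog (k - int N) \<and> w \<in> Ik k}"

lemma l_power_homog: "l ^ n \<in> homog (int n)"
  using homog_power[OF l_homog, of n] by simp

lemma Bk_subspace: "S.subspace (Bk N k)"
  unfolding Bk_def by (rule subspace_mult_plus[OF subspace_homog Ik_subspace])

lemma Bk_homog: "Bk N k \<subseteq> homog k"
  using homog_mult[OF _ l_power_homog[of N], of _ "k - int N"] Ik_homog[of k]
  by (auto simp: Bk_def intro!: homog_add)

lemma Bk_fin_dim: "fin_dim scale3 (Bk N k)"
  by (rule S.fin_dim_subset[OF fin_dim_homog Bk_homog])

lemma BkI: "s \<in> homog (k - int N) \<Longrightarrow> w \<in> Ik k \<Longrightarrow> s * l ^ N + w \<in> Bk N k"
  unfolding Bk_def by blast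

lemma Ik_Bk: "Ik k \<subseteq> Bk N k"
  using BkI[of 0 k N] by auto

lemma kernel_l_power: "{s \<in> homog k. s * l ^ n \<in> Ik (k + int n)} = Ik k"
  using Ik_cancel_l_power[of _ k n] Ik_mult(2)[OF l_power_homog[of n], of _ k] Ik_homog[of k] by blast

text \<open>As multiplication by l^N is injective on S/I, the quotient has dimension H(2 D - 3 + N)
  - H(2 D - 3) for the Hilbert function H of S/I; the first value is D^2, the second one
  less.\<close>

lemma dim_Bk_socle:
  assumes "N \<ge> 1"
  shows "sdim (2 * D - 3 + int N) - int (S.dim (Bk N (2 * D - 3 + int N))) = 1"
proof -
  let ?k = "2 * D - 3"
  have "S.dim (Bk N (?k + int N)) + S.dim (Ik ?k) = S.dim (homog ?k) + S.dim (Ik (?k + int N))"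
    using dim_mult_plus[OF subspace_homog fin_dim_homog Ik_subspace Ik_fin_dim, of "l ^ N" ?k "?k + int N"]
    unfolding kernel_l_power by (simp add: Bk_def)
  moreover have "sdim (?k + int N) - int (S.dim (Ik (?k + int N))) = D ^ 2"
    using assms by (intro hilbert_Ik) simp
  moreover have "sdim ?k - int (S.dim (Ik ?k)) = D ^ 2 - 1"
    using sdim_double[of ?k] sdim_double[of "?k - D"] sdim_neg[of "?k - 2 * D"] D_ge
    by (simp add: dim_Ik power2_eq_square algebra_simps)
  ultimately show ?thesis by linarith
qed

text \<open>On the line the quotient by g1, g2 has its socle in degree 2 D - 2, so below that degree
  an element killed by u and y is zero. The two equations express that u t and y t vanish in this
  quotient; u does not appear because it restricts to 1.\<close>

lemma line_socle:
  assumes t: "t \<in> homog e" and e: "e \<le> 2 * D - 3"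
    and A: "A \<in> homog (e + 1 - D)" "B \<in> homog (e + 1 - D)" "\<rho> t = \<rho> A * \<rho> g1 + \<rho> B * \<rho> g2"
    and A': "A' \<in> homog (e + 1 - D)" "B' \<in> homog (e + 1 - D)" "[:0, 1:] * \<rho> t = \<rho> A' * \<rho> g1 + \<rho> B' * \<rho> g2"
  obtains s w where "s \<in> homog (e - 1)" "w \<in> Ik e" "t = s * l + w"
proof -
  have h: "var3 1 * X - u * Y \<in> homog (e + 2 - D)" if "X \<in> homog (e + 1 - D)" "Y \<in> homog (e + 1 - D)" for X Y
    using homog_mult[OF homog_var that(1)] homog_mult[OF u_homog that(2)] by (intro homog_diff) (simp_all add: algebra_simps)
  have "\<rho> (var3 1 * A - u * A') * \<rho> g1 + \<rho> (var3 1 * B - u * B') * \<rho> g2 =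
      [:0, 1:] * (\<rho> A * \<rho> g1 + \<rho> B * \<rho> g2) - (\<rho> A' * \<rho> g1 + \<rho> B' * \<rho> g2)"
    unfolding \<rho>_simps \<rho>_u by (simp only: algebra_simps mult_1_left)
  also have "\<dots> = 0" unfolding A(3)[symmetric] A'(3)[symmetric] by simp
  finally obtain z where z: "z \<in> homog (e + 2 - D - D)" "\<rho> (var3 1 * A - u * A') = \<rho> z * \<rho> g2" "\<rho> (var3 1 * B - u * B') = - \<rho> z * \<rho> g1"
    using regular_mod_l[OF h[OF A(1) A'(1)] h[OF A(2) A'(2)]] by metis
  \<comment> \<open>Its degree e + 2 - 2 D is negative.\<close>
  have "z = 0" using homog_neg[of "e + 2 - D - D"] z(1) e by auto
  then have AA': "\<rho> A' = [:0, 1:] * \<rho> A" "\<rho> B' = [:0, 1:] * \<rho> B" using z by (simp_all add: \<rho>_simps \<rho>_u)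
  \<comment> \<open>From A' = y A on the line, the restriction of A has degree one less than the
    bound for A', so A can be replaced by a form of degree e - D; this is division by u.\<close>
  have low: "\<exists>Y\<in>homog (e - D). \<rho> Y = \<rho> X" if "X' \<in> homog (e + 1 - D)" "\<rho> X' = [:0, 1:] * \<rho> X" for X X'
  proof (cases "\<rho> X = 0")
    case True
    then show ?thesis by (intro bexI[of _ 0]) (auto simp: \<rho>_simps)
  next
    case False
    then have "X' \<noteq> 0" using that by (auto simp: \<rho>_simps)
    then have m: "e + 1 - D \<ge> 0" using homog_neg[of "e + 1 - D"] that(1) by (cases "e + 1 - D < 0") auto
    have "degree (\<rho> X') \<le> nat (e + 1 - D)" using degree_\<rho>_le[of X' "nat (e + 1 - D)"] that(1) m by simp
    moreover have "degree (\<rho> X') = Suc (degree (\<rho> X))"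
      unfolding that(2) using degree_mult_eq[of "[:0, 1:]" "\<rho> X"] False by simp
    ultimately have "int (degree (\<rho> X)) \<le> e - D" using m by simp
    then show ?thesis using \<rho>_surj by metis
  qed
  obtain Y where Y: "Y \<in> homog (e - D)" "\<rho> Y = \<rho> A" using low[OF A'(1) AA'(1)] by blast
  obtain Z where Z: "Z \<in> homog (e - D)" "\<rho> Z = \<rho> B" using low[OF A'(2) AA'(2)] by blast
  have w: "Y * g1 + Z * g2 \<in> Ik e" by (rule IkI[OF Y(1) Z(1)])
  then have "t - (Y * g1 + Z * g2) \<in> homog e" using t Ik_homog by (intro homog_diff) auto
  moreover have "\<rho> (t - (Y * g1 + Z * g2)) = 0" using A(3) Y Z by (simp add: \<rho>_simps)
  ultimately obtain s where "s \<in> homog (e - 1)" "t - (Y * g1 + Z * g2) = s * l" using \<rho>_eq_0_imp by metis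
  then show ?thesis using that[of s "Y * g1 + Z * g2"] w by (simp add: algebra_simps)
qed

text \<open>The condition on l gives s = t l^(N - 1) modulo I. Cancelling that power turns the
  conditions on u and y into conditions on t modulo l, that is, on the line.\<close>

lemma socle:
  assumes N: "N \<ge> 1" and k: "k \<le> 2 * D - 4 + int N" and s: "s \<in> homog k"
    and sl: "s * l \<in> Bk N (k + 1)" and su: "s * u \<in> Bk N (k + 1)" and sy: "s * var3 1 \<in> Bk N (k + 1)"
  shows "s \<in> Bk N k"
proof -
  define M where "M = N - 1"
  have N': "N = Suc M" using N by (simp add: M_def)
  obtain t w where tw: "t \<in> homog (k + 1 - int N)" "w \<in> Ik (k + 1)" "s * l = t * l ^ N + w"
    using sl unfolding Bk_def by blast
  have th: "t * l ^ M \<in> homog k" using homog_mult[OF tw(1) l_power_homog[of M]] by (simp add: N')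
  have "(s - t * l ^ M) * l \<in> Ik (k + 1)" using tw(2,3) by (simp add: N' algebra_simps)
  then have w': "s - t * l ^ M \<in> Ik k" using Ik_cancel_l[of "s - t * l ^ M" k] s th by (auto intro: homog_diff)
  define e where "e = k + 1 - int N"
  have te: "t \<in> homog e" using tw(1) by (simp add: e_def)
  have key: "\<exists>A B. A \<in> homog (e + 1 - D) \<and> B \<in> homog (e + 1 - D) \<and> \<rho> v * \<rho> t = \<rho> A * \<rho> g1 + \<rho> B * \<rho> g2"
    if v: "v \<in> homog 1" "s * v \<in> Bk N (k + 1)" for v
  proof -
    obtain t' x where tx: "t' \<in> homog (k + 1 - int N)" "x \<in> Ik (k + 1)" "s * v = t' * l ^ N + x"
      using v(2) unfolding Bk_def by blast
    have "(t * v - t' * l) * l ^ M = x - (s - t * l ^ M) * v" using tx(3) by (simp add: N' algebra_simps)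
    moreover have "x - (s - t * l ^ M) * v \<in> Ik (k + 1)"
      using Ik_mult(2)[OF v(1) w'] tx(2) S.subspace_diff[OF Ik_subspace] by blast
    moreover have k1: "k + 1 = (e + 1) + int M" by (simp add: e_def N')
    moreover have "t * v - t' * l \<in> homog (e + 1)"
      using homog_mult[OF tw(1) v(1)] homog_mult[OF tx(1) l_homog] by (auto simp: e_def intro!: homog_diff)
    ultimately have "t * v - t' * l \<in> Ik (e + 1)" using Ik_cancel_l_power[of "t * v - t' * l" "e + 1" M] by simp
    then obtain A B where AB: "A \<in> homog (e + 1 - D)" "B \<in> homog (e + 1 - D)" "t * v - t' * l = A * g1 + B * g2" by (rule IkE)
    have "\<rho> t * \<rho> v = \<rho> (t * v - t' * l)" by (simp add: \<rho>_simps \<rho>_l)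
    then show ?thesis using AB by (intro exI[of _ A] exI[of _ B]) (simp add: \<rho>_simps mult.commute)
  qed
  obtain A B where A: "A \<in> homog (e + 1 - D)" "B \<in> homog (e + 1 - D)" "\<rho> t = \<rho> A * \<rho> g1 + \<rho> B * \<rho> g2"
    using key[OF u_homog su] by (auto simp: \<rho>_u)
  obtain A' B' where A': "A' \<in> homog (e + 1 - D)" "B' \<in> homog (e + 1 - D)" "[:0, 1:] * \<rho> t = \<rho> A' * \<rho> g1 + \<rho> B' * \<rho> g2"
    using key[OF homog_var sy] by (auto simp: \<rho>_simps)
  have "e \<le> 2 * D - 3" using k by (simp add: e_def)
  from line_socle[OF te this A A'] obtain r x where rx: "r \<in> homog (e - 1)" "x \<in> Ik e" "t = r * l + x" by metis
  have "x * l ^ M \<in> Ik k" using Ik_mult(2)[OF l_power_homog[of M] rx(2)] by (simp add: e_def N')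
  then have "x * l ^ M + (s - t * l ^ M) \<in> Ik k" using w' S.subspace_add[OF Ik_subspace] by blast
  moreover have "r \<in> homog (k - int N)" using rx(1) by (simp add: e_def)
  moreover have "s = r * l ^ N + (x * l ^ M + (s - t * l ^ M))" by (simp add: rx(3) N' algebra_simps)
  ultimately show ?thesis using BkI by metis
qed

text \<open>Downward induction on k: if s pairs to zero with everything, so do s l, s u and s y,
  which therefore lie in the ideal, and \<open>socle\<close> applies.\<close>

lemma nondegenerate:
  assumes "N \<ge> 1" "s \<in> homog k" "k \<le> 2 * D - 3 + int N"
    "\<And>p. p \<in> homog (2 * D - 3 + int N - k) \<Longrightarrow> s * p \<in> Bk N (2 * D - 3 + int N)"
  shows "s \<in> Bk N k"
  using assms(2-)
proof (induction "nat (2 * D - 3 + int N - k)" arbitrary: s k)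
  case 0
  then have "k = 2 * D - 3 + int N" by simp
  then show ?case using "0.prems"(3)[of 1] homog_one by simp
next
  case (Suc n)
  have sv: "s * v \<in> Bk N (k + 1)" if v: "v \<in> homog 1" for v
  proof (rule Suc.hyps(1))
    show "s * v \<in> homog (k + 1)" using homog_mult[OF Suc.prems(1) v] .
    fix p assume "p \<in> homog (2 * D - 3 + int N - (k + 1))"
    moreover have "1 + (2 * D - 3 + int N - (k + 1)) = 2 * D - 3 + int N - k" by simp
    ultimately have "v * p \<in> homog (2 * D - 3 + int N - k)" using homog_mult[OF v] by metis
    then show "s * v * p \<in> Bk N (2 * D - 3 + int N)" using Suc.prems(3) by (simp add: mult.assoc)
  qed (use Suc.hyps(2) in auto)
  have "k \<le> 2 * D - 4 + int N" using Suc.hyps(2) by simp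
  then show ?case using socle[OF assms(1) _ Suc.prems(1)] sv[OF l_homog] sv[OF u_homog] sv[OF homog_var] by blast
qed

lemma Ck_mult_jacobian:
  assumes "s \<in> Ck j" "x \<in> jacobian_ideal f \<inter> homog i"
  shows "s * x \<in> Ik (j + i)"
proof -
  obtain t w where tw: "t \<in> homog (i - D)" "w \<in> Ik i" "x = t * g3 + w" using assms(2) unfolding jacobian_eq by blast
  have s: "s \<in> homog j" "s * g3 \<in> Ik (j + D)" using assms(1) by (auto simp: Ck_def)
  have "s * g3 * t \<in> Ik (j + D + (i - D))" "s * w \<in> Ik (j + i)" by (rule Ik_mult[OF tw(1) s(2)], rule Ik_mult[OF s(1) tw(2)])
  then have "s * g3 * t + s * w \<in> Ik (j + i)" by (intro S.subspace_add[OF Ik_subspace]) auto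
  then show ?thesis by (simp add: tw(3) algebra_simps)
qed

text \<open>The pairing of \<open>(I : g\<^sub>3)/I\<close> with the Milnor algebra into the socle of the complete intersection
  \<open>S/(g\<^sub>1, g\<^sub>2, l\<^sup>N)\<close>.\<close>

lemma Ck_growth:
  assumes N: "N \<ge> 1" and j: "j \<le> 2 * D - 3"
  shows "int (S.dim (Ck (j + int N))) - int (S.dim (Ik (j + int N)))
    \<le> int (S.dim (Ck j)) - int (S.dim (Ik j)) + int (milnor_dim f (2 * D - 3 - j))"
proof -
  define i where "i = 2 * D - 3 - j"
  define \<sigma> where "\<sigma> = 2 * D - 3 + int N"
  define J where "J = jacobian_ideal f \<inter> homog i"
  have J: "S.subspace J" "J \<subseteq> homog i" unfolding J_def using subspace_jacobian by auto
  obtain B where B: "quot_basis scale3 B (homog i) J" using S.quot_basis_exists[OF J] by blast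
  obtain G where G: "finite G" "homog i \<subseteq> S.span G" using fin_dim_homog[of i] unfolding fin_dim_def by blast
  have "homog i \<subseteq> S.span (G \<union> J)" using G(2) S.span_mono[of G "G \<union> J"] by auto
  then have finB: "finite B" using S.quot_basis_finite[OF J(1) B G(1)] by blast
  have cardB: "card B = milnor_dim f i"
    unfolding milnor_dim_def using S.quot_dim_eq_card[OF J(1) B] by (simp add: J_def)
  have Bi: "B \<subseteq> homog i" using B by (simp add: quot_basis_def)
  let ?C = "Ck (j + int N)"
  \<comment> \<open>The annihilator of T in I : g3 under the pairing. As the target has dimension 1,
    each b in T cuts the dimension by at most 1.\<close>
  define U where "U T = {s \<in> ?C. \<forall>b\<in>T. s * b \<in> Bk N \<sigma>}" for T
  have U_sub: "S.subspace (U T)" for T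
    unfolding U_def
  proof (rule S.subspaceI)
    fix x y assume "x \<in> {s \<in> ?C. \<forall>b\<in>T. s * b \<in> Bk N \<sigma>}" "y \<in> {s \<in> ?C. \<forall>b\<in>T. s * b \<in> Bk N \<sigma>}"
    then show "x + y \<in> {s \<in> ?C. \<forall>b\<in>T. s * b \<in> Bk N \<sigma>}"
      using S.subspace_add[OF Ck_subspace] S.subspace_add[OF Bk_subspace] by (auto simp: distrib_right)
  next
    fix c x assume "x \<in> {s \<in> ?C. \<forall>b\<in>T. s * b \<in> Bk N \<sigma>}"
    then show "scale3 c x \<in> {s \<in> ?C. \<forall>b\<in>T. s * b \<in> Bk N \<sigma>}"
      using S.subspace_scale[OF Ck_subspace] S.subspace_scale[OF Bk_subspace, of _ N \<sigma> c] by (auto simp: scale3_def mult.assoc)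
  qed (use S.subspace_0[OF Ck_subspace] S.subspace_0[OF Bk_subspace] in auto)
  have U_fin: "fin_dim scale3 (U T)" for T
    by (rule S.fin_dim_subset[OF Ck_fin_dim]) (auto simp: U_def)
  have step: "S.dim ?C \<le> S.dim (U T) + card T" if "finite T" "T \<subseteq> B" for T
    using that
  proof (induction T rule: finite_induct)
    case empty
    then show ?case by (simp add: U_def)
  next
    case (insert b T)
    have b: "b \<in> homog i" using insert Bi by auto
    have "u * b + w \<in> homog \<sigma>" if "u \<in> U T" "w \<in> Bk N \<sigma>" for u w
    proof -
      have "u \<in> homog (j + int N)" using that by (auto simp: U_def Ck_def)
      moreover have "j + int N + i = \<sigma>" by (simp add: i_def \<sigma>_def)
      ultimately have "u * b \<in> homog \<sigma>" using homog_mult[OF _ b] by metis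
      then show ?thesis using that(2) Bk_homog by (auto intro: homog_add)
    qed
    then have "S.dim {u * b + w | u w. u \<in> U T \<and> w \<in> Bk N \<sigma>} \<le> S.dim (homog \<sigma>)"
      by (intro S.dim_mono_finite[OF fin_dim_homog]) auto
    also have "S.dim (homog \<sigma>) = S.dim (Bk N \<sigma>) + 1" using dim_Bk_socle[OF N] unfolding \<sigma>_def by linarith
    moreover have "{u \<in> U T. u * b \<in> Bk N \<sigma>} = U (insert b T)" by (auto simp: U_def)
    ultimately have "S.dim (U T) \<le> S.dim (U (insert b T)) + 1"
      using dim_mult_plus[OF U_sub U_fin Bk_subspace Bk_fin_dim, of b T N \<sigma>] by simp
    then show ?case using insert by simp
  qed
  let ?E = "{s * l ^ N + w | s w. s \<in> Ck j \<and> w \<in> Ik (j + int N)}"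
  \<comment> \<open>What pairs to zero with all of M(f) lies in (I, l^N) by nondegeneracy; its
    coefficient t of l^N lies in I : g3 again, since l^N can be cancelled.\<close>
  have UB: "U B \<subseteq> ?E"
  proof
    fix s assume s: "s \<in> U B"
    have sC: "s \<in> ?C" "s \<in> homog (j + int N)" using s by (auto simp: U_def Ck_def)
    have ji: "j + int N + i = \<sigma>" by (simp add: i_def \<sigma>_def)
    have "s * p \<in> Bk N \<sigma>" if p: "p \<in> homog i" for p
    proof -
      obtain c where c: "p - (\<Sum>b\<in>B. scale3 (c b) b) \<in> J" using S.quot_basis_family(1)[OF J(1) B finB p] by blast
      have "s * (p - (\<Sum>b\<in>B. scale3 (c b) b)) \<in> Bk N \<sigma>"
        using Ck_mult_jacobian[OF sC(1), of _ i] c Ik_Bk unfolding J_def ji by blast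
      moreover have "s * (\<Sum>b\<in>B. scale3 (c b) b) \<in> Bk N \<sigma>"
      proof -
        have "s * (\<Sum>b\<in>B. scale3 (c b) b) = (\<Sum>b\<in>B. scale3 (c b) (s * b))"
          by (simp add: sum_distrib_left scale3_def algebra_simps)
        also have "\<dots> \<in> Bk N \<sigma>"
          using s by (intro S.subspace_sum[OF Bk_subspace] S.subspace_scale[OF Bk_subspace]) (auto simp: U_def)
        finally show ?thesis .
      qed
      ultimately have "s * (p - (\<Sum>b\<in>B. scale3 (c b) b)) + s * (\<Sum>b\<in>B. scale3 (c b) b) \<in> Bk N \<sigma>"
        by (rule S.subspace_add[OF Bk_subspace])
      then show ?thesis by (simp add: algebra_simps)
    qed
    then have "s \<in> Bk N (j + int N)"
      using nondegenerate[OF N sC(2)] j unfolding \<sigma>_def i_def by (auto simp: algebra_simps)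
    then obtain t w where tw: "t \<in> homog j" "w \<in> Ik (j + int N)" "s = t * l ^ N + w" unfolding Bk_def by auto
    have "t * g3 * l ^ N = s * g3 - w * g3" by (simp add: tw(3) algebra_simps)
    also have "\<dots> \<in> Ik (j + int N + D)"
      using sC(1) Ik_mult(2)[OF g_homog(3) tw(2)] S.subspace_diff[OF Ik_subspace] by (auto simp: Ck_def)
    finally have "t * g3 * l ^ N \<in> Ik (j + D + int N)" by (simp add: algebra_simps)
    then have "t \<in> Ck j" using Ik_cancel_l_power[OF homog_mult[OF tw(1) g_homog(3)]] tw(1) by (simp add: Ck_def)
    then show "s \<in> ?E" using tw by blast
  qed
  have ker: "{s \<in> Ck j. s * l ^ N \<in> Ik (j + int N)} = Ik j"
  proof -
    have "Ik j \<subseteq> Ck j" using Ik_mult(2)[OF g_homog(3), of _ j] Ik_homog[of j] by (auto simp: Ck_def)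
    then show ?thesis using kernel_l_power[of j N] by (auto simp: Ck_def)
  qed
  have dE: "S.dim ?E + S.dim (Ik j) = S.dim (Ck j) + S.dim (Ik (j + int N))"
    using dim_mult_plus[OF Ck_subspace Ck_fin_dim Ik_subspace Ik_fin_dim, of "l ^ N" j "j + int N"] unfolding ker .
  have "?E \<subseteq> homog (j + int N)"
    using homog_mult[OF _ l_power_homog[of N], of _ j] Ik_homog[of "j + int N"] by (auto simp: Ck_def intro!: homog_add)
  then have "S.dim (U B) \<le> S.dim ?E" by (intro S.dim_mono_finite[OF S.fin_dim_subset[OF fin_dim_homog] UB])
  then show ?thesis using step[OF finB order_refl] dE cardB unfolding i_def by linarith
qed

lemma dim_Ck_Ik: "int (S.dim (Ck j)) - int (S.dim (Ik j)) = int (ar f j) - 3 * sdim (j - D) + sdim (j - 2 * D)"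
  using dim_Ck[of j] dim_Ik[of j] by simp

text \<open>(I : g3)/I and S/J are kernel and cokernel of multiplication by g3 on S/I, so their
  dimensions agree once the Hilbert function of S/I is constant.\<close>

lemma dim_Ck_Ik_stable:
  assumes "milnor_dim f (n + D) = \<tau>" and n: "n - 2 * D \<ge> - 2"
  shows "int (S.dim (Ck n)) - int (S.dim (Ik n)) = int \<tau>"
proof -
  have "int \<tau> = sdim (n + D) - 3 * sdim n + int (ar f n)"
    using milnor_dim_eq[OF f_homog, of "n + D", folded D_def] assms(1) by simp
  \<comment> \<open>A third difference, with step D, of a quadratic polynomial.\<close>
  moreover have "sdim (n + D) - 3 * sdim n + 3 * sdim (n - D) - sdim (n - 2 * D) = 0"
    using sdim_double[of "n + D"] sdim_double[of n] sdim_double[of "n - D"] sdim_double[of "n - 2 * D"] n D_ge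
    by (simp add: algebra_simps)
  ultimately show ?thesis using dim_Ck_Ik[of n] by linarith
qed

text \<open>This is \<open>Ck_growth\<close> for N so large that its left side has reached \<tau>.
  The two \<open>sdim\<close> terms vanish for j < D; beyond, they subtract the Koszul
  syzygies.\<close>

lemma ar_milnor_ge:
  assumes stable: "\<And>k. k \<ge> k0 \<Longrightarrow> milnor_dim f k = \<tau>" and j: "j \<le> 2 * D - 3"
  shows "int (ar f j) - 3 * sdim (j - D) + sdim (j - 2 * D) + int (milnor_dim f (2 * D - 3 - j)) \<ge> int \<tau>"
proof -
  define N where "N = nat (max (k0 - j) (2 * D - j) + 1)"
  have "int N = max (k0 - j) (2 * D - j) + 1" using j by (simp add: N_def)
  then have N: "N \<ge> 1" "j + int N + D \<ge> k0" "j + int N - 2 * D \<ge> - 2" using D_ge j by auto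
  show ?thesis using Ck_growth[OF N(1) j] dim_Ck_Ik_stable[OF stable[OF N(2)] N(3)] dim_Ck_Ik[of j] by linarith
qed

text \<open>With \<tau> = 0 the ideal I : g3 equals I in large degrees, and cancelling l^N carries
  this down to degree j. For j < D the degree j part of I is zero.\<close>

lemma ar_eq_0_of_stable_0:
  assumes stable: "\<And>k. k \<ge> k0 \<Longrightarrow> milnor_dim f k = 0" and j: "j < D"
  shows "ar f j = 0"
proof -
  define N where "N = nat (max (k0 - j) (2 * D - j) + 1)"
  have "int N = max (k0 - j) (2 * D - j) + 1" using j D_ge by (simp add: N_def)
  then have N: "j + int N + D \<ge> k0" "j + int N - 2 * D \<ge> - 2" using D_ge j by auto
  let ?n = "j + int N"
  have IC: "Ik k \<subseteq> Ck k" for k using Ik_mult(2)[OF g_homog(3), of _ k] Ik_homog[of k] by (auto simp: Ck_def)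
  have "S.dim (Ck ?n) \<le> S.dim (Ik ?n)" using dim_Ck_Ik_stable[OF stable[OF N(1)] N(2)] by simp
  then have eq: "Ik ?n = Ck ?n" by (rule S.subspace_eq_of_dim_ge[OF Ik_subspace Ck_fin_dim IC])
  have "Ck j \<subseteq> Ik j"
  proof
    fix s assume s: "s \<in> Ck j"
    then have sh: "s \<in> homog j" "s * g3 \<in> Ik (j + D)" by (auto simp: Ck_def)
    have "s * g3 * l ^ N \<in> Ik (j + D + int N)" by (rule Ik_mult(2)[OF l_power_homog sh(2)])
    moreover have "s * l ^ N \<in> homog ?n" by (rule homog_mult[OF sh(1) l_power_homog])
    ultimately have "s * l ^ N \<in> Ck ?n" by (simp add: Ck_def ac_simps)
    then show "s \<in> Ik j" using Ik_cancel_l_power[OF sh(1)] eq by blast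
  qed
  then have "S.dim (Ck j) \<le> S.dim (Ik j)" by (rule S.dim_mono_finite[OF Ik_fin_dim])
  then show ?thesis using dim_Ck[of j] dim_Ik[of j] sdim_neg[of "j - D"] j by simp
qed

text \<open>The regular sequence g1, g2 plays the role of coprime partial derivatives: the
  corresponding combinations Q, P of the v i satisfy P g1 = Q g2, so P = h g2, and h is the factor
  for all components.\<close>

lemma parallel_to_gradient:
  assumes v: "v 0 \<in> homog k" "v 1 \<in> homog k" "v 2 \<in> homog k"
    and par: "\<And>i j. v i * pd j f = v j * pd i f"
  obtains h where "h \<in> homog (k - D)" "\<And>i. v i = h * pd i f"
proof -
  let ?Q = "const3 a * v 0 + const3 c * v 2" and ?P = "const3 \<alpha> * v 0 + v 1 + const3 \<gamma> * v 2"
  have Pv: "?P * pd i f = v i * g2" for i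
  proof -
    have "?P * pd i f = const3 \<alpha> * (v 0 * pd i f) + v 1 * pd i f + const3 \<gamma> * (v 2 * pd i f)"
      by (simp add: algebra_simps)
    also have "\<dots> = v i * g2" unfolding par[of 0 i] par[of 1 i] par[of 2 i] by (simp add: g2_def algebra_simps)
    finally show ?thesis .
  qed
  have "?P * g1 + (- ?Q) * g2 = 0"
  proof -
    have "?P * g1 = const3 a * (?P * pd 0 f) + const3 c * (?P * pd 2 f)" by (simp add: g1_def algebra_simps)
    also have "\<dots> = ?Q * g2" unfolding Pv by (simp add: algebra_simps)
    finally show ?thesis by (simp add: algebra_simps)
  qed
  moreover have "?P \<in> homog k" "- ?Q \<in> homog k"
    by (auto intro!: homog_add homog_uminus homog_diff homog_const_mult v)
  ultimately obtain h where h: "h \<in> homog (k - D)" "?P = h * g2" using regular by blast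
  have "v i = h * pd i f" for i
  proof -
    have "h * pd i f * g2 = v i * g2" using Pv[of i] unfolding h(2) by (simp only: ac_simps)
    then show ?thesis using g2_neq_0 by simp
  qed
  then show ?thesis using that h(1) by blast
qed

end

section \<open>Local equations\<close>

lemma structure_map_fps2_const: "structure_map fps2_const"
  by unfold_locales (simp_all add: fps2_const_def flip: fps_const_add fps_const_mult)

interpretation fps2_map: structure_map fps2_const
  by (rule structure_map_fps2_const)

lemma fps2_u_power: "fps2_u ^ n = fps_const (fps_X ^ n)"
  by (simp add: fps2_u_def fps_const_power)

lemma fps2_nth_monomial:
  "fps_nth (fps_nth (fps2_const c * fps2_u ^ i * fps2_v ^ j) j') i' = (if i' = i \<and> j' = j then c else 0)"
  unfolding fps2_u_power by (auto simp: fps2_const_def fps2_v_def fps_X_power_mult_right_nth fps_mult_right_const_nth)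

text \<open>Membership in (u^n, v^n) becomes a condition on finitely many coefficients, which forms
  can be made to match.\<close>

lemma fps2_box_iff:
  "(\<forall>i<n. \<forall>j<n. fps_nth (fps_nth g j) i = 0) \<longleftrightarrow> (\<exists>a b. g = a * fps2_u ^ n + b * fps2_v ^ n)"
proof
  assume box: "\<forall>i<n. \<forall>j<n. fps_nth (fps_nth g j) i = 0"
  define a where "a = Abs_fps (\<lambda>j. if j < n then fps_shift n (fps_nth g j) else 0)"
  have "g = a * fps2_u ^ n + fps_shift n g * fps2_v ^ n"
  proof (rule fps_ext)
    fix j
    have "fps_shift n (fps_nth g j) * fps_X ^ n = fps_nth g j" if "j < n"
      using box that by (intro fps_ext) (simp add: fps_X_power_mult_right_nth)
    then show "fps_nth g j = fps_nth (a * fps2_u ^ n + fps_shift n g * fps2_v ^ n) j"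
      unfolding fps2_u_power by (simp add: a_def fps2_v_def fps_X_power_mult_right_nth)
  qed
  then show "\<exists>a b. g = a * fps2_u ^ n + b * fps2_v ^ n" by blast
next
  assume "\<exists>a b. g = a * fps2_u ^ n + b * fps2_v ^ n"
  then obtain a b where g: "g = a * fps2_u ^ n + b * fps2_v ^ n" by blast
  show "\<forall>i<n. \<forall>j<n. fps_nth (fps_nth g j) i = 0"
    unfolding g fps2_u_power by (simp add: fps2_v_def fps_X_power_mult_right_nth)
qed

lemma fps2_unit:
  fixes g :: fps2
  assumes "fps_nth (fps_nth g 0) 0 \<noteq> 0"
  shows "\<exists>h. g * h = 1"
proof -
  have "fps_nth g 0 * inverse (fps_nth g 0) = 1" using assms by (simp add: inverse_mult_eq_1')
  then have "g * fps_right_inverse g (inverse (fps_nth g 0)) = 1" by (rule fps_right_inverse)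
  then show ?thesis by blast
qed

lemma fps2_du_simps:
  "fps2_du (g + h) = fps2_du g + fps2_du h"
  "fps2_du (g * h) = fps2_du g * h + g * fps2_du h"
  "fps2_du (fps2_const c) = 0" "fps2_du fps2_u = 1" "fps2_du fps2_v = 0"
proof -
  show "fps2_du (g + h) = fps2_du g + fps2_du h"
    by (rule fps_ext) (simp add: fps2_du_def)
  show "fps2_du (g * h) = fps2_du g * h + g * fps2_du h"
  proof (rule fps_ext)
    fix n
    have "fps_nth (fps2_du (g * h)) n = (\<Sum>i=0..n. fps_deriv (fps_nth g i * fps_nth h (n - i)))"
      by (simp add: fps2_du_def fps_mult_nth fps_deriv_sum)
    also have "\<dots> = fps_nth (fps2_du g * h + g * fps2_du h) n"
      by (simp add: fps2_du_def fps_mult_nth sum.distrib add.commute)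
    finally show "fps_nth (fps2_du (g * h)) n = fps_nth (fps2_du g * h + g * fps2_du h) n" .
  qed
  show "fps2_du (fps2_const c) = 0" "fps2_du fps2_u = 1" "fps2_du fps2_v = 0"
    by (rule fps_ext; auto simp: fps2_du_def fps2_const_def fps2_u_def fps2_v_def; fail)+
qed

lemma fps2_dv_simps:
  "fps2_dv (g + h) = fps2_dv g + fps2_dv h"
  "fps2_dv (g * h) = fps2_dv g * h + g * fps2_dv h"
  "fps2_dv (fps2_const c) = 0" "fps2_dv fps2_u = 0" "fps2_dv fps2_v = 1"
  by (simp_all add: fps2_dv_def fps2_const_def fps2_u_def fps2_v_def algebra_simps)

lemma eval3_scale:
  assumes "q \<in> homog (int n)"
  shows "eval3 q (t * x, t * y, t * z) = t ^ n * eval3 q (x, y, z)"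
  using assms
proof (induction rule: homog_induct)
  case (monomial c i j k)
  then have "n = i + j + k" by simp
  then show ?case by (simp add: eval3_simps power_add power_mult_distrib)
qed (auto simp: eval3_simps algebra_simps)

text \<open>Treats the three cases of \<open>local_eq\<close> at once: the coordinate
  \<open>i0\<close> is set to 1, and \<open>i1\<close>, \<open>i2\<close> carry u and v.\<close>

locale chart =
  fixes p :: "complex \<times> complex \<times> complex" and i0 i1 i2 :: 3
  assumes distinct: "i0 \<noteq> i1" "i0 \<noteq> i2" "i1 \<noteq> i2" and p_i0: "coord i0 p = 1"
begin

definition W :: "3 \<Rightarrow> fps2" where
  "W i = (if i = i0 then 1 else if i = i1 then fps2_const (coord i1 p) + fps2_u else fps2_const (coord i2 p) + fps2_v)"

definition \<Lambda> :: "poly3 \<Rightarrow> fps2" where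
  "\<Lambda> q = subst3 fps2_const q (W 0, W 1, W 2)"

text \<open>X, U, V are linear forms whose expansions under \<open>\<Lambda>\<close> are 1, u and
  v.\<close>

definition X where "X = var3 i0"
definition U where "U = var3 i1 - const3 (coord i1 p) * var3 i0"
definition V where "V = var3 i2 - const3 (coord i2 p) * var3 i0"

lemma index_cases: "i = i0 \<or> i = i1 \<or> i = i2"
proof -
  have "card {i0, i1, i2} = CARD(3)" using distinct by simp
  then have "{i0, i1, i2} = UNIV" by (intro card_subset_eq) auto
  then show ?thesis by blast
qed

lemma \<Lambda>_var: "\<Lambda> (var3 i) = W i"
  using exhaust_3[of i] by (auto simp: \<Lambda>_def)

lemma \<Lambda>_simps:
  "\<Lambda> (q + r) = \<Lambda> q + \<Lambda> r" "\<Lambda> (q - r) = \<Lambda> q - \<Lambda> r" "\<Lambda> (- q) = - \<Lambda> q" "\<Lambda> (q * r) = \<Lambda> q * \<Lambda> r"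
  "\<Lambda> (q ^ n) = \<Lambda> q ^ n" "\<Lambda> (sum F A) = (\<Sum>x\<in>A. \<Lambda> (F x))" "\<Lambda> (prod F A) = (\<Prod>x\<in>A. \<Lambda> (F x))"
  "\<Lambda> 0 = 0" "\<Lambda> 1 = 1" "\<Lambda> (const3 c) = fps2_const c"
  by (simp_all add: \<Lambda>_def fps2_map.subst3_simps)

lemma \<Lambda>_X: "\<Lambda> X = 1" and \<Lambda>_U: "\<Lambda> U = fps2_u" and \<Lambda>_V: "\<Lambda> V = fps2_v"
  using distinct by (auto simp: X_def U_def V_def \<Lambda>_simps \<Lambda>_var W_def)

lemma homog_XUV: "X \<in> homog 1" "U \<in> homog 1" "V \<in> homog 1"
  by (auto simp: X_def U_def V_def intro!: homog_diff homog_const_mult homog_var)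

lemma eval_XUV: "eval3 X p = 1" "eval3 U p = 0" "eval3 V p = 0"
  by (simp_all add: X_def U_def V_def eval3_simps p_i0)

lemma \<Lambda>_const_term: "fps_nth (fps_nth (\<Lambda> q) 0) 0 = eval3 q p"
proof (induction q rule: poly3_induct)
  case (const c)
  then show ?case by (simp add: \<Lambda>_simps eval3_simps fps2_const_def)
next
  case (var i)
  show ?case using index_cases[of i] distinct p_i0
    by (auto simp: \<Lambda>_var W_def eval3_simps fps2_const_def fps2_u_def fps2_v_def)
qed (auto simp: \<Lambda>_simps eval3_simps)

lemma \<Lambda>_du: "fps2_du (\<Lambda> q) = \<Lambda> (pd i1 q)"
proof (induction q rule: poly3_induct)
  case (var i)
  have "fps2_du 1 = 0" using fps2_du_simps(3)[of 1] by (simp add: fps2_map.one)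
  then have "fps2_du (W i0) = 0" "fps2_du (W i1) = 1" "fps2_du (W i2) = 0"
    using distinct by (auto simp: W_def fps2_du_simps)
  then show ?case
    unfolding \<Lambda>_var pd_var using index_cases[of i] distinct \<Lambda>_simps(8,9) by metis
qed (auto simp: \<Lambda>_simps fps2_du_simps pd_add pd_mult)

lemma \<Lambda>_dv: "fps2_dv (\<Lambda> q) = \<Lambda> (pd i2 q)"
proof (induction q rule: poly3_induct)
  case (var i)
  have "fps2_dv 1 = 0" using fps2_dv_simps(3)[of 1] by (simp add: fps2_map.one)
  then have "fps2_dv (W i0) = 0" "fps2_dv (W i2) = 1" "fps2_dv (W i1) = 0"
    using distinct by (auto simp: W_def fps2_dv_simps)
  then show ?case
    unfolding \<Lambda>_var pd_var using index_cases[of i] distinct \<Lambda>_simps(8,9) by metis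
qed (auto simp: \<Lambda>_simps fps2_dv_simps pd_add pd_mult)

lemma expand:
  assumes "G \<in> homog k"
  obtains q where "q \<in> homog k"
    "G = (\<Sum>m\<in>Poly_Mapping.keys q. const3 (Poly_Mapping.lookup q m) * U ^ Poly_Mapping.lookup m 0 * V ^ Poly_Mapping.lookup m 1 * X ^ Poly_Mapping.lookup m 2)"
    "\<And>m. m \<in> Poly_Mapping.keys q \<Longrightarrow> int (Poly_Mapping.lookup m 0) + int (Poly_Mapping.lookup m 1) + int (Poly_Mapping.lookup m 2) = k"
proof -
  define M where "M i = (if i = i0 then var3 2 else if i = i1 then var3 0 + const3 (coord i1 p) * var3 2 else var3 1 + const3 (coord i2 p) * var3 2)" for i
  have h: "M i \<in> homog 1" for i by (auto simp: M_def intro!: homog_add homog_const_mult homog_var)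
  have inv: "subst3 const3 (M i) (U, V, X) = var3 i" for i
    using index_cases[of i] distinct by (auto simp: M_def const3_map.subst3_simps U_def V_def X_def)
  show ?thesis by (rule homog_expand[OF assms h[of 0] h[of 1] h[of 2] inv inv inv], rule that)
qed

text \<open>In the coordinates U, V, X the monomials of one degree expand to distinct monomials in u
  and v, so every monomial of G lies outside the box and contains U^n or V^n.\<close>

lemma box_imp_ideal:
  assumes G: "G \<in> homog k" and box: "\<forall>i<n. \<forall>j<n. fps_nth (fps_nth (\<Lambda> G) j) i = 0"
  shows "\<exists>A B. G = U ^ n * A + V ^ n * B"
proof -
  obtain q where q: "q \<in> homog k"
    "G = (\<Sum>m\<in>Poly_Mapping.keys q. const3 (Poly_Mapping.lookup q m) * U ^ Poly_Mapping.lookup m 0 * V ^ Poly_Mapping.lookup m 1 * X ^ Poly_Mapping.lookup m 2)"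
    "\<And>m. m \<in> Poly_Mapping.keys q \<Longrightarrow> int (Poly_Mapping.lookup m 0) + int (Poly_Mapping.lookup m 1) + int (Poly_Mapping.lookup m 2) = k"
    by (rule expand[OF G], rule that)
  have L: "\<Lambda> G = (\<Sum>m\<in>Poly_Mapping.keys q. fps2_const (Poly_Mapping.lookup q m) * fps2_u ^ Poly_Mapping.lookup m 0 * fps2_v ^ Poly_Mapping.lookup m 1)"
    unfolding q(2) by (simp add: \<Lambda>_simps \<Lambda>_X \<Lambda>_U \<Lambda>_V)
  have big: "Poly_Mapping.lookup m 0 \<ge> n \<or> Poly_Mapping.lookup m 1 \<ge> n" if m: "m \<in> Poly_Mapping.keys q" for m
  proof (rule ccontr)
    assume "\<not> ?thesis"
    then have "fps_nth (fps_nth (\<Lambda> G) (Poly_Mapping.lookup m 1)) (Poly_Mapping.lookup m 0) = 0" using box by simp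
    moreover have "fps_nth (fps_nth (\<Lambda> G) (Poly_Mapping.lookup m 1)) (Poly_Mapping.lookup m 0) =
      (\<Sum>m'\<in>Poly_Mapping.keys q. if m' = m then Poly_Mapping.lookup q m else 0)"
      unfolding L fps_sum_nth fps2_nth_monomial
    proof (intro sum.cong refl)
      fix m' assume m': "m' \<in> Poly_Mapping.keys q"
      have "m' = m" if "Poly_Mapping.lookup m 0 = Poly_Mapping.lookup m' 0" "Poly_Mapping.lookup m 1 = Poly_Mapping.lookup m' 1"
      proof -
        have "Poly_Mapping.lookup m' 2 = Poly_Mapping.lookup m 2" using q(3)[OF m] q(3)[OF m'] that by simp
        then show ?thesis using that by (subst mono3_eq[of m'], subst mono3_eq[of m]) simp
      qed
      then show "(if Poly_Mapping.lookup m 0 = Poly_Mapping.lookup m' 0 \<and> Poly_Mapping.lookup m 1 = Poly_Mapping.lookup m' 1 then Poly_Mapping.lookup q m' else 0) =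
        (if m' = m then Poly_Mapping.lookup q m else 0)" by auto
    qed
    ultimately show False using m by (simp add: in_keys_iff)
  qed
  have tm: "\<exists>A B. c * U ^ i * V ^ j * r = U ^ n * A + V ^ n * B" if "i \<ge> n \<or> j \<ge> n" for c i j r
  proof (cases "i \<ge> n")
    case True
    then have "U ^ i = U ^ n * U ^ (i - n)" by (simp flip: power_add)
    then have "c * U ^ i * V ^ j * r = U ^ n * (c * U ^ (i - n) * V ^ j * r) + V ^ n * 0" by (simp add: ac_simps)
    then show ?thesis by blast
  next
    case False
    then have "V ^ j = V ^ n * V ^ (j - n)" using that by (simp flip: power_add)
    then have "c * U ^ i * V ^ j * r = U ^ n * 0 + V ^ n * (c * U ^ i * V ^ (j - n) * r)" by (simp add: ac_simps)
    then show ?thesis by blast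
  qed
  have "\<exists>A B. (\<Sum>m\<in>K. const3 (Poly_Mapping.lookup q m) * U ^ Poly_Mapping.lookup m 0 * V ^ Poly_Mapping.lookup m 1 * X ^ Poly_Mapping.lookup m 2) = U ^ n * A + V ^ n * B"
    if "finite K" "K \<subseteq> Poly_Mapping.keys q" for K
    using that
  proof (induction K rule: finite_induct)
    case empty
    show ?case by (intro exI[of _ 0]) simp
  next
    case (insert m K)
    then obtain A B where 1: "(\<Sum>m\<in>K. const3 (Poly_Mapping.lookup q m) * U ^ Poly_Mapping.lookup m 0 * V ^ Poly_Mapping.lookup m 1 * X ^ Poly_Mapping.lookup m 2) = U ^ n * A + V ^ n * B" by auto
    obtain A' B' where 2: "const3 (Poly_Mapping.lookup q m) * U ^ Poly_Mapping.lookup m 0 * V ^ Poly_Mapping.lookup m 1 * X ^ Poly_Mapping.lookup m 2 = U ^ n * A' + V ^ n * B'"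
      using tm big insert by blast
    show ?case unfolding sum.insert[OF insert(1,2)] 1 2 by (intro exI[of _ "A' + A"] exI[of _ "B' + B"]) (simp add: algebra_simps)
  qed
  from this[OF finite_keys order_refl] show ?thesis by (simp flip: q(2))
qed

text \<open>The coefficients of \<beta> in the box are lifted by monomials in U and V; K \<ge> 2 n
  leaves room to fill up the degree with X.\<close>

lemma truncate:
  assumes "2 * n \<le> K"
  obtains a where "a \<in> homog (int K)" "\<forall>i<n. \<forall>j<n. fps_nth (fps_nth (\<beta> - \<Lambda> a) j) i = 0"
    "\<Lambda> a = (\<Sum>i<n. \<Sum>j<n. fps2_const (fps_nth (fps_nth \<beta> j) i) * fps2_u ^ i * fps2_v ^ j)"
proof -
  define a where "a = (\<Sum>i<n. \<Sum>j<n. const3 (fps_nth (fps_nth \<beta> j) i) * (U ^ i * V ^ j * X ^ (K - i - j)))"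
  have L: "\<Lambda> a = (\<Sum>i<n. \<Sum>j<n. fps2_const (fps_nth (fps_nth \<beta> j) i) * fps2_u ^ i * fps2_v ^ j)"
    by (simp add: a_def \<Lambda>_simps \<Lambda>_X \<Lambda>_U \<Lambda>_V mult.assoc)
  have "U ^ i * V ^ j * X ^ (K - i - j) \<in> homog (int K)" if "i < n" "j < n" for i j
  proof -
    have "U ^ i * V ^ j * X ^ (K - i - j) \<in> homog (int i * 1 + int j * 1 + int (K - i - j) * 1)"
      by (intro homog_mult homog_power homog_XUV)
    then show ?thesis using that assms by (simp add: of_nat_diff)
  qed
  then have "a \<in> homog (int K)" unfolding a_def by (intro homog_sum homog_const_mult) auto
  moreover have "fps_nth (fps_nth (\<beta> - \<Lambda> a) j) i = 0" if "i < n" "j < n" for i j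
  proof -
    have "fps_nth (fps_nth (\<Lambda> a) j) i = (\<Sum>i'<n. \<Sum>j'<n. if i = i' \<and> j = j' then fps_nth (fps_nth \<beta> j') i' else 0)"
      unfolding L fps_sum_nth fps2_nth_monomial ..
    also have "\<dots> = (\<Sum>i'<n. if i = i' then fps_nth (fps_nth \<beta> j) i' else 0)"
      using that by (intro sum.cong) auto
    also have "\<dots> = fps_nth (fps_nth \<beta> j) i" using that by simp
    finally show ?thesis by simp
  qed
  ultimately show ?thesis using that L by blast
qed

text \<open>Since X expands to 1 and d is invertible, Euler's relation exchanges f for its
  derivative with respect to \<open>i0\<close>. So the Tjurina ideal is the local version of the
  Jacobian ideal, in which the three variables are treated alike.\<close>

lemma tjurina_eq:
  assumes f: "f \<in> homog (int d)" and d: "d \<ge> 1"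
  shows "tjurina_ideal (\<Lambda> f) = {a * \<Lambda> (pd 0 f) + b * \<Lambda> (pd 1 f) + c * \<Lambda> (pd 2 f) | a b c. True}"
proof -
  have perm: "(\<Sum>i\<in>UNIV. F i) = F i0 + F i1 + F i2" for F :: "3 \<Rightarrow> 'b::comm_monoid_add"
  proof -
    have "(UNIV::3 set) = {i0, i1, i2}" using index_cases by blast
    then have "(\<Sum>i\<in>UNIV. F i) = (\<Sum>i\<in>{i0, i1, i2}. F i)" by simp
    also have "\<dots> = F i0 + F i1 + F i2" using distinct by (simp add: add.assoc)
    finally show ?thesis .
  qed
  have sum012: "(\<Sum>i\<in>UNIV. F i) = F 0 + F 1 + F 2" for F :: "3 \<Rightarrow> 'b::comm_monoid_add"
    unfolding UNIV_3 by (simp add: add.assoc)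
  have "(\<Sum>i\<in>UNIV. var3 i * pd i f) = const3 (of_int (int d)) * f" unfolding sum012 by (rule euler[OF f])
  then have "\<Lambda> (\<Sum>i\<in>UNIV. var3 i * pd i f) = \<Lambda> (const3 (of_int (int d)) * f)" by simp
  then have e: "\<Lambda> (pd i0 f) + W i1 * \<Lambda> (pd i1 f) + W i2 * \<Lambda> (pd i2 f) = fps2_const (of_nat d) * \<Lambda> f"
    unfolding perm \<Lambda>_simps \<Lambda>_var by (simp add: W_def)
  have dd: "fps2_const (1 / of_nat d) * fps2_const (of_nat d) = 1"
    using d by (simp flip: fps2_map.mult add: fps2_map.one)
  have f_eq: "\<Lambda> f = fps2_const (1 / of_nat d) * (\<Lambda> (pd i0 f) + W i1 * \<Lambda> (pd i1 f) + W i2 * \<Lambda> (pd i2 f))"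
    unfolding e by (simp add: dd flip: mult.assoc)
  have i0_eq: "\<Lambda> (pd i0 f) = fps2_const (of_nat d) * \<Lambda> f - W i1 * \<Lambda> (pd i1 f) - W i2 * \<Lambda> (pd i2 f)"
    using e by (simp add: algebra_simps)
  \<comment> \<open>Reorders the generators from 0, 1, 2 to i0, i1, i2.\<close>
  have ex3: "(\<exists>a b c. x = a * F 0 + b * F 1 + c * F 2) \<longleftrightarrow> (\<exists>a b c. x = a * F i0 + b * F i1 + c * F i2)" for x :: fps2 and F
  proof -
    have "(\<exists>a b c. x = a * F 0 + b * F 1 + c * F 2) \<longleftrightarrow> (\<exists>A. x = (\<Sum>i\<in>UNIV. A i * F i))"
    proof
      assume "\<exists>a b c. x = a * F 0 + b * F 1 + c * F 2"
      then obtain a b c where "x = a * F 0 + b * F 1 + c * F 2" by blast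
      then show "\<exists>A. x = (\<Sum>i\<in>UNIV. A i * F i)" unfolding sum012
        by (intro exI[of _ "\<lambda>i. if i = 0 then a else if i = 1 then b else c"]) simp
    qed (auto simp: sum012)
    also have "\<dots> \<longleftrightarrow> (\<exists>a b c. x = a * F i0 + b * F i1 + c * F i2)"
    proof
      assume "\<exists>a b c. x = a * F i0 + b * F i1 + c * F i2"
      then obtain a b c where "x = a * F i0 + b * F i1 + c * F i2" by blast
      then show "\<exists>A. x = (\<Sum>i\<in>UNIV. A i * F i)" unfolding perm using distinct
        by (intro exI[of _ "\<lambda>i. if i = i0 then a else if i = i1 then b else c"]) simp
    qed (auto simp: perm)
    finally show ?thesis .
  qed
  have "(\<exists>a b c. x = a * \<Lambda> f + b * \<Lambda> (pd i1 f) + c * \<Lambda> (pd i2 f)) \<longleftrightarrow>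
    (\<exists>a b c. x = a * \<Lambda> (pd i0 f) + b * \<Lambda> (pd i1 f) + c * \<Lambda> (pd i2 f))" for x
  proof
    assume "\<exists>a b c. x = a * \<Lambda> f + b * \<Lambda> (pd i1 f) + c * \<Lambda> (pd i2 f)"
    then obtain a b c where x: "x = a * \<Lambda> f + b * \<Lambda> (pd i1 f) + c * \<Lambda> (pd i2 f)" by blast
    have "x = (a * fps2_const (1 / of_nat d)) * \<Lambda> (pd i0 f) + (b + a * fps2_const (1 / of_nat d) * W i1) * \<Lambda> (pd i1 f)
       + (c + a * fps2_const (1 / of_nat d) * W i2) * \<Lambda> (pd i2 f)"
      unfolding x by (subst f_eq) (simp add: algebra_simps)
    then show "\<exists>a b c. x = a * \<Lambda> (pd i0 f) + b * \<Lambda> (pd i1 f) + c * \<Lambda> (pd i2 f)" by blast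
  next
    assume "\<exists>a b c. x = a * \<Lambda> (pd i0 f) + b * \<Lambda> (pd i1 f) + c * \<Lambda> (pd i2 f)"
    then obtain a b c where x: "x = a * \<Lambda> (pd i0 f) + b * \<Lambda> (pd i1 f) + c * \<Lambda> (pd i2 f)" by blast
    have "x = (a * fps2_const (of_nat d)) * \<Lambda> f + (b - a * W i1) * \<Lambda> (pd i1 f) + (c - a * W i2) * \<Lambda> (pd i2 f)"
      unfolding x i0_eq by (simp add: algebra_simps)
    then show "\<exists>a b c. x = a * \<Lambda> f + b * \<Lambda> (pd i1 f) + c * \<Lambda> (pd i2 f)" by blast
  qed
  then show ?thesis
    unfolding tjurina_ideal_def \<Lambda>_du \<Lambda>_dv using ex3[of _ "\<lambda>i. \<Lambda> (pd i f)"] by (auto simp: set_eq_iff)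
qed

end

lemma proj_plane_chart:
  assumes "p \<in> proj_plane"
  obtains i0 i1 i2 where "chart p i0 i1 i2" "\<And>f. local_eq f p = chart.\<Lambda> p i0 i1 i2 f"
proof -
  have z: "fps2_const 0 = 0" by (rule fps2_map.zero)
  consider b c where "p = (1, b, c)" | c where "p = (0, 1, c)" | "p = (0, 0, 1)"
    using assms unfolding proj_plane_def by blast
  then show ?thesis
  proof cases
    case 1
    interpret chart p 0 1 2 by unfold_locales (auto simp: 1)
    show ?thesis
      by (rule that[OF chart_axioms], unfold \<Lambda>_def W_def local_eq_def) (simp add: 1)
  next
    case 2
    interpret chart p 1 0 2 by unfold_locales (auto simp: 2)
    show ?thesis
      by (rule that[OF chart_axioms], unfold \<Lambda>_def W_def local_eq_def) (simp add: 2 z)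
  next
    case 3
    interpret chart p 2 0 1 by unfold_locales (auto simp: 3)
    show ?thesis
      by (rule that[OF chart_axioms], unfold \<Lambda>_def W_def local_eq_def) (simp add: 3 z)
  qed
qed

section \<open>Tjurina ideals, binary forms and points of the plane\<close>

lemma
  shows tjurina_add: "x \<in> tjurina_ideal g \<Longrightarrow> y \<in> tjurina_ideal g \<Longrightarrow> x + y \<in> tjurina_ideal g"
    and tjurina_mult: "x \<in> tjurina_ideal g \<Longrightarrow> r * x \<in> tjurina_ideal g"
    and tjurina_0: "0 \<in> tjurina_ideal g"
proof -
  show "x + y \<in> tjurina_ideal g" if x: "x \<in> tjurina_ideal g" and y: "y \<in> tjurina_ideal g"
  proof -
    obtain a b c a' b' c' where "x = a * g + b * fps2_du g + c * fps2_dv g" "y = a' * g + b' * fps2_du g + c' * fps2_dv g"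
      using x y unfolding tjurina_ideal_def by blast
    then have "x + y = (a + a') * g + (b + b') * fps2_du g + (c + c') * fps2_dv g" by (simp add: algebra_simps)
    then show ?thesis unfolding tjurina_ideal_def by blast
  qed
  show "r * x \<in> tjurina_ideal g" if x: "x \<in> tjurina_ideal g"
  proof -
    obtain a b c where "x = a * g + b * fps2_du g + c * fps2_dv g"
      using x unfolding tjurina_ideal_def by blast
    then have "r * x = (r * a) * g + (r * b) * fps2_du g + (r * c) * fps2_dv g" by (simp add: algebra_simps)
    then show ?thesis unfolding tjurina_ideal_def by blast
  qed
  have "0 = 0 * g + 0 * fps2_du g + 0 * fps2_dv g" by simp
  then show "0 \<in> tjurina_ideal g" unfolding tjurina_ideal_def by blast
qed

lemma subspace_tjurina: "fps2.subspace (tjurina_ideal g)"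
  by (rule fps2.subspaceI) (auto intro: tjurina_add tjurina_mult tjurina_0)

lemma tjurina_sum: "(\<And>i. i \<in> I \<Longrightarrow> F i \<in> tjurina_ideal g) \<Longrightarrow> sum F I \<in> tjurina_ideal g"
  by (rule fps2.subspace_sum[OF subspace_tjurina])

text \<open>Each term of the binomial expansion contains x or y at least to the power n.\<close>

lemma tjurina_power_add:
  assumes "x ^ n \<in> tjurina_ideal g" "y ^ n \<in> tjurina_ideal g"
  shows "(a * x + b * y) ^ (2 * n) \<in> tjurina_ideal g"
proof -
  have pw: "x ^ k * r \<in> tjurina_ideal g" if "x ^ n \<in> tjurina_ideal g" "k \<ge> n" for x r k
  proof -
    have "x ^ k * r = (r * x ^ (k - n)) * x ^ n" using that(2) by (simp add: ac_simps flip: power_add)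
    then show ?thesis using tjurina_mult[OF that(1)] by metis
  qed
  have "of_nat (2 * n choose k) * (a * x) ^ k * (b * y) ^ (2 * n - k) \<in> tjurina_ideal g" for k
  proof (cases "k \<ge> n")
    case True
    have "of_nat (2 * n choose k) * (a * x) ^ k * (b * y) ^ (2 * n - k) = x ^ k * (of_nat (2 * n choose k) * a ^ k * (b * y) ^ (2 * n - k))"
      by (simp add: power_mult_distrib ac_simps)
    then show ?thesis using pw[OF assms(1) True] by metis
  next
    case False
    have "of_nat (2 * n choose k) * (a * x) ^ k * (b * y) ^ (2 * n - k) = y ^ (2 * n - k) * (of_nat (2 * n choose k) * (a * x) ^ k * b ^ (2 * n - k))"
      by (simp add: power_mult_distrib ac_simps)
    moreover have "n \<le> 2 * n - k" using False by simp
    ultimately show ?thesis using pw[OF assms(2)] by metis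
  qed
  then show ?thesis unfolding binomial_ring by (intro tjurina_sum)
qed

text \<open>Otherwise the family would be a basis of a quotient V'/W inside V/W of larger
  dimension.\<close>

lemma (in vector_space) exists_relation_mod:
  assumes V: "subspace V" "fin_dim scale V" and W: "subspace W" "W \<subseteq> V"
    and I: "finite I" "card I > quot_dim scale V W" and e: "\<And>i. i \<in> I \<Longrightarrow> e i \<in> V"
  shows "\<exists>c. (\<exists>i\<in>I. c i \<noteq> 0) \<and> (\<Sum>i\<in>I. scale (c i) (e i)) \<in> W"
proof (rule ccontr)
  assume no: "\<not> ?thesis"
  define V' where "V' = {(\<Sum>i\<in>I. scale (c i) (e i)) + w | c w. w \<in> W}"
  have V': "subspace V'"
  proof (rule subspaceI)
    show "0 \<in> V'" unfolding V'_def using subspace_0[OF W(1)] by (intro CollectI exI[of _ "\<lambda>_. 0"] exI[of _ 0]) simp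
    fix x y assume "x \<in> V'" "y \<in> V'"
    then obtain c w c' w' where "x = (\<Sum>i\<in>I. scale (c i) (e i)) + w" "w \<in> W" "y = (\<Sum>i\<in>I. scale (c' i) (e i)) + w'" "w' \<in> W"
      unfolding V'_def by blast
    then show "x + y \<in> V'" unfolding V'_def using subspace_add[OF W(1)]
      by (intro CollectI exI[of _ "\<lambda>i. c i + c' i"] exI[of _ "w + w'"]) (simp add: scale_left_distrib sum.distrib algebra_simps)
  next
    fix a x assume "x \<in> V'"
    then obtain c w where "x = (\<Sum>i\<in>I. scale (c i) (e i)) + w" "w \<in> W" unfolding V'_def by blast
    then show "scale a x \<in> V'" unfolding V'_def using subspace_scale[OF W(1)]
      by (intro CollectI exI[of _ "\<lambda>i. a * c i"] exI[of _ "scale a w"]) (simp add: scale_right_distrib scale_sum_right)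
  qed
  have WV': "W \<subseteq> V'" unfolding V'_def by (force intro!: exI[of _ "\<lambda>_. 0"])
  have V'V: "V' \<subseteq> V"
    unfolding V'_def using W(2) e by (auto intro!: subspace_add[OF V(1)] subspace_sum[OF V(1)] subspace_scale[OF V(1)])
  have "quot_dim scale V' W = card I"
  proof (rule quot_dim_family[OF W(1) WV' I(1), of e])
    fix i assume i: "i \<in> I"
    have "e i = (\<Sum>j\<in>I. scale (if j = i then 1 else 0) (e j)) + 0"
      using i I(1) by (simp add: if_distrib[of "\<lambda>t. scale t _"] cong: if_cong)
    then show "e i \<in> V'" unfolding V'_def using subspace_0[OF W(1)]
      by (intro CollectI exI[of _ "\<lambda>j. if j = i then 1 else 0"] exI[of _ 0] conjI)
  next
    fix v assume "v \<in> V'"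
    then obtain c w where "v = (\<Sum>i\<in>I. scale (c i) (e i)) + w" "w \<in> W" unfolding V'_def by blast
    then show "\<exists>c. v - (\<Sum>i\<in>I. scale (c i) (e i)) \<in> W" by (intro exI[of _ c]) simp
  next
    fix c i assume "(\<Sum>i\<in>I. scale (c i) (e i)) \<in> W" "i \<in> I"
    then show "c i = 0" using no by blast
  qed
  then show False
    using dim_quot[OF V' fin_dim_subset[OF V(2) V'V] W(1) WV'] dim_quot[OF V W] dim_mono_finite[OF V(2) V'V] I(2) by simp
qed

text \<open>This is y^K Q(x/y), written without division; it turns polynomial equations for x/l into
  forms.\<close>

definition bihom :: "poly3 \<Rightarrow> poly3 \<Rightarrow> nat \<Rightarrow> complex poly \<Rightarrow> poly3" where
  "bihom x y K Q = (\<Sum>n\<le>K. const3 (coeff Q n) * x ^ n * y ^ (K - n))"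

lemma bihom_homog:
  assumes "x \<in> homog 1" "y \<in> homog 1"
  shows "bihom x y K Q \<in> homog (int K)"
  unfolding bihom_def
proof (rule homog_sum)
  fix n assume n: "n \<in> {..K}"
  have "const3 (coeff Q n) * x ^ n * y ^ (K - n) \<in> homog (0 + int n * 1 + int (K - n) * 1)"
    by (intro homog_mult homog_power homog_const assms)
  then show "const3 (coeff Q n) * x ^ n * y ^ (K - n) \<in> homog (int K)" using n by (simp add: of_nat_diff)
qed

lemma bihom_linear_factor:
  assumes "degree Q \<le> K"
  shows "bihom x y (Suc K) ([:- a, 1:] * Q) = (x - const3 a * y) * bihom x y K Q"
proof -
  have "bihom x y (Suc K) ([:- a, 1:] * Q) = bihom x y (Suc K) (pCons 0 Q) - const3 a * bihom x y (Suc K) Q"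
    by (simp add: bihom_def const3_diff const3_mult sum_distrib_left sum_subtractf algebra_simps)
  also have "bihom x y (Suc K) (pCons 0 Q) = x * bihom x y K Q"
    unfolding bihom_def sum.atMost_Suc_shift by (simp add: sum_distrib_left ac_simps)
  also have "bihom x y (Suc K) Q = y * bihom x y K Q"
  proof -
    have "coeff Q (Suc K) = 0" using assms by (simp add: coeff_eq_0)
    then have "bihom x y (Suc K) Q = (\<Sum>n\<le>K. const3 (coeff Q n) * x ^ n * y ^ (Suc K - n))"
      by (simp add: bihom_def)
    also have "\<dots> = y * bihom x y K Q"
      unfolding bihom_def sum_distrib_left by (intro sum.cong) (auto simp: Suc_diff_le ac_simps)
    finally show ?thesis .
  qed
  finally show ?thesis by (simp add: algebra_simps)
qed

lemma eval3_bihom: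
  assumes "eval3 y p \<noteq> 0" "degree Q \<le> K"
  shows "eval3 (bihom x y K Q) p = eval3 y p ^ K * poly Q (eval3 x p / eval3 y p)"
proof -
  have "poly Q (eval3 x p / eval3 y p) = (\<Sum>n\<le>K. coeff Q n * (eval3 x p / eval3 y p) ^ n)"
    unfolding poly_altdef using assms(2) by (intro sum.mono_neutral_left) (auto simp: coeff_eq_0)
  also have "eval3 y p ^ K * \<dots> = (\<Sum>n\<le>K. coeff Q n * eval3 x p ^ n * eval3 y p ^ (K - n))"
    unfolding sum_distrib_left using assms(1) by (intro sum.cong) (auto simp: power_divide power_diff field_simps)
  finally show ?thesis by (simp add: bihom_def eval3_simps)
qed

lemma proj_plane_nonzero: "p \<in> proj_plane \<Longrightarrow> \<exists>i. coord i p = 1"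
  unfolding proj_plane_def by (auto intro: exI[of _ 0] exI[of _ 1] exI[of _ 2])

lemma proj_plane_proportional:
  assumes p: "p \<in> proj_plane" and q: "q \<in> proj_plane" and eq: "\<And>i. coord i p = t * coord i q"
  shows "p = q"
proof -
  obtain p0 p1 p2 q0 q1 q2 where pq: "p = (p0, p1, p2)" "q = (q0, q1, q2)" by (cases p, cases q) auto
  have "p0 = t * q0" "p1 = t * q1" "p2 = t * q2" using eq[of 0] eq[of 1] eq[of 2] by (simp_all add: pq)
  then show ?thesis using p q unfolding proj_plane_def pq by auto
qed

lemma proj_plane_normalize:
  assumes "(x, y, z) \<noteq> (0, 0, 0)"
  obtains t where "t \<noteq> 0" "(t * x, t * y, t * z) \<in> proj_plane"
proof (cases "x = 0")
  case False
  then show ?thesis using that[of "1 / x"] by (simp add: proj_plane_def)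
next
  case x: True
  show ?thesis
  proof (cases "y = 0")
    case False
    then show ?thesis using that[of "1 / y"] x by (simp add: proj_plane_def)
  next
    case True
    then have "z \<noteq> 0" using assms x by simp
    then show ?thesis using that[of "1 / z"] x True by (simp add: proj_plane_def)
  qed
qed

text \<open>Powers of u and v in the ideal leave the n^2 monomials of the box as generators.
  Finiteness matters because \<open>quot_dim\<close> is 0 for an infinite-dimensional
  quotient.\<close>

lemma local_tjurina_finite_span:
  assumes "chart p i0 i1 i2" "fps2_u ^ n \<in> tjurina_ideal g" "fps2_v ^ n \<in> tjurina_ideal g"
  obtains S where "finite S" "UNIV \<subseteq> fps2.span (S \<union> tjurina_ideal g)"
proof -
  interpret chart p i0 i1 i2 by (rule assms(1))
  define S where "S = (\<lambda>(i, j). fps2_u ^ i * fps2_v ^ j) ` ({..<n} \<times> {..<n})"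
  have "\<beta> \<in> fps2.span (S \<union> tjurina_ideal g)" for \<beta>
  proof -
    obtain a where "a \<in> homog (int (2 * n))" and a: "\<forall>i<n. \<forall>j<n. fps_nth (fps_nth (\<beta> - \<Lambda> a) j) i = 0"
      "\<Lambda> a = (\<Sum>i<n. \<Sum>j<n. fps2_const (fps_nth (fps_nth \<beta> j) i) * fps2_u ^ i * fps2_v ^ j)"
      by (rule truncate[OF order_refl, of n \<beta>], rule that)
    obtain A B where "\<beta> - \<Lambda> a = A * fps2_u ^ n + B * fps2_v ^ n" using a(1) unfolding fps2_box_iff by blast
    then have "\<beta> - \<Lambda> a \<in> tjurina_ideal g" using tjurina_add[OF tjurina_mult[OF assms(2)] tjurina_mult[OF assms(3)]] by simp
    moreover have "\<Lambda> a \<in> fps2.span (S \<union> tjurina_ideal g)"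
      unfolding a(2) mult.assoc
      by (intro fps2.span_sum fps2.span_scale fps2.span_base) (auto simp: S_def)
    ultimately have "\<Lambda> a + (\<beta> - \<Lambda> a) \<in> fps2.span (S \<union> tjurina_ideal g)"
      by (intro fps2.span_add) (auto intro: fps2.span_base)
    then show ?thesis by simp
  qed
  then show ?thesis using that[of S] by (auto simp: S_def)
qed

section \<open>Localization at l and the singular points\<close>

context transversal_line
begin

text \<open>More than D^2 forms of one large degree are dependent modulo J by
  \<open>milnor_dim_bounded\<close>. So x/l satisfies a polynomial equation on S/J localized at
  l.\<close>

lemma exists_bihom_relation:
  assumes x: "x \<in> homog 1"
  obtains K Q where "Q \<noteq> 0" "degree Q \<le> K" "bihom x l K Q \<in> jacobian_ideal f"
proof -
  \<comment> \<open>K + 1 exceeds D^2, and K lies in the range of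
    \<open>milnor_dim_bounded\<close>.\<close>
  define K where "K = nat (2 * D + D ^ 2)"
  have K: "int K = 2 * D + D ^ 2" using D_ge by (simp add: K_def)
  then have "int K \<ge> 2 * D - 2" using zero_le_power2[of D] by linarith
  then have "int (milnor_dim f (int K)) \<le> D ^ 2" by (rule milnor_dim_bounded)
  then have m: "milnor_dim f (int K) < card {..K}" using K D_ge by simp
  have h: "x ^ n * l ^ (K - n) \<in> homog (int K)" if "n \<in> {..K}" for n
  proof -
    have "x ^ n * l ^ (K - n) \<in> homog (int n * 1 + int (K - n) * 1)"
      by (intro homog_mult homog_power x l_homog)
    then show ?thesis using that by (simp add: of_nat_diff)
  qed
  obtain c where c: "\<exists>i\<in>{..K}. c i \<noteq> 0" "(\<Sum>i\<le>K. scale3 (c i) (x ^ i * l ^ (K - i))) \<in> jacobian_ideal f \<inter> homog (int K)"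
    using S.exists_relation_mod[of "homog (int K)" "jacobian_ideal f \<inter> homog (int K)" "{..K}" "\<lambda>n. x ^ n * l ^ (K - n)",
        OF subspace_homog fin_dim_homog subspace_jacobian Int_lower2 finite_atMost]
      m h unfolding milnor_dim_def by blast
  define Q where "Q = (\<Sum>n\<le>K. monom (c n) n)"
  have cQ: "coeff Q n = (if n \<le> K then c n else 0)" for n
    by (simp add: Q_def coeff_sum)
  have "Q \<noteq> 0" using c(1) cQ by (metis atMost_iff coeff_0)
  moreover have "degree Q \<le> K" using cQ by (intro degree_le) auto
  moreover have "bihom x l K Q = (\<Sum>i\<le>K. scale3 (c i) (x ^ i * l ^ (K - i)))"
    unfolding bihom_def by (intro sum.cong) (auto simp: cQ scale3_def mult.assoc)
  ultimately show ?thesis using that c(2) by simp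
qed

text \<open>Multiplication by l on S/J is surjective from degree 2 D - 2 on, by
  \<open>homog_eq_l\<close>, so m(f) decreases there and becomes constant; between spaces of equal
  dimension a surjection is injective.\<close>

lemma mult_l_injective:
  obtains k1 where "\<And>k s. k \<ge> k1 \<Longrightarrow> s \<in> homog k \<Longrightarrow> s * l \<in> jacobian_ideal f \<Longrightarrow> s \<in> jacobian_ideal f"
proof -
  let ?J = "\<lambda>k. jacobian_ideal f \<inter> homog k"
  let ?N = "\<lambda>k. {s \<in> homog k. s * l \<in> ?J (k + 1)}"
  have dimN: "int (milnor_dim f (k + 1)) = sdim k - int (S.dim (?N k))" if k: "k \<ge> 2 * D - 2" for k
  proof -
    have "{s * l + w | s w. s \<in> homog k \<and> w \<in> ?J (k + 1)} = homog (k + 1)"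
    proof
      show "{s * l + w | s w. s \<in> homog k \<and> w \<in> ?J (k + 1)} \<subseteq> homog (k + 1)"
        using homog_mult[OF _ l_homog, of _ k] by (auto intro!: homog_add)
      have "homog (k + 1) = {s * l + w | s w. s \<in> homog (k + 1 - 1) \<and> w \<in> Ik (k + 1)}"
        by (rule homog_eq_l) (use k in simp)
      moreover have "Ik (k + 1) \<subseteq> ?J (k + 1)" using Ik_jacobian Ik_homog by blast
      ultimately show "homog (k + 1) \<subseteq> {s * l + w | s w. s \<in> homog k \<and> w \<in> ?J (k + 1)}"
        by (simp only: add_diff_cancel_right') blast
    qed
    then have "S.dim (homog (k + 1)) + S.dim (?N k) = S.dim (homog k) + S.dim (?J (k + 1))"
      using dim_mult_plus[OF subspace_homog fin_dim_homog subspace_jacobian S.fin_dim_subset[OF fin_dim_homog Int_lower2], of l k f "k + 1"]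
      by simp
    then show ?thesis using milnor_dim_jacobian[of f "k + 1"] by linarith
  qed
  have JN: "?J k \<subseteq> ?N k" for k
    using homog_mult[OF _ l_homog, of _ k] jacobian_mult[of _ f l] by (auto simp: mult.commute)
  have N_fin: "fin_dim scale3 (?N k)" for k
    by (rule S.fin_dim_subset[OF fin_dim_homog]) auto
  define m where "m i = milnor_dim f (2 * D - 2 + int i)" for i
  have mono1: "m (Suc i) \<le> m i" for i
  proof -
    have "S.dim (?J (2 * D - 2 + int i)) \<le> S.dim (?N (2 * D - 2 + int i))"
      by (rule S.dim_mono_finite[OF N_fin JN])
    then show ?thesis using dimN[of "2 * D - 2 + int i"] milnor_dim_jacobian[of f "2 * D - 2 + int i"]
      by (simp add: m_def algebra_simps)
  qed
  have mono: "i \<le> j \<Longrightarrow> m j \<le> m i" for i j using lift_Suc_antimono_le[of m] mono1 by blast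
  obtain i0 where i0: "\<And>i. m i0 \<le> m i" using ex_has_least_nat[of "\<lambda>_. True" 0 m] by auto
  have const: "m i = m i0" if "i \<ge> i0" for i using mono[OF that] i0[of i] by simp
  show ?thesis
  proof (rule that[of "2 * D - 2 + int i0"])
    fix k s assume k: "2 * D - 2 + int i0 \<le> k" and s: "s \<in> homog k" "s * l \<in> jacobian_ideal f"
    define i where "i = nat (k - (2 * D - 2))"
    have ki: "k = 2 * D - 2 + int i" "i \<ge> i0" using k by (auto simp: i_def)
    have "2 * D - 2 + int (Suc i) = k + 1" using ki(1) by simp
    then have "m (Suc i) = milnor_dim f (k + 1)" "m i = milnor_dim f k" by (simp_all only: m_def ki(1))
    then have "milnor_dim f (k + 1) = milnor_dim f k" using const[of i] const[of "Suc i"] ki(2) by simp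
    then have "S.dim (?N k) \<le> S.dim (?J k)"
      using dimN[of k] milnor_dim_jacobian[of f k] ki(1) by simp
    then have "?J k = ?N k" by (rule S.subspace_eq_of_dim_ge[OF subspace_jacobian N_fin JN])
    moreover have "s \<in> ?N k" using s homog_mult[OF s(1) l_homog] by simp
    ultimately show "s \<in> jacobian_ideal f" by blast
  qed
qed

text \<open>The saturation of J with respect to l, that is, J with l inverted. It frees the local
  arguments from degree bounds and agrees with J on forms of large degree by
  \<open>mult_l_injective\<close>.\<close>

definition Jl :: "poly3 set" where
  "Jl = {g. \<exists>n. g * l ^ n \<in> jacobian_ideal f}"

lemma jacobian_Jl: "g \<in> jacobian_ideal f \<Longrightarrow> g \<in> Jl"
  unfolding Jl_def by (intro CollectI exI[of _ 0]) simp

lemma Jl_mult: "g \<in> Jl \<Longrightarrow> h * g \<in> Jl"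
  unfolding Jl_def using jacobian_mult by (fastforce simp: mult.assoc)

lemma Jl_add:
  assumes "g \<in> Jl" "h \<in> Jl"
  shows "g + h \<in> Jl"
proof -
  obtain m n where mn: "g * l ^ m \<in> jacobian_ideal f" "h * l ^ n \<in> jacobian_ideal f" using assms unfolding Jl_def by blast
  have "(g + h) * l ^ (m + n) = l ^ n * (g * l ^ m) + l ^ m * (h * l ^ n)" by (simp add: power_add algebra_simps)
  also have "\<dots> \<in> jacobian_ideal f" by (intro jacobian_add jacobian_mult[OF mn(1)] jacobian_mult[OF mn(2)])
  finally show ?thesis unfolding Jl_def by blast
qed

lemma Jl_diff: "g \<in> Jl \<Longrightarrow> h \<in> Jl \<Longrightarrow> g - h \<in> Jl"
  using Jl_add[of g "- 1 * h"] Jl_mult[of h "- 1"] by simp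

lemma Jl_cancel: "l ^ n * g \<in> Jl \<Longrightarrow> g \<in> Jl"
proof -
  assume "l ^ n * g \<in> Jl"
  then obtain m where "l ^ n * g * l ^ m \<in> jacobian_ideal f" unfolding Jl_def by blast
  then have "g * l ^ (n + m) \<in> jacobian_ideal f" by (simp add: power_add ac_simps)
  then show ?thesis unfolding Jl_def by blast
qed

lemma Jl_const: "const3 t * g \<in> Jl \<Longrightarrow> t \<noteq> 0 \<Longrightarrow> g \<in> Jl"
  using Jl_mult[of "const3 t * g" "const3 (inverse t)"] const3_inverse[of t] by (simp flip: mult.assoc)

text \<open>A polynomial in x/l annihilates g modulo \<open>Jl\<close>. Its linear factors are
  applied to g one by one; the factor that first leads into \<open>Jl\<close> belongs to an
  eigenvalue.\<close>

lemma eigenvector: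
  assumes "x \<in> homog 1" "Q \<noteq> 0" "degree Q \<le> K" "bihom x l K Q * g \<in> Jl" "g \<notin> Jl"
  shows "\<exists>a m h. h \<in> homog (int m) \<and> h * g \<notin> Jl \<and> (x - const3 a * l) * (h * g) \<in> Jl"
  using assms
proof (induction "degree Q" arbitrary: Q K)
  case 0
  then obtain t where t: "Q = [:t:]" by (metis degree_eq_zeroE)
  have "bihom x l K Q = (\<Sum>n\<le>K. if n = 0 then const3 t * l ^ K else 0)"
    unfolding bihom_def t by (intro sum.cong) (auto simp: coeff_pCons split: nat.split)
  then have "bihom x l K Q = const3 t * l ^ K" by simp
  then have "const3 t * (l ^ K * g) \<in> Jl" using 0 by (simp add: mult.assoc)
  then have "g \<in> Jl" using Jl_const Jl_cancel t 0 by (metis pCons_0_0)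
  then show ?case using 0 by simp
next
  case (Suc n)
  have "\<not> constant (poly Q)" using Suc.hyps(2) by (simp add: constant_degree)
  then obtain a where "poly Q a = 0" using fundamental_theorem_of_algebra by blast
  then obtain R where R: "Q = [:- a, 1:] * R" by (metis dvdE poly_eq_0_iff_dvd)
  have R0: "R \<noteq> 0" using R Suc.prems(2) by auto
  have dQ: "degree Q = Suc (degree R)" unfolding R using degree_mult_eq[of "[:- a, 1:]" R] R0 by simp
  obtain K' where K': "K = Suc K'" "degree R \<le> K'" using Suc.prems(3) dQ by (cases K) auto
  have e: "bihom x l K Q * g = (x - const3 a * l) * (bihom x l K' R * g)"
    unfolding R K'(1) bihom_linear_factor[OF K'(2)] by (simp add: mult.assoc)
  show ?case
  proof (cases "bihom x l K' R * g \<in> Jl")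
    case True
    then show ?thesis using Suc.hyps(1)[of R K'] Suc.hyps(2) dQ R0 K' Suc.prems by simp
  next
    case False
    then show ?thesis using Suc.prems(4) bihom_homog[OF assms(1) l_homog] unfolding e by blast
  qed
qed

lemma exists_eigenvector:
  assumes "x \<in> homog 1" "g \<notin> Jl"
  shows "\<exists>a m h. h \<in> homog (int m) \<and> h * g \<notin> Jl \<and> (x - const3 a * l) * (h * g) \<in> Jl"
proof -
  obtain K Q where "Q \<noteq> 0" "degree Q \<le> K" "bihom x l K Q \<in> jacobian_ideal f" using exists_bihom_relation[OF assms(1)] by metis
  moreover from this(3) have "bihom x l K Q * g \<in> Jl" using Jl_mult[OF jacobian_Jl, of "bihom x l K Q" g] by (simp add: mult.commute)
  ultimately show ?thesis using eigenvector[OF assms(1) _ _ _ assms(2)] by blast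
qed

text \<open>Further multiplication by forms keeps the relations found earlier, as \<open>Jl\<close>
  is an ideal, so the three coordinates are treated in turn.\<close>

lemma exists_common_eigenvector:
  assumes "g \<notin> Jl"
  obtains a0 a1 a2 m h where "h \<in> homog (int m)" "h * g \<notin> Jl"
    "(var3 0 - const3 a0 * l) * (h * g) \<in> Jl" "(var3 1 - const3 a1 * l) * (h * g) \<in> Jl" "(var3 2 - const3 a2 * l) * (h * g) \<in> Jl"
proof -
  obtain a0 m0 h0 where 0: "h0 \<in> homog (int m0)" "h0 * g \<notin> Jl" "(var3 0 - const3 a0 * l) * (h0 * g) \<in> Jl"
    using exists_eigenvector[OF homog_var assms] by blast
  obtain a1 m1 h1 where 1: "h1 \<in> homog (int m1)" "h1 * (h0 * g) \<notin> Jl" "(var3 1 - const3 a1 * l) * (h1 * (h0 * g)) \<in> Jl"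
    using exists_eigenvector[OF homog_var 0(2)] by blast
  obtain a2 m2 h2 where 2: "h2 \<in> homog (int m2)" "h2 * (h1 * (h0 * g)) \<notin> Jl" "(var3 2 - const3 a2 * l) * (h2 * (h1 * (h0 * g))) \<in> Jl"
    using exists_eigenvector[OF homog_var 1(2)] by blast
  have e: "h2 * h1 * h0 * g = h2 * (h1 * (h0 * g))" by (simp add: ac_simps)
  show ?thesis
  proof (rule that[of "h2 * h1 * h0" "m2 + m1 + m0"])
    show "h2 * h1 * h0 \<in> homog (int (m2 + m1 + m0))" using homog_mult[OF homog_mult[OF 2(1) 1(1)] 0(1)] by simp
    show "h2 * h1 * h0 * g \<notin> Jl" unfolding e by (rule 2(2))
    have "(var3 0 - const3 a0 * l) * (h2 * (h1 * (h0 * g))) = (h2 * h1) * ((var3 0 - const3 a0 * l) * (h0 * g))" by (simp only: ac_simps)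
    then show "(var3 0 - const3 a0 * l) * (h2 * h1 * h0 * g) \<in> Jl" unfolding e using Jl_mult[OF 0(3)] by metis
    have "(var3 1 - const3 a1 * l) * (h2 * (h1 * (h0 * g))) = h2 * ((var3 1 - const3 a1 * l) * (h1 * (h0 * g)))" by (simp only: ac_simps)
    then show "(var3 1 - const3 a1 * l) * (h2 * h1 * h0 * g) \<in> Jl" unfolding e using Jl_mult[OF 1(3)] by metis
    show "(var3 2 - const3 a2 * l) * (h2 * h1 * h0 * g) \<in> Jl" unfolding e by (rule 2(3))
  qed
qed

text \<open>The variables are replaced by multiples of l one after the other, since x^n - y^n is
  divisible by x - y. So the eigenvalues form a point at which forms are evaluated.\<close>

lemma eigenvector_eval:
  assumes w: "(var3 0 - const3 a0 * l) * w \<in> Jl" "(var3 1 - const3 a1 * l) * w \<in> Jl" "(var3 2 - const3 a2 * l) * w \<in> Jl"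
    and q: "q \<in> homog (int m)"
  shows "(q - const3 (eval3 q (a0, a1, a2)) * l ^ m) * w \<in> Jl"
  using q
proof (induction rule: homog_induct)
  case zero
  then show ?case using Jl_mult[OF w(1), of 0] by (simp add: eval3_simps)
next
  case (add p q)
  have "(p + q - const3 (eval3 (p + q) (a0, a1, a2)) * l ^ m) * w =
     (p - const3 (eval3 p (a0, a1, a2)) * l ^ m) * w + (q - const3 (eval3 q (a0, a1, a2)) * l ^ m) * w"
    by (simp add: eval3_simps const3_add algebra_simps)
  then show ?case using Jl_add add by metis
next
  case (monomial c i j k)
  have pw: "(x ^ n - (const3 a * l) ^ n) * w \<in> Jl" if x: "(x - const3 a * l) * w \<in> Jl" for x a n
  proof -
    obtain s where "x ^ n - (const3 a * l) ^ n = (x - const3 a * l) * s" using power_diff_sumr2 by blast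
    then have "(x ^ n - (const3 a * l) ^ n) * w = s * ((x - const3 a * l) * w)" by (simp only: ac_simps)
    then show ?thesis using Jl_mult[OF x] by metis
  qed
  let ?L0 = "(const3 a0 * l) ^ i" and ?L1 = "(const3 a1 * l) ^ j" and ?L2 = "(const3 a2 * l) ^ k"
  have m: "m = i + j + k" using monomial by simp
  have "(const3 c * var3 0 ^ i * var3 1 ^ j * var3 2 ^ k - const3 (eval3 (const3 c * var3 0 ^ i * var3 1 ^ j * var3 2 ^ k) (a0, a1, a2)) * l ^ m) * w
    = (const3 c * var3 0 ^ i * var3 1 ^ j * var3 2 ^ k - const3 c * ?L0 * ?L1 * ?L2) * w"
    by (simp add: eval3_simps m const3_mult const3_power power_add power_mult_distrib ac_simps)
  also have "\<dots> = const3 c * var3 1 ^ j * var3 2 ^ k * ((var3 0 ^ i - ?L0) * w)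
     + const3 c * ?L0 * var3 2 ^ k * ((var3 1 ^ j - ?L1) * w) + const3 c * ?L0 * ?L1 * ((var3 2 ^ k - ?L2) * w)"
    by (simp add: algebra_simps)
  also have "\<dots> \<in> Jl" by (intro Jl_add Jl_mult pw w)
  finally show ?case .
qed

lemma eigenvector_zero:
  assumes w: "(var3 0 - const3 a0 * l) * w \<in> Jl" "(var3 1 - const3 a1 * l) * w \<in> Jl" "(var3 2 - const3 a2 * l) * w \<in> Jl" "w \<notin> Jl"
    and q: "q \<in> homog (int m)" "q * w \<in> Jl"
  shows "eval3 q (a0, a1, a2) = 0"
proof (rule ccontr)
  assume ne: "eval3 q (a0, a1, a2) \<noteq> 0"
  have "q * w - (q - const3 (eval3 q (a0, a1, a2)) * l ^ m) * w \<in> Jl"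
    by (rule Jl_diff[OF q(2) eigenvector_eval[OF w(1-3) q(1)]])
  then have "const3 (eval3 q (a0, a1, a2)) * (l ^ m * w) \<in> Jl" by (simp add: algebra_simps)
  then show False using Jl_const Jl_cancel ne w(4) by blast
qed

lemma jacobian_eval_sing: "x \<in> jacobian_ideal f \<Longrightarrow> p \<in> sing_points f \<Longrightarrow> eval3 x p = 0"
  unfolding jacobian_ideal_def sing_points_def by (auto simp: eval3_simps)

text \<open>A singular point on the line would be a zero of all forms of degree 2 D, as they lie in
  (l) + I.\<close>

lemma l_sing: assumes p: "p \<in> sing_points f" shows "eval3 l p \<noteq> 0"
proof
  assume l0: "eval3 l p = 0"
  obtain i where i: "coord i p = 1" using proj_plane_nonzero p unfolding sing_points_def by blast
  define n where "n = nat (2 * D)"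
  have "var3 i ^ n \<in> homog (2 * D)" using homog_power[OF homog_var, of i n] D_ge by (simp add: n_def)
  then obtain s w where "var3 i ^ n = s * l + w" "w \<in> Ik (2 * D)" using homog_eq_l[of "2 * D"] by auto
  then have "eval3 (var3 i ^ n) p = 0" using jacobian_eval_sing[OF _ p] Ik_jacobian l0 by (auto simp: eval3_simps)
  then show False using i by (simp add: eval3_simps)
qed

text \<open>Each x_i/l takes only values among the roots of one polynomial, and these three ratios
  determine the point. Over an infinite set the sum \<open>total_tjurina\<close> would be 0.\<close>

lemma finite_sing_points: "finite (sing_points f)"
proof -
  define r where "r p = (coord 0 p / eval3 l p, coord 1 p / eval3 l p, coord 2 p / eval3 l p)" for p
  have fin: "\<exists>R. finite R \<and> (\<forall>p\<in>sing_points f. coord i p / eval3 l p \<in> R)" for i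
  proof -
    obtain K Q where Q: "Q \<noteq> 0" "degree Q \<le> K" "bihom (var3 i) l K Q \<in> jacobian_ideal f"
      using exists_bihom_relation[OF homog_var] by metis
    have "poly Q (coord i p / eval3 l p) = 0" if p: "p \<in> sing_points f" for p
      using jacobian_eval_sing[OF Q(3) p] eval3_bihom[OF l_sing[OF p] Q(2), of "var3 i"] l_sing[OF p] by (simp add: eval3_simps)
    then show ?thesis using poly_roots_finite[OF Q(1)] by blast
  qed
  obtain R0 R1 R2 where R: "finite R0" "finite R1" "finite R2"
    "\<forall>p\<in>sing_points f. coord 0 p / eval3 l p \<in> R0" "\<forall>p\<in>sing_points f. coord 1 p / eval3 l p \<in> R1" "\<forall>p\<in>sing_points f. coord 2 p / eval3 l p \<in> R2"
    using fin[of 0] fin[of 1] fin[of 2] by metis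
  have "r ` sing_points f \<subseteq> R0 \<times> R1 \<times> R2" using R by (auto simp: r_def)
  then have "finite (r ` sing_points f)" using R by (meson finite_SigmaI finite_subset)
  moreover have "inj_on r (sing_points f)"
  proof (rule inj_onI)
    fix p q assume pq: "p \<in> sing_points f" "q \<in> sing_points f" "r p = r q"
    have "coord i p = (eval3 l p / eval3 l q) * coord i q" for i
      using pq(3) l_sing[OF pq(1)] l_sing[OF pq(2)] exhaust_3[of i] by (auto simp: r_def field_simps)
    then show "p = q" using proj_plane_proportional pq(1,2) unfolding sing_points_def by blast
  qed
  ultimately show ?thesis by (rule finite_imageD)
qed

text \<open>The relation from \<open>exists_bihom_relation\<close> is divided by the highest power
  of x that its polynomial allows. The lowest nonzero coefficient makes h nonzero at p, where x
  vanishes and l does not.\<close>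

lemma local_power:
  assumes p: "p \<in> sing_points f" and x: "x \<in> homog 1" "eval3 x p = 0"
  obtains n m h where "h \<in> homog (int m)" "eval3 h p \<noteq> 0" "x ^ n * h \<in> jacobian_ideal f"
proof -
  obtain K Q where Q: "Q \<noteq> 0" "degree Q \<le> K" "bihom x l K Q \<in> jacobian_ideal f" using exists_bihom_relation[OF x(1)] by metis
  define n where "n = (LEAST n. coeff Q n \<noteq> 0)"
  have "\<exists>n. coeff Q n \<noteq> 0" using Q(1) by (simp add: poly_eq_iff)
  then have n: "coeff Q n \<noteq> 0" unfolding n_def by (rule LeastI_ex)
  have lt: "coeff Q i = 0" if "i < n" for i using not_less_Least that unfolding n_def by blast
  have nK: "n \<le> K" using le_degree[OF n] Q(2) by simp
  define h where "h = (\<Sum>i\<in>{n..K}. const3 (coeff Q i) * x ^ (i - n) * l ^ (K - i))"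
  have "bihom x l K Q = (\<Sum>i\<in>{n..K}. const3 (coeff Q i) * x ^ i * l ^ (K - i))"
    unfolding bihom_def by (intro sum.mono_neutral_right) (auto simp: lt)
  also have "\<dots> = x ^ n * h"
    unfolding h_def sum_distrib_left
  proof (intro sum.cong refl)
    fix i assume "i \<in> {n..K}"
    then have "x ^ i = x ^ n * x ^ (i - n)" by (simp flip: power_add)
    then show "const3 (coeff Q i) * x ^ i * l ^ (K - i) = x ^ n * (const3 (coeff Q i) * x ^ (i - n) * l ^ (K - i))" by (simp only: ac_simps)
  qed
  finally have e: "bihom x l K Q = x ^ n * h" .
  have "const3 (coeff Q i) * x ^ (i - n) * l ^ (K - i) \<in> homog (int (K - n))" if "i \<in> {n..K}" for i
  proof -
    have "const3 (coeff Q i) * x ^ (i - n) * l ^ (K - i) \<in> homog (0 + int (i - n) * 1 + int (K - i) * 1)"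
      by (intro homog_mult homog_power homog_const x l_homog)
    then show ?thesis using that by (simp add: of_nat_diff)
  qed
  then have "h \<in> homog (int (K - n))" unfolding h_def by (intro homog_sum)
  moreover have "eval3 h p = (\<Sum>i\<in>{n..K}. if i = n then coeff Q n * eval3 l p ^ (K - n) else 0)"
    unfolding h_def eval3_simps x(2) by (intro sum.cong) auto
  then have "eval3 h p \<noteq> 0" using n nK l_sing[OF p] by simp
  ultimately show ?thesis using that Q(3) e by metis
qed

lemma local_box:
  assumes p: "p \<in> sing_points f" and ch: "chart p i0 i1 i2"
  obtains n m h where "h \<in> homog (int m)" "eval3 h p \<noteq> 0"
    "chart.U p i0 i1 ^ n * h \<in> jacobian_ideal f" "chart.V p i0 i2 ^ n * h \<in> jacobian_ideal f"
proof -
  interpret chart p i0 i1 i2 by (rule ch)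
  obtain n1 m1 h1 where 1: "h1 \<in> homog (int m1)" "eval3 h1 p \<noteq> 0" "U ^ n1 * h1 \<in> jacobian_ideal f"
    using local_power[OF p homog_XUV(2) eval_XUV(2)] by metis
  obtain n2 m2 h2 where 2: "h2 \<in> homog (int m2)" "eval3 h2 p \<noteq> 0" "V ^ n2 * h2 \<in> jacobian_ideal f"
    using local_power[OF p homog_XUV(3) eval_XUV(3)] by metis
  show ?thesis
  proof (rule that[of "h1 * h2" "m1 + m2" "n1 + n2"])
    show "h1 * h2 \<in> homog (int (m1 + m2))" using homog_mult[OF 1(1) 2(1)] by simp
    show "eval3 (h1 * h2) p \<noteq> 0" using 1 2 by (simp add: eval3_simps)
    have "U ^ (n1 + n2) * (h1 * h2) = (U ^ n2 * h2) * (U ^ n1 * h1)" by (simp only: power_add ac_simps)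
    then show "U ^ (n1 + n2) * (h1 * h2) \<in> jacobian_ideal f" using jacobian_mult[OF 1(3)] by metis
    have "V ^ (n1 + n2) * (h1 * h2) = (V ^ n1 * h1) * (V ^ n2 * h2)" by (simp only: power_add ac_simps)
    then show "V ^ (n1 + n2) * (h1 * h2) \<in> jacobian_ideal f" using jacobian_mult[OF 2(3)] by metis
  qed
qed

end

section \<open>The Tjurina number as a value of the Hilbert function\<close>

text \<open>The candidates are 2 by 2 minors against q that involve its normalized coordinate; if
  all of them vanished at p, the two points would be proportional.\<close>

lemma exists_separating_form:
  assumes p: "p \<in> proj_plane" and q: "q \<in> proj_plane" and "p \<noteq> q"
  obtains s where "s \<in> homog 1" "eval3 s q = 0" "eval3 s p \<noteq> 0"
proof -
  obtain i where i: "coord i q = 1" using proj_plane_nonzero[OF q] by blast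
  define s where "s j = const3 (coord i q) * var3 j - const3 (coord j q) * var3 i" for j
  have s: "s j \<in> homog 1" "eval3 (s j) q = 0" for j
    unfolding s_def by (auto simp: eval3_simps intro!: homog_diff homog_const_mult homog_var)
  have "\<exists>j. eval3 (s j) p \<noteq> 0"
  proof (rule ccontr)
    assume "\<not> ?thesis"
    then have s0: "eval3 (s j) p = 0" for j by blast
    have "eval3 (s j) p = coord j p - coord i p * coord j q" for j by (simp add: s_def eval3_simps i mult.commute)
    then have "coord j p = coord i p * coord j q" for j using s0[of j] by (metis right_minus_eq)
    from proj_plane_proportional[OF p q this] show False using \<open>p \<noteq> q\<close> by simp
  qed
  then obtain j where "eval3 (s j) p \<noteq> 0" by blast
  from that[OF s this] show ?thesis .
qed

context transversal_line
begin

lemma f_homog_pos: "(1::nat) \<le> d" using d_ge by simp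

lemma jacobian_local:
  assumes p: "p \<in> sing_points f" and x: "x \<in> jacobian_ideal f"
  shows "local_eq x p \<in> tjurina_ideal (local_eq f p)"
proof -
  obtain i0 i1 i2 where ch: "chart p i0 i1 i2" "\<And>f. local_eq f p = chart.\<Lambda> p i0 i1 i2 f"
    using proj_plane_chart p unfolding sing_points_def by blast
  interpret chart p i0 i1 i2 by (rule ch(1))
  obtain A B C where "x = A * pd 0 f + B * pd 1 f + C * pd 2 f" using x unfolding jacobian_ideal_def by blast
  then have "\<Lambda> x = \<Lambda> A * \<Lambda> (pd 0 f) + \<Lambda> B * \<Lambda> (pd 1 f) + \<Lambda> C * \<Lambda> (pd 2 f)" by (simp add: \<Lambda>_simps)
  then show ?thesis unfolding ch(2) tjurina_eq[OF f_homog f_homog_pos] by blast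
qed

lemma local_eq_simps:
  assumes "p \<in> proj_plane"
  shows "local_eq (x + y) p = local_eq x p + local_eq y p" "local_eq (x - y) p = local_eq x p - local_eq y p"
    "local_eq (x * y) p = local_eq x p * local_eq y p" "local_eq (x ^ n) p = local_eq x p ^ n"
    "local_eq (sum F A) p = (\<Sum>i\<in>A. local_eq (F i) p)" "local_eq (prod F A) p = (\<Prod>i\<in>A. local_eq (F i) p)"
    "local_eq (scale3 t x) p = fps2_const t * local_eq x p"
    "fps_nth (fps_nth (local_eq x p) 0) 0 = eval3 x p"
proof -
  obtain i0 i1 i2 where ch: "chart p i0 i1 i2" "\<And>f. local_eq f p = chart.\<Lambda> p i0 i1 i2 f"
    using proj_plane_chart assms by blast
  interpret chart p i0 i1 i2 by (rule ch(1))
  show "local_eq (x + y) p = local_eq x p + local_eq y p" "local_eq (x - y) p = local_eq x p - local_eq y p"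
    "local_eq (x * y) p = local_eq x p * local_eq y p" "local_eq (x ^ n) p = local_eq x p ^ n"
    "local_eq (sum F A) p = (\<Sum>i\<in>A. local_eq (F i) p)" "local_eq (prod F A) p = (\<Prod>i\<in>A. local_eq (F i) p)"
    "local_eq (scale3 t x) p = fps2_const t * local_eq x p"
    "fps_nth (fps_nth (local_eq x p) 0) 0 = eval3 x p"
    by (simp_all add: ch(2) \<Lambda>_simps \<Lambda>_const_term scale3_def)
qed

lemma sing_proj: "p \<in> sing_points f \<Longrightarrow> p \<in> proj_plane"
  by (simp add: sing_points_def)

text \<open>The cofactor h of \<open>local_box\<close> is a unit in the local ring.\<close>

lemma tjurina_contains_power:
  assumes p: "p \<in> sing_points f"
  obtains n where "fps2_u ^ n \<in> tjurina_ideal (local_eq f p)" "fps2_v ^ n \<in> tjurina_ideal (local_eq f p)"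
proof -
  obtain i0 i1 i2 where ch: "chart p i0 i1 i2" "\<And>f. local_eq f p = chart.\<Lambda> p i0 i1 i2 f"
    using proj_plane_chart sing_proj[OF p] by blast
  interpret chart p i0 i1 i2 by (rule ch(1))
  obtain n m h where h: "h \<in> homog (int m)" "eval3 h p \<noteq> 0" "U ^ n * h \<in> jacobian_ideal f" "V ^ n * h \<in> jacobian_ideal f"
    using local_box[OF p ch(1)] by metis
  obtain r where r: "\<Lambda> h * r = 1" using fps2_unit[of "\<Lambda> h"] h(2) by (auto simp: \<Lambda>_const_term)
  have u: "r * \<Lambda> (U ^ n * h) = fps2_u ^ n" "r * \<Lambda> (V ^ n * h) = fps2_v ^ n"
    using r by (simp_all add: \<Lambda>_simps \<Lambda>_U \<Lambda>_V ac_simps flip: mult.assoc)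
  have "r * \<Lambda> (U ^ n * h) \<in> tjurina_ideal (local_eq f p)" "r * \<Lambda> (V ^ n * h) \<in> tjurina_ideal (local_eq f p)"
    using jacobian_local[OF p h(3)] jacobian_local[OF p h(4)] unfolding ch(2) by (auto intro: tjurina_mult)
  then show ?thesis using that unfolding u by blast
qed

text \<open>Otherwise \<open>exists_common_eigenvector\<close> yields a multiple w of g outside
  \<open>Jl\<close> and a point P of eigenvalues. The partial derivatives carry w into J, so P is
  singular, and there w lies in the Tjurina ideal. Truncating the local coefficients produces a form
  that carries w into J without vanishing at P, contrary to \<open>eigenvector_zero\<close>.\<close>

lemma local_global_injective:
  assumes g: "g \<in> homog k" and loc: "\<And>p. p \<in> sing_points f \<Longrightarrow> local_eq g p \<in> tjurina_ideal (local_eq f p)"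
  shows "g \<in> Jl"
proof (rule ccontr)
  assume gJ: "g \<notin> Jl"
  then have "g \<noteq> 0" using Jl_mult[of _ 0] jacobian_Jl[OF g_in_jacobian(1)] by (metis mult_zero_left)
  then have "k \<ge> 0" using g homog_neg[of k] by (cases "k < 0") auto
  then obtain kk where kk: "k = int kk" using nonneg_int_cases by metis
  obtain a0 a1 a2 m h where h: "h \<in> homog (int m)" "h * g \<notin> Jl"
    "(var3 0 - const3 a0 * l) * (h * g) \<in> Jl" "(var3 1 - const3 a1 * l) * (h * g) \<in> Jl" "(var3 2 - const3 a2 * l) * (h * g) \<in> Jl"
    using exists_common_eigenvector[OF gJ] by metis
  define w where "w = h * g"
  note ev = h(3-5)[folded w_def]
  have wJ: "w \<notin> Jl" using h(2) by (simp add: w_def)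
  have w_homog: "w \<in> homog (int (m + kk))" unfolding w_def using homog_mult[OF h(1) g] kk by simp
  let ?P = "(a0, a1, a2)"
  \<comment> \<open>By \<open>eigenvector_eval\<close> for l itself, l acts on w as its value at
    \<open>?P\<close> times l. In particular \<open>?P\<close> is not the zero vector and gives a
    projective point.\<close>
  have "eval3 l ?P = 1"
  proof (rule ccontr)
    assume ne: "eval3 l ?P \<noteq> 1"
    have "(l - const3 (eval3 l ?P) * l ^ 1) * w \<in> Jl" by (rule eigenvector_eval[OF ev]) (simp add: l_homog)
    then have "const3 (1 - eval3 l ?P) * (l ^ 1 * w) \<in> Jl" by (simp add: const3_diff const3_1 algebra_simps)
    then have "l ^ 1 * w \<in> Jl" by (rule Jl_const) (use ne in simp)
    then show False using Jl_cancel wJ by blast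
  qed
  then have "?P \<noteq> (0, 0, 0)" by (auto simp: l_def eval3_simps)
  then obtain t where t: "t \<noteq> 0" "(t * a0, t * a1, t * a2) \<in> proj_plane" by (rule proj_plane_normalize)
  define p where "p = (t * a0, t * a1, t * a2)"
  have D: "D = int (d - 1)" using d_ge by (simp add: D_def)
  have pdP: "eval3 (pd i f) ?P = 0" for i
  proof (rule eigenvector_zero[OF ev wJ])
    show "pd i f \<in> homog (int (d - 1))" using pd_f_homog D by simp
    have "1 * pd 0 f + 0 * pd 1 f + 0 * pd 2 f \<in> jacobian_ideal f" "0 * pd 0 f + 1 * pd 1 f + 0 * pd 2 f \<in> jacobian_ideal f"
      "0 * pd 0 f + 0 * pd 1 f + 1 * pd 2 f \<in> jacobian_ideal f" unfolding jacobian_ideal_def by blast+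
    then have "pd i f \<in> jacobian_ideal f" using exhaust_3[of i] by auto
    then show "pd i f * w \<in> Jl" using Jl_mult[OF jacobian_Jl, of "pd i f" w] by (simp add: mult.commute)
  qed
  have "eval3 (const3 (of_int (int d)) * f) ?P = 0" unfolding euler[OF f_homog, symmetric] by (simp add: eval3_simps pdP)
  then have fP: "eval3 f ?P = 0" using d_ge by (simp add: eval3_simps)
  have "eval3 f p = 0" unfolding p_def eval3_scale[OF f_homog] using fP by simp
  moreover have "eval3 (pd i f) p = 0" for i
    unfolding p_def using eval3_scale[of "pd i f" "d - 1"] pd_f_homog[of i] pdP[of i] D by simp
  ultimately have p: "p \<in> sing_points f" using t(2) by (simp add: sing_points_def p_def)
  obtain i0 i1 i2 where ch: "chart p i0 i1 i2" "\<And>f. local_eq f p = chart.\<Lambda> p i0 i1 i2 f"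
    using proj_plane_chart sing_proj[OF p] by blast
  interpret chart p i0 i1 i2 by (rule ch(1))
  obtain n m' h' where h': "h' \<in> homog (int m')" "eval3 h' p \<noteq> 0" "U ^ n * h' \<in> jacobian_ideal f" "V ^ n * h' \<in> jacobian_ideal f"
    using local_box[OF p ch(1)] by metis
  have "\<Lambda> w \<in> tjurina_ideal (\<Lambda> f)" using loc[OF p] unfolding ch(2) w_def \<Lambda>_simps by (rule tjurina_mult)
  then obtain \<beta>0 \<beta>1 \<beta>2 where \<beta>: "\<Lambda> w = \<beta>0 * \<Lambda> (pd 0 f) + \<beta>1 * \<Lambda> (pd 1 f) + \<beta>2 * \<Lambda> (pd 2 f)"
    unfolding tjurina_eq[OF f_homog f_homog_pos] by blast
  \<comment> \<open>M \<ge> 2 n permits \<open>truncate\<close>, and with s = 2 n + D the form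
    \<open>X ^ s * w\<close> gets the degree M + D of \<open>E\<close>.\<close>
  define M where "M = 2 * n + (m + kk)"
  have tr: "\<exists>b\<in>homog (int M). \<exists>A B. \<beta> - \<Lambda> b = A * fps2_u ^ n + B * fps2_v ^ n" for \<beta>
  proof -
    have "2 * n \<le> M" by (simp add: M_def)
    then obtain b where "b \<in> homog (int M)" "\<forall>i<n. \<forall>j<n. fps_nth (fps_nth (\<beta> - \<Lambda> b) j) i = 0"
      using truncate[of n M \<beta>] by metis
    then show ?thesis unfolding fps2_box_iff by blast
  qed
  obtain b0 A0 B0 where 0: "b0 \<in> homog (int M)" "\<beta>0 - \<Lambda> b0 = A0 * fps2_u ^ n + B0 * fps2_v ^ n" using tr by blast
  obtain b1 A1 B1 where 1: "b1 \<in> homog (int M)" "\<beta>1 - \<Lambda> b1 = A1 * fps2_u ^ n + B1 * fps2_v ^ n" using tr by blast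
  obtain b2 A2 B2 where 2: "b2 \<in> homog (int M)" "\<beta>2 - \<Lambda> b2 = A2 * fps2_u ^ n + B2 * fps2_v ^ n" using tr by blast
  define s where "s = 2 * n + (d - 1)"
  define E where "E = b0 * pd 0 f + b1 * pd 1 f + b2 * pd 2 f"
  \<comment> \<open>The error of replacing the local coefficients by forms: it lies locally in (u^n,
    v^n), hence in (U^n, V^n), and so is carried into J by h'.\<close>
  define G where "G = X ^ s * w - E"
  have E_homog: "E \<in> homog (int M + D)" unfolding E_def by (intro homog_add homog_mult pd_f_homog 0 1 2)
  have EJ: "E \<in> jacobian_ideal f" unfolding E_def jacobian_ideal_def by blast
  have "X ^ s * w \<in> homog (int s * 1 + int (m + kk))" by (intro homog_mult homog_power homog_XUV w_homog)
  also have "int s * 1 + int (m + kk) = int M + D" by (simp add: s_def M_def D)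
  finally have G_homog: "G \<in> homog (int M + D)" unfolding G_def using E_homog by (rule homog_diff)
  have "\<Lambda> G = (\<beta>0 - \<Lambda> b0) * \<Lambda> (pd 0 f) + (\<beta>1 - \<Lambda> b1) * \<Lambda> (pd 1 f) + (\<beta>2 - \<Lambda> b2) * \<Lambda> (pd 2 f)"
    unfolding G_def E_def \<Lambda>_simps \<beta> \<Lambda>_X by (simp add: algebra_simps)
  also have "\<dots> = (A0 * \<Lambda> (pd 0 f) + A1 * \<Lambda> (pd 1 f) + A2 * \<Lambda> (pd 2 f)) * fps2_u ^ n
     + (B0 * \<Lambda> (pd 0 f) + B1 * \<Lambda> (pd 1 f) + B2 * \<Lambda> (pd 2 f)) * fps2_v ^ n"
    unfolding 0(2) 1(2) 2(2) by (simp add: algebra_simps)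
  finally have "\<forall>i<n. \<forall>j<n. fps_nth (fps_nth (\<Lambda> G) j) i = 0" unfolding fps2_box_iff by blast
  then obtain A B where AB: "G = U ^ n * A + V ^ n * B" using box_imp_ideal[OF G_homog] by blast
  have "(h' * X ^ s) * w = A * (U ^ n * h') + B * (V ^ n * h') + h' * E"
  proof -
    have "(h' * X ^ s) * w = h' * G + h' * E" by (simp add: G_def algebra_simps)
    then show ?thesis unfolding AB by (simp add: algebra_simps)
  qed
  also have "\<dots> \<in> jacobian_ideal f" by (intro jacobian_add jacobian_mult[OF h'(3)] jacobian_mult[OF h'(4)] jacobian_mult[OF EJ])
  finally have "(h' * X ^ s) * w \<in> Jl" by (rule jacobian_Jl)
  moreover have hX: "h' * X ^ s \<in> homog (int (m' + s))" using homog_mult[OF h'(1) homog_power[OF homog_XUV(1), of s]] by simp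
  ultimately have "eval3 (h' * X ^ s) ?P = 0" using eigenvector_zero[OF ev wJ] by blast
  then have "eval3 (h' * X ^ s) p = 0" unfolding p_def eval3_scale[OF hX] by simp
  then show False using h'(2) eval_XUV(1) by (simp add: eval3_simps)
qed

text \<open>A product G of powers of separating linear forms lies in the Tjurina ideals of the other
  singular points and is a unit at p; its product with a form that approximates \<beta>/G at p is
  the required g.\<close>

lemma local_global_surjective:
  obtains k2 where "\<And>k p \<beta>. k \<ge> k2 \<Longrightarrow> p \<in> sing_points f \<Longrightarrow>
    \<exists>g\<in>homog k. local_eq g p - \<beta> \<in> tjurina_ideal (local_eq f p) \<and>
      (\<forall>q\<in>sing_points f - {p}. local_eq g q \<in> tjurina_ideal (local_eq f q))"
proof -
  let ?Z = "sing_points f"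
  have "\<forall>p\<in>?Z. \<exists>n. fps2_u ^ n \<in> tjurina_ideal (local_eq f p) \<and> fps2_v ^ n \<in> tjurina_ideal (local_eq f p)"
    using tjurina_contains_power by metis
  then obtain n where n: "\<forall>p\<in>?Z. fps2_u ^ n p \<in> tjurina_ideal (local_eq f p) \<and> fps2_v ^ n p \<in> tjurina_ideal (local_eq f p)" by metis
  \<comment> \<open>The sum bounds all exponents \<open>n p\<close> at once.\<close>
  define N where "N = sum n ?Z"
  have N: "fps2_u ^ N \<in> tjurina_ideal (local_eq f p)" "fps2_v ^ N \<in> tjurina_ideal (local_eq f p)" if p: "p \<in> ?Z" for p
  proof -
    have "n p \<le> N" unfolding N_def using finite_sing_points p by (intro member_le_sum) auto
    then have e: "x ^ N = x ^ (N - n p) * x ^ n p" for x :: fps2 by (simp flip: power_add)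
    show "fps2_u ^ N \<in> tjurina_ideal (local_eq f p)" "fps2_v ^ N \<in> tjurina_ideal (local_eq f p)"
      unfolding e using n p by (auto intro: tjurina_mult)
  qed
  \<comment> \<open>A bound for the degree of \<open>G\<close>, whose factors are powers with
    exponent 2 N, plus the 2 N required by \<open>truncate\<close>.\<close>
  define k2 where "k2 = int (2 * N * card ?Z + 2 * N)"
  show ?thesis
  proof (rule that[of k2])
    fix k p \<beta> assume k: "k2 \<le> k" and p: "p \<in> ?Z"
    have "\<forall>q\<in>?Z - {p}. \<exists>s. s \<in> homog 1 \<and> eval3 s q = 0 \<and> eval3 s p \<noteq> 0"
      using exists_separating_form[OF sing_proj[OF p]] sing_proj by (metis Diff_iff insertI1)
    then obtain s where s: "\<And>q. q \<in> ?Z - {p} \<Longrightarrow> s q \<in> homog 1 \<and> eval3 (s q) q = 0 \<and> eval3 (s q) p \<noteq> 0" by metis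
    define G where "G = (\<Prod>q\<in>?Z - {p}. s q ^ (2 * N))"
    define e where "e = 2 * N * card (?Z - {p})"
    have "G \<in> homog (\<Sum>q\<in>?Z - {p}. int (2 * N) * 1)"
      unfolding G_def using s by (intro homog_prod homog_power) auto
    then have G_homog: "G \<in> homog (int e)" by (simp add: e_def mult.commute)
    have "eval3 G p \<noteq> 0" unfolding G_def eval3_simps using s finite_sing_points by simp
    then obtain r where r: "local_eq G p * r = 1"
      using fps2_unit[of "local_eq G p"] by (auto simp: local_eq_simps[OF sing_proj[OF p]])
    have Gq: "local_eq G q \<in> tjurina_ideal (local_eq f q)" if q: "q \<in> ?Z - {p}" for q
    proof -
      have q': "q \<in> ?Z" "q \<in> proj_plane" using q sing_proj by auto
      have "\<forall>i<1. \<forall>j<1. fps_nth (fps_nth (local_eq (s q) q) j) i = 0"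
        using s[OF q] by (simp add: local_eq_simps(8)[OF q'(2)])
      then obtain A B where AB: "local_eq (s q) q = A * fps2_u + B * fps2_v" unfolding fps2_box_iff by auto
      have "local_eq (s q ^ (2 * N)) q \<in> tjurina_ideal (local_eq f q)"
        unfolding local_eq_simps(4)[OF q'(2)] AB by (rule tjurina_power_add[OF N[OF q'(1)]])
      then have "local_eq (\<Prod>q'\<in>?Z - {p} - {q}. s q' ^ (2 * N)) q * local_eq (s q ^ (2 * N)) q \<in> tjurina_ideal (local_eq f q)"
        by (rule tjurina_mult)
      moreover have "G = (\<Prod>q'\<in>?Z - {p} - {q}. s q' ^ (2 * N)) * s q ^ (2 * N)"
        unfolding G_def using prod.remove[of "?Z - {p}" q "\<lambda>q. s q ^ (2 * N)"] q finite_sing_points by (simp add: mult.commute)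
      ultimately show ?thesis by (simp only: local_eq_simps[OF q'(2)])
    qed
    obtain i0 i1 i2 where ch: "chart p i0 i1 i2" "\<And>f. local_eq f p = chart.\<Lambda> p i0 i1 i2 f"
      using proj_plane_chart sing_proj[OF p] by blast
    interpret chart p i0 i1 i2 by (rule ch(1))
    have "card (?Z - {p}) \<le> card ?Z" using finite_sing_points by (intro card_mono) auto
    then have "e \<le> 2 * N * card ?Z" unfolding e_def by simp
    then have "int e \<le> int (2 * N * card ?Z)" by (rule of_nat_mono)
    then have ke: "k \<ge> int e + int (2 * N)" using k unfolding k2_def of_nat_add by linarith
    define K where "K = nat (k - int e)"
    have K: "2 * N \<le> K" "int K = k - int e" using ke by (auto simp: K_def)
    obtain b where b: "b \<in> homog (int K)" "\<forall>i<N. \<forall>j<N. fps_nth (fps_nth (\<beta> * r - \<Lambda> b) j) i = 0"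
      using truncate[OF K(1), of "\<beta> * r"] by metis
    then obtain A B where AB: "\<beta> * r - \<Lambda> b = A * fps2_u ^ N + B * fps2_v ^ N" unfolding fps2_box_iff by blast
    have "\<beta> * r - \<Lambda> b \<in> tjurina_ideal (local_eq f p)"
      unfolding AB by (intro tjurina_add tjurina_mult N[OF p])
    then have "(- local_eq G p) * (\<beta> * r - \<Lambda> b) \<in> tjurina_ideal (local_eq f p)" by (rule tjurina_mult)
    moreover have "(- local_eq G p) * (\<beta> * r - \<Lambda> b) = local_eq (b * G) p - \<beta>"
    proof -
      have "(- local_eq G p) * (\<beta> * r - \<Lambda> b) = \<Lambda> b * local_eq G p - \<beta> * (local_eq G p * r)" by (simp add: algebra_simps)
      then show ?thesis unfolding r by (simp add: ch(2) \<Lambda>_simps)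
    qed
    moreover have "b * G \<in> homog k" using homog_mult[OF b(1) G_homog] K(2) by simp
    moreover have "local_eq (b * G) q \<in> tjurina_ideal (local_eq f q)" if q: "q \<in> ?Z - {p}" for q
      using tjurina_mult[OF Gq[OF q], of "local_eq b q"] local_eq_simps(3)[of q b G] sing_proj[of q] q by simp
    ultimately show "\<exists>g\<in>homog k. local_eq g p - \<beta> \<in> tjurina_ideal (local_eq f p) \<and>
      (\<forall>q\<in>?Z - {p}. local_eq g q \<in> tjurina_ideal (local_eq f q))" by metis
  qed
qed

text \<open>In large degrees a basis of M(f) consists of forms e(p, b) that represent b in the
  Tjurina algebra at p and 0 at the other singular points: independence is checked locally, and
  spanning rests on \<open>local_global_injective\<close>.\<close>

lemma milnor_dim_eventually_tjurina:
  obtains k0 where "\<And>k. k \<ge> k0 \<Longrightarrow> milnor_dim f k = total_tjurina f"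
proof -
  let ?Z = "sing_points f" and ?T = "\<lambda>p. tjurina_ideal (local_eq f p)"
  obtain k1 where k1: "\<And>k s. k \<ge> k1 \<Longrightarrow> s \<in> homog k \<Longrightarrow> s * l \<in> jacobian_ideal f \<Longrightarrow> s \<in> jacobian_ideal f"
    using mult_l_injective by metis
  have Jl_J: "s \<in> jacobian_ideal f" if "k \<ge> k1" "s \<in> homog k" "s \<in> Jl" for k s
  proof -
    have "s * l ^ n \<in> jacobian_ideal f \<Longrightarrow> s \<in> jacobian_ideal f" for n
    proof (induction n)
      case (Suc n)
      have "s * l ^ n \<in> homog (k + int n)" using homog_mult[OF that(2) l_power_homog[of n]] .
      then have "s * l ^ n \<in> jacobian_ideal f" using k1[of "k + int n" "s * l ^ n"] Suc.prems that(1) by (simp add: ac_simps)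
      then show ?case by (rule Suc.IH)
    qed simp
    then show ?thesis using that(3) unfolding Jl_def by blast
  qed
  obtain k2 where k2: "\<And>k p \<beta>. k \<ge> k2 \<Longrightarrow> p \<in> ?Z \<Longrightarrow>
    \<exists>g\<in>homog k. local_eq g p - \<beta> \<in> ?T p \<and> (\<forall>q\<in>?Z - {p}. local_eq g q \<in> ?T q)"
    using local_global_surjective by metis
  have "\<exists>B. finite B \<and> quot_basis (\<lambda>c. (*) (fps2_const c)) B UNIV (?T p)" if p: "p \<in> ?Z" for p
  proof -
    obtain B where B: "quot_basis (\<lambda>c. (*) (fps2_const c)) B UNIV (?T p)"
      using fps2.quot_basis_exists[OF subspace_tjurina, of "local_eq f p" UNIV] by auto
    obtain n where n: "fps2_u ^ n \<in> ?T p" "fps2_v ^ n \<in> ?T p" using tjurina_contains_power[OF p] by metis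
    obtain i0 i1 i2 where ch: "chart p i0 i1 i2" using proj_plane_chart sing_proj[OF p] by metis
    obtain S where "finite S" "UNIV \<subseteq> fps2.span (S \<union> ?T p)" using local_tjurina_finite_span[OF ch n] by metis
    then have "finite B" using fps2.quot_basis_finite[OF subspace_tjurina B] by blast
    then show ?thesis using B by blast
  qed
  then obtain B where B: "\<And>p. p \<in> ?Z \<Longrightarrow> finite (B p)" "\<And>p. p \<in> ?Z \<Longrightarrow> quot_basis (\<lambda>c. (*) (fps2_const c)) (B p) UNIV (?T p)"
    by metis
  note fam = fps2.quot_basis_family[OF subspace_tjurina B(2) B(1)]
  show ?thesis
  proof (rule that[of "max k1 k2"])
    fix k assume k: "max k1 k2 \<le> k"
    have "\<forall>x\<in>Sigma ?Z B. \<exists>g. g \<in> homog k \<and> local_eq g (fst x) - snd x \<in> ?T (fst x) \<and> (\<forall>q\<in>?Z - {fst x}. local_eq g q \<in> ?T q)"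
      using k2[of k] k by fastforce
    then obtain e where e: "\<And>x. x \<in> Sigma ?Z B \<Longrightarrow> e x \<in> homog k \<and> local_eq (e x) (fst x) - snd x \<in> ?T (fst x) \<and> (\<forall>q\<in>?Z - {fst x}. local_eq (e x) q \<in> ?T q)"
      by metis
    have fin: "finite (Sigma ?Z B)" using finite_sing_points B(1) by auto
    \<comment> \<open>At p only the summands e(p, b) survive modulo the Tjurina ideal.\<close>
    have loc: "local_eq (\<Sum>x\<in>Sigma ?Z B. scale3 (c x) (e x)) p - (\<Sum>b\<in>B p. fps2_const (c (p, b)) * b) \<in> ?T p" if p: "p \<in> ?Z" for c p
    proof -
      have pp: "p \<in> proj_plane" using p sing_proj by blast
      have "local_eq (\<Sum>x\<in>Sigma ?Z B. scale3 (c x) (e x)) p = (\<Sum>q\<in>?Z. \<Sum>b\<in>B q. fps2_const (c (q, b)) * local_eq (e (q, b)) p)"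
        using finite_sing_points B(1) by (simp add: local_eq_simps[OF pp] sum.Sigma split_def)
      also have "\<dots> = (\<Sum>q\<in>?Z - {p}. \<Sum>b\<in>B q. fps2_const (c (q, b)) * local_eq (e (q, b)) p)
         + (\<Sum>b\<in>B p. fps2_const (c (p, b)) * local_eq (e (p, b)) p)"
        using sum.remove[OF finite_sing_points p, of "\<lambda>q. \<Sum>b\<in>B q. fps2_const (c (q, b)) * local_eq (e (q, b)) p"] by (simp add: add.commute)
      finally have eq: "local_eq (\<Sum>x\<in>Sigma ?Z B. scale3 (c x) (e x)) p - (\<Sum>b\<in>B p. fps2_const (c (p, b)) * b) =
         (\<Sum>q\<in>?Z - {p}. \<Sum>b\<in>B q. fps2_const (c (q, b)) * local_eq (e (q, b)) p)
         + (\<Sum>b\<in>B p. fps2_const (c (p, b)) * (local_eq (e (p, b)) p - b))"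
        by (simp add: right_diff_distrib sum_subtractf)
      show ?thesis unfolding eq
      proof (intro tjurina_add tjurina_sum tjurina_mult)
        fix q b assume "q \<in> ?Z - {p}" "b \<in> B q"
        then show "local_eq (e (q, b)) p \<in> ?T p" using e[of "(q, b)"] p by auto
      next
        fix b assume "b \<in> B p"
        then show "local_eq (e (p, b)) p - b \<in> ?T p" using e[of "(p, b)"] p by auto
      qed
    qed
    have "milnor_dim f k = card (Sigma ?Z B)"
      unfolding milnor_dim_def
    proof (rule S.quot_dim_family[OF subspace_jacobian Int_lower2 fin, of e])
      fix x assume "x \<in> Sigma ?Z B"
      then show "e x \<in> homog k" using e by blast
    next
      fix g assume g: "g \<in> homog k"
      have "\<forall>p\<in>?Z. \<exists>c. local_eq g p - (\<Sum>b\<in>B p. fps2_const (c b) * b) \<in> ?T p" using fam(1) by blast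
      then obtain c where c: "\<And>p. p \<in> ?Z \<Longrightarrow> local_eq g p - (\<Sum>b\<in>B p. fps2_const (c p b) * b) \<in> ?T p" by metis
      define g' where "g' = g - (\<Sum>x\<in>Sigma ?Z B. scale3 (c (fst x) (snd x)) (e x))"
      have g'h: "g' \<in> homog k" unfolding g'_def scale3_def using e by (intro homog_diff g homog_sum homog_const_mult) blast
      have "local_eq g' p \<in> ?T p" if p: "p \<in> ?Z" for p
      proof -
        have "local_eq g' p = (local_eq g p - (\<Sum>b\<in>B p. fps2_const (c p b) * b))
          + - 1 * (local_eq (\<Sum>x\<in>Sigma ?Z B. scale3 (c (fst x) (snd x)) (e x)) p - (\<Sum>b\<in>B p. fps2_const (c p b) * b))"
          unfolding g'_def local_eq_simps(2)[OF sing_proj[OF p]] by simp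
        also have "\<dots> \<in> ?T p"
          using c[OF p] loc[OF p, of "\<lambda>x. c (fst x) (snd x)"] by (intro tjurina_add tjurina_mult) auto
        finally show ?thesis .
      qed
      then have "g' \<in> Jl" by (rule local_global_injective[OF g'h])
      then have "g' \<in> jacobian_ideal f" using Jl_J[OF _ g'h] k by simp
      then show "\<exists>c. g - (\<Sum>x\<in>Sigma ?Z B. scale3 (c x) (e x)) \<in> jacobian_ideal f \<inter> homog k"
        using g'h unfolding g'_def by (intro exI[of _ "\<lambda>x. c (fst x) (snd x)"]) simp
    next
      fix c x assume c: "(\<Sum>x\<in>Sigma ?Z B. scale3 (c x) (e x)) \<in> jacobian_ideal f \<inter> homog k" and x: "x \<in> Sigma ?Z B"
      obtain p b where pb: "x = (p, b)" "p \<in> ?Z" "b \<in> B p" using x by auto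
      have "local_eq (\<Sum>x\<in>Sigma ?Z B. scale3 (c x) (e x)) p \<in> ?T p" using jacobian_local[OF pb(2)] c by blast
      then have "local_eq (\<Sum>x\<in>Sigma ?Z B. scale3 (c x) (e x)) p
        + - 1 * (local_eq (\<Sum>x\<in>Sigma ?Z B. scale3 (c x) (e x)) p - (\<Sum>b\<in>B p. fps2_const (c (p, b)) * b)) \<in> ?T p"
        using loc[OF pb(2)] by (intro tjurina_add tjurina_mult)
      then have "(\<Sum>b\<in>B p. fps2_const (c (p, b)) * b) \<in> ?T p" by simp
      then show "c x = 0" using fam(2)[OF pb(2) pb(2), of "\<lambda>b. c (p, b)" b] pb by simp
    qed
    also have "\<dots> = (\<Sum>p\<in>?Z. card (B p))" using finite_sing_points B(1) by (simp add: card_SigmaI)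
    also have "\<dots> = total_tjurina f"
      unfolding total_tjurina_def local_tjurina_def
      using fps2.quot_dim_eq_card[OF subspace_tjurina B(2)] by (intro sum.cong) auto
    finally show "milnor_dim f k = total_tjurina f" .
  qed
qed

end

section \<open>Syzygies and freeness\<close>

lemma transversal_line_exists:
  assumes "f \<in> homog (int d)" "squarefree f" "d \<ge> 2"
  obtains \<alpha> \<gamma> a c where "transversal_line f d \<alpha> \<gamma> a c"
proof -
  have "d \<ge> 1" using assms(3) by simp
  from exists_transversal_line[OF assms(1,2) this] obtain \<alpha> \<gamma> a c where
    "eval3 f (\<alpha>, 1, \<gamma>) \<noteq> 0" "coprime (restrict_line a c \<alpha> \<gamma> f) (pderiv (restrict_line a c \<alpha> \<gamma> f))"
    by metis
  then have "transversal_line f d \<alpha> \<gamma> a c" using assms by unfold_locales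
  then show ?thesis by (rule that)
qed

text \<open>On the line of points (1, y, 0) either the restriction has a root, or it is constant and
  its coefficient at n, which is the value at (0, 1, 0), vanishes.\<close>

lemma homog_has_zero:
  assumes "q \<in> homog (int n)" "n \<ge> 1"
  obtains p where "p \<in> proj_plane" "eval3 q p = 0"
proof -
  define F where "F = restrict_line 1 0 0 0 q"
  have ev: "poly (restrict_line 1 0 0 0 q) y = eval3 q (1, y, 0)" for y q
  proof (induction q rule: poly3_induct)
    case (var i)
    show ?case using exhaust_3[of i] by (auto simp: id_map.line_poly_simps eval3_simps)
  qed (auto simp: id_map.line_poly_simps eval3_simps)
  show ?thesis
  proof (cases "degree F = 0")
    case True
    then have "coeff F n = 0" using assms(2) by (simp add: coeff_eq_0)
    then have "eval3 q (0, 1, 0) = 0" using id_map.line_poly_degree(2)[OF assms(1), of 1 0 0 0] by (simp add: F_def)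
    then show ?thesis using that[of "(0, 1, 0)"] by (simp add: proj_plane_def)
  next
    case False
    then have "\<not> constant (poly F)" by (simp add: constant_degree)
    then obtain y where "poly F y = 0" using fundamental_theorem_of_algebra by blast
    then have "eval3 q (1, y, 0) = 0" using ev by (simp add: F_def)
    then show ?thesis using that[of "(1, y, 0)"] by (simp add: proj_plane_def)
  qed
qed

text \<open>A multiple factor of positive degree has a zero in the plane, and there the curve is
  singular. This makes a transversal line available for the smooth curve as well.\<close>

lemma smooth_imp_squarefree:
  assumes f: "f \<in> homog (int d)" and smooth: "smooth_curve f"
  shows "squarefree f"
proof (rule squarefreeI)
  fix x assume "x ^ 2 dvd f"
  then obtain h where h: "f = x ^ 2 * h" by auto
  have "(0, 0, 1) \<notin> sing_points f" using smooth by (simp add: smooth_curve_def)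
  then have "f \<noteq> 0" by (auto simp: sing_points_def proj_plane_def eval3_simps)
  then have x0: "x \<noteq> 0" and h0: "h \<noteq> 0" using h by auto
  \<comment> \<open>The factors of a form are replaced by their top components, which gives f = X^2
    H with X and H homogeneous.\<close>
  define e where "e = top_deg x"
  define e' where "e' = top_deg h"
  define X where "X = hcomp e x"
  define H where "H = hcomp e' h"
  have X0: "X \<noteq> 0" and H0: "H \<noteq> 0" unfolding X_def H_def e_def e'_def using top_deg x0 h0 by blast+
  have tx: "hcomp k x = 0" if "k > e" for k using top_deg(2)[OF x0] that by (simp add: e_def)
  have th: "hcomp k h = 0" if "k > e'" for k using top_deg(2)[OF h0] that by (simp add: e'_def)
  have xx: "hcomp (e + e) (x * x) = X * X" unfolding X_def by (rule hcomp_mult_top(1)[OF tx tx])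
  have txx: "hcomp k (x * x) = 0" if "k > e + e" for k using hcomp_mult_top(2)[OF tx tx that] .
  have "hcomp (e + e + e') f = X * X * H"
    unfolding h power2_eq_square using hcomp_mult_top(1)[OF txx th] xx by (simp add: H_def)
  moreover from this have "e + e + e' = int d" using hcomp_of_homog[OF f, of "e + e + e'"] X0 H0 by (auto split: if_splits)
  ultimately have fX: "f = X * X * H" using hcomp_homog_id[OF f] by simp
  show "x dvd 1"
  proof (rule ccontr)
    assume "\<not> x dvd 1"
    then have "e > 0" using top_deg_le_0_imp_const[OF x0] by (fastforce simp: e_def)
    then have "X \<in> homog (int (nat e))" "nat e \<ge> 1" using hcomp_homog[of e x] by (simp_all add: X_def)
    then obtain p where p: "p \<in> proj_plane" "eval3 X p = 0" by (rule homog_has_zero)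
    have "eval3 f p = 0" "eval3 (pd i f) p = 0" for i
      unfolding fX using p(2) by (simp_all add: eval3_simps pd_mult)
    then have "p \<in> sing_points f" using p(1) by (simp add: sing_points_def)
    then show False using smooth by (simp add: smooth_curve_def)
  qed
qed

text \<open>There are no singular points, so \<tau> is an empty sum and
  \<open>ar_eq_0_of_stable_0\<close> applies.\<close>

lemma ar_smooth:
  assumes "f \<in> homog (int d)" "smooth_curve f" "d \<ge> 2" "j < int d - 1"
  shows "ar f j = 0"
proof -
  obtain \<alpha> \<gamma> a c where "transversal_line f d \<alpha> \<gamma> a c"
    using transversal_line_exists[OF assms(1) smooth_imp_squarefree[OF assms(1,2)] assms(3)] by metis
  then interpret transversal_line f d \<alpha> \<gamma> a c .
  obtain k0 where k0: "\<And>k. k \<ge> k0 \<Longrightarrow> milnor_dim f k = total_tjurina f" using milnor_dim_eventually_tjurina by metis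
  have "total_tjurina f = 0" using assms(2) by (simp add: total_tjurina_def smooth_curve_def)
  then have "milnor_dim f k = 0" if "k \<ge> k0" for k using k0[OF that] by simp
  moreover have "j < D" unfolding D_def by (rule assms(4))
  ultimately show ?thesis by (rule ar_eq_0_of_stable_0)
qed

section \<open>The graded pieces of AR(f)\<close>

lemma linear_smult3: "Vector_Spaces.linear scale3 (\<lambda>c. smult3 (const3 c)) (\<lambda>q. smult3 q t)"
  unfolding Vector_Spaces.linear_iff
  by (intro conjI allI S.vector_space_axioms S3C.vector_space_axioms)
    (auto simp: scale3_def smult3_def algebra_simps split: prod.splits)

lemma smult3_eq_0_iff: "smult3 q t = 0 \<longleftrightarrow> q = 0 \<or> t = 0"
  by (cases t) (auto simp: smult3_def zero_prod_def)

lemma smult3_homog: "q \<in> homog j \<Longrightarrow> t \<in> homog_triples k \<Longrightarrow> smult3 q t \<in> homog_triples (j + k)"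
  by (cases t) (auto simp: smult3_def homog_triples_def intro: homog_mult)

lemma subspace_AR: "S3.subspace (AR f)"
proof (rule S3.subspaceI)
  fix p x assume "x \<in> AR f"
  then obtain a b c where "x = (a, b, c)" "a * pd 0 f + b * pd 1 f + c * pd 2 f = 0" by (auto simp: AR_def)
  moreover have "p * a * pd 0 f + p * b * pd 1 f + p * c * pd 2 f = p * (a * pd 0 f + b * pd 1 f + c * pd 2 f)"
    by (simp add: algebra_simps)
  ultimately show "smult3 p x \<in> AR f" by (simp add: AR_def smult3_def)
next
  fix x y assume "x \<in> AR f" "y \<in> AR f"
  then obtain a b c a' b' c' where xy: "x = (a, b, c)" "a * pd 0 f + b * pd 1 f + c * pd 2 f = 0"
    "y = (a', b', c')" "a' * pd 0 f + b' * pd 1 f + c' * pd 2 f = 0" by (auto simp: AR_def)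
  have "(a + a') * pd 0 f + (b + b') * pd 1 f + (c + c') * pd 2 f =
    (a * pd 0 f + b * pd 1 f + c * pd 2 f) + (a' * pd 0 f + b' * pd 1 f + c' * pd 2 f)" by (simp add: algebra_simps)
  then show "x + y \<in> AR f" using xy by (simp add: AR_def)
qed (simp add: AR_def zero_prod_def)

lemma subspace_AR_homog: "S3C.subspace (AR f \<inter> homog_triples k)"
proof (rule S3C.subspace_inter[OF _ subspace_homog_triples])
  show "S3C.subspace (AR f)"
    using subspace_AR[of f] by (intro S3C.subspaceI) (auto intro: S3.subspace_0 S3.subspace_add S3.subspace_scale)
qed

lemma fin_dim_AR_homog: "fin_dim (\<lambda>c. smult3 (const3 c)) (AR f \<inter> homog_triples k)"
  by (rule S3C.fin_dim_subset[OF fin_dim_homog_triples]) auto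

lemma ar_eq_0_iff: "ar f k = 0 \<longleftrightarrow> AR f \<inter> homog_triples k = {0}"
proof
  assume "ar f k = 0"
  then have "{0} = AR f \<inter> homog_triples k"
    using subspace_AR_homog[of f k] unfolding ar_def
    by (intro S3C.subspace_eq_of_dim_ge[OF _ fin_dim_AR_homog]) (auto dest: S3C.subspace_0)
  then show "AR f \<inter> homog_triples k = {0}" by simp
qed (simp add: ar_def)

lemma ar_neg: "k < 0 \<Longrightarrow> ar f k = 0"
  unfolding ar_eq_0_iff using S3C.subspace_0[OF subspace_AR_homog, of f k]
  by (auto simp: homog_triples_def homog_neg zero_prod_def)

lemma ar_ge_of_syzygy:
  assumes t: "t \<in> AR f \<inter> homog_triples r" "t \<noteq> 0"
  shows "sdim (k - r) \<le> int (ar f k)"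
proof -
  interpret l: Vector_Spaces.linear scale3 "\<lambda>c. smult3 (const3 c)" "\<lambda>q. smult3 q t" by (rule linear_smult3)
  have "S3C.dim ((\<lambda>q. smult3 q t) ` homog (k - r)) = S.dim (homog (k - r))"
    by (rule l.dim_image_inj[OF subspace_homog fin_dim_homog]) (use t(2) in \<open>simp add: smult3_eq_0_iff\<close>)
  moreover have sub: "(\<lambda>q. smult3 q t) ` homog (k - r) \<subseteq> AR f \<inter> homog_triples k"
  proof (rule image_subsetI, rule IntI)
    fix q assume "q \<in> homog (k - r)"
    then show "smult3 q t \<in> homog_triples k" using smult3_homog[of q "k - r" t r] t(1) by simp
    show "smult3 q t \<in> AR f" using S3.subspace_scale[OF subspace_AR] t(1) by blast
  qed
  ultimately show ?thesis using S3C.dim_mono_finite[OF fin_dim_AR_homog sub] unfolding ar_def by linarith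
qed

text \<open>The gradient is orthogonal to both syzygies, so it is parallel to their cross product;
  the computation is the expansion of a triple cross product.\<close>

lemma cross_identity:
  fixes f0 f1 f2 :: "'a::comm_ring_1"
  assumes "s0 * f0 + s1 * f1 + s2 * f2 = 0" "r0 * f0 + r1 * f1 + r2 * f2 = 0"
  shows "(s1 * r2 - s2 * r1) * f1 = (s2 * r0 - s0 * r2) * f0"
    and "(s2 * r0 - s0 * r2) * f2 = (s0 * r1 - s1 * r0) * f1"
    and "(s0 * r1 - s1 * r0) * f0 = (s1 * r2 - s2 * r1) * f2"
proof -
  have "(s1 * r2 - s2 * r1) * f1 - (s2 * r0 - s0 * r2) * f0 =
    r2 * (s0 * f0 + s1 * f1 + s2 * f2) - s2 * (r0 * f0 + r1 * f1 + r2 * f2)" by (simp add: algebra_simps)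
  then show "(s1 * r2 - s2 * r1) * f1 = (s2 * r0 - s0 * r2) * f0" using assms by simp
  have "(s2 * r0 - s0 * r2) * f2 - (s0 * r1 - s1 * r0) * f1 =
    r0 * (s0 * f0 + s1 * f1 + s2 * f2) - s0 * (r0 * f0 + r1 * f1 + r2 * f2)" by (simp add: algebra_simps)
  then show "(s2 * r0 - s0 * r2) * f2 = (s0 * r1 - s1 * r0) * f1" using assms by simp
  have "(s0 * r1 - s1 * r0) * f0 - (s1 * r2 - s2 * r1) * f2 =
    r1 * (s0 * f0 + s1 * f1 + s2 * f2) - s1 * (r0 * f0 + r1 * f1 + r2 * f2)" by (simp add: algebra_simps)
  then show "(s0 * r1 - s1 * r0) * f0 = (s1 * r2 - s2 * r1) * f2" using assms by simp
qed

text \<open>A syzygy of minimal degree has coprime components, so it generates all syzygies parallel to it.\<close>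

lemma parallel_to_minimal_syzygy:
  assumes a: "(a0, a1, a2) \<in> AR f \<inter> homog_triples r" "(a0, a1, a2) \<noteq> 0"
    and min: "\<And>j. j < r \<Longrightarrow> AR f \<inter> homog_triples j = {0}"
    and s: "(s0, s1, s2) \<in> homog_triples k"
    and par: "s1 * a2 = s2 * a1" "s2 * a0 = s0 * a2" "s0 * a1 = s1 * a0"
  shows "\<exists>q\<in>homog (k - r). (s0, s1, s2) = smult3 q (a0, a1, a2)"
proof -
  let ?\<psi> = "nested 0 0"
  define A where "A i = coord i (a0, a1, a2)" for i
  define s' where "s' i = coord i (s0, s1, s2)" for i
  have Ah: "A i \<in> homog r" for i using a(1) exhaust_3[of i] by (auto simp: A_def homog_triples_def)
  have sh: "s' i \<in> homog k" for i using s exhaust_3[of i] by (auto simp: s'_def homog_triples_def)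
  have p: "s' i * A j = s' j * A i" for i j
    using exhaust_3[of i] exhaust_3[of j] par by (auto simp: A_def s'_def mult.commute)
  \<comment> \<open>Greatest common divisors are formed in the iterated polynomial ring and pulled
    back to S, here as \<delta>.\<close>
  define G where "G = gcd (?\<psi> (A 0)) (gcd (?\<psi> (A 1)) (?\<psi> (A 2)))"
  have Gd: "G dvd ?\<psi> (A i)" for i using exhaust_3[of i] by (auto simp: G_def intro: dvd_trans[OF gcd_dvd2])
  obtain \<delta> where \<delta>: "?\<psi> \<delta> = G" using surj_nested by blast
  have "\<delta> dvd A i" for i using Gd[of i] unfolding \<delta>[symmetric] nested_dvd_iff .
  then have "\<forall>i. \<exists>b. A i = \<delta> * b" by auto
  then obtain b where b: "\<And>i. A i = \<delta> * b i" by metis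
  have ex: "\<exists>i. A i \<noteq> 0" using a(2) by (auto simp: A_def zero_prod_def intro: exI[of _ 0] exI[of _ 1] exI[of _ 2])
  then have \<delta>0: "\<delta> \<noteq> 0" using b by auto
  \<comment> \<open>\<delta> is not known to be homogeneous; comparing top components replaces it by
    a form that divides all \<open>A i\<close>.\<close>
  define e where "e = top_deg \<delta>"
  have te: "hcomp j \<delta> = 0" if "j > e" for j using top_deg(2)[OF \<delta>0] that by (simp add: e_def)
  have te0: "hcomp e \<delta> \<noteq> 0" using top_deg(1)[OF \<delta>0] by (simp add: e_def)
  have tb: "hcomp j (b i) = 0" if j: "j > r - e" for i j
  proof (cases "b i = 0")
    case False
    have "hcomp (e + top_deg (b i)) (A i) = hcomp e \<delta> * hcomp (top_deg (b i)) (b i)"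
      unfolding b using top_deg(2)[OF False] by (intro hcomp_mult_top(1)[OF te])
    then have "hcomp (e + top_deg (b i)) (A i) \<noteq> 0" using te0 top_deg(1)[OF False] by simp
    then have "e + top_deg (b i) = r" using hcomp_of_homog[OF Ah] by (auto split: if_splits)
    then show ?thesis using top_deg(2)[OF False] j by simp
  qed simp
  define B where "B i = hcomp (r - e) (b i)" for i
  have AB: "A i = hcomp e \<delta> * B i" for i
  proof -
    have "hcomp (e + (r - e)) (A i) = hcomp e \<delta> * B i" unfolding b B_def by (rule hcomp_mult_top(1)[OF te tb])
    then show ?thesis using hcomp_homog_id[OF Ah] by simp
  qed
  have "A 0 * pd 0 f + A 1 * pd 1 f + A 2 * pd 2 f = 0" using a(1) by (simp add: A_def AR_def)
  then have "hcomp e \<delta> * (B 0 * pd 0 f + B 1 * pd 1 f + B 2 * pd 2 f) = 0" unfolding AB by (simp add: algebra_simps)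
  then have "(B 0, B 1, B 2) \<in> AR f \<inter> homog_triples (r - e)"
    using te0 by (simp add: AR_def homog_triples_def B_def hcomp_homog)
  moreover have "(B 0, B 1, B 2) \<noteq> 0"
  proof
    assume "(B 0, B 1, B 2) = 0"
    then have "B i = 0" for i using exhaust_3[of i] by (auto simp: zero_prod_def)
    then show False using ex AB by auto
  qed
  \<comment> \<open>The quotients form a nonzero syzygy of degree r - e, so minimality leaves only e
    \<le> 0, and \<delta> is a constant.\<close>
  ultimately have "\<not> r - e < r" using min[of "r - e"] by auto
  then have "\<delta> dvd 1" using top_deg_le_0_imp_const[OF \<delta>0] by (simp add: e_def)
  then have G1: "G dvd 1" using nested_dvd_iff[of 0 0 \<delta> 1] \<delta> by (simp add: nested_simps)
  obtain j where j: "A j \<noteq> 0" using ex by blast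
  have "?\<psi> (A j) dvd ?\<psi> (s' j) * ?\<psi> (A i)" for i
    using p[of i j] by (metis dvd_triv_right nested_simps(4))
  moreover have "x dvd y * gcd z w" if "x dvd y * z" "x dvd y * w" for x y z w :: "complex poly poly poly"
    using gcd_greatest[OF that] by (simp add: gcd_mult_left)
  ultimately have "?\<psi> (A j) dvd ?\<psi> (s' j) * G" unfolding G_def by blast
  then have "?\<psi> (A j) dvd ?\<psi> (s' j)" using G1 by (simp add: dvd_mult_unit_iff)
  then have "A j dvd s' j" by (simp add: nested_dvd_iff)
  then obtain q where q: "s' j = q * A j" by (metis dvd_def mult.commute)
  have sq: "s' i = q * A i" for i
  proof -
    have "(s' i - q * A i) * A j = 0" using p[of i j] unfolding q by (simp add: algebra_simps)
    then show ?thesis using j by simp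
  qed
  have "q \<in> homog (k - r)" using homog_cancel[of q "A j" "k - r" r] sh[of j] Ah[of j] j q by simp
  moreover have "(s0, s1, s2) = smult3 q (a0, a1, a2)"
    using sq[of 0] sq[of 1] sq[of 2] by (simp add: smult3_def A_def s'_def)
  ultimately show ?thesis by blast
qed

lemma hcomp_AR:
  assumes f: "f \<in> homog (int d)" and s: "(s0, s1, s2) \<in> AR f"
  shows "(hcomp k s0, hcomp k s1, hcomp k s2) \<in> AR f \<inter> homog_triples k"
proof -
  have "hcomp (k + (int d - 1)) (s0 * pd 0 f + s1 * pd 1 f + s2 * pd 2 f) = 0" using s by (simp add: AR_def)
  then show ?thesis
    by (simp add: hcomp_add hcomp_mult_homog[OF homog_pd[OF f]] AR_def homog_triples_def hcomp_homog)
qed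

context transversal_line
begin

lemma exists_pd_neq_0: "\<exists>i. pd i f \<noteq> 0"
proof (rule ccontr)
  assume "\<not> ?thesis"
  then have "pd i f = 0" for i by blast
  then show False using g2_neq_0 unfolding g2_def by simp
qed

text \<open>For j + k = D the factor h has degree 0, which is the situation of Saito's
  criterion.\<close>

lemma cross_gradient:
  assumes s: "(s0, s1, s2) \<in> AR f \<inter> homog_triples j" and r: "(r0, r1, r2) \<in> AR f \<inter> homog_triples k"
  obtains h where "h \<in> homog (j + k - D)" "s1 * r2 - s2 * r1 = h * pd 0 f" "s2 * r0 - s0 * r2 = h * pd 1 f" "s0 * r1 - s1 * r0 = h * pd 2 f"
proof -
  define v where "v i = coord i (s1 * r2 - s2 * r1, s2 * r0 - s0 * r2, s0 * r1 - s1 * r0)" for i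
  have sr: "s0 * pd 0 f + s1 * pd 1 f + s2 * pd 2 f = 0" "r0 * pd 0 f + r1 * pd 1 f + r2 * pd 2 f = 0"
    using s r by (auto simp: AR_def)
  have v: "v i \<in> homog (j + k)" for i
    using s r exhaust_3[of i] by (auto simp: v_def homog_triples_def intro!: homog_diff homog_mult)
  have par: "v i * pd m f = v m * pd i f" for i m
    using exhaust_3[of i] exhaust_3[of m] cross_identity[OF sr] by (auto simp: v_def)
  obtain h where "h \<in> homog (j + k - D)" "\<And>i. v i = h * pd i f" using parallel_to_gradient[OF v v v par] by blast
  then show ?thesis using that[of h] by (metis coord_simps v_def)
qed

text \<open>Saito's criterion.\<close>

lemma free_of_cross:
  assumes s: "(s0, s1, s2) \<in> AR f \<inter> homog_triples j" and r: "(r0, r1, r2) \<in> AR f \<inter> homog_triples k"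
    and t: "t \<noteq> 0" "s1 * r2 - s2 * r1 = const3 t * pd 0 f" "s2 * r0 - s0 * r2 = const3 t * pd 1 f" "s0 * r1 - s1 * r0 = const3 t * pd 2 f"
  shows "free_curve f"
proof -
  let ?s = "(s0, s1, s2)" and ?r = "(r0, r1, r2)"
  have t0: "const3 t \<noteq> 0" using t(1) by simp
  have ind: "p = 0 \<and> q = 0" if pq: "smult3 p ?s + smult3 q ?r = 0" for p q
  proof -
    have e: "p * s0 + q * r0 = 0" "p * s1 + q * r1 = 0" "p * s2 + q * r2 = 0" using pq by (simp_all add: smult3_def zero_prod_def)
    have "p * (s1 * r2 - s2 * r1) = r2 * (p * s1 + q * r1) - r1 * (p * s2 + q * r2)" "p * (s2 * r0 - s0 * r2) = r0 * (p * s2 + q * r2) - r2 * (p * s0 + q * r0)"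
      "p * (s0 * r1 - s1 * r0) = r1 * (p * s0 + q * r0) - r0 * (p * s1 + q * r1)" 
      "q * (s1 * r2 - s2 * r1) = s1 * (p * s2 + q * r2) - s2 * (p * s1 + q * r1)" "q * (s2 * r0 - s0 * r2) = s2 * (p * s0 + q * r0) - s0 * (p * s2 + q * r2)"
      "q * (s0 * r1 - s1 * r0) = s0 * (p * s1 + q * r1) - s1 * (p * s0 + q * r0)" by (simp_all add: algebra_simps)
    then have z: "p * (const3 t * pd 0 f) = 0" "p * (const3 t * pd 1 f) = 0" "p * (const3 t * pd 2 f) = 0"
      "q * (const3 t * pd 0 f) = 0" "q * (const3 t * pd 1 f) = 0" "q * (const3 t * pd 2 f) = 0"
      unfolding t(2-4) e by simp_all
    obtain i where "pd i f \<noteq> 0" using exists_pd_neq_0 by blast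
    then show ?thesis using z t0 exhaust_3[of i] by auto
  qed
  have ne: "?s \<noteq> ?r"
  proof
    assume "?s = ?r"
    then have "smult3 1 ?s + smult3 (- 1) ?r = 0" by (simp add: smult3_def zero_prod_def)
    from ind[OF this] show False by simp
  qed
  have "S3.independent {?s, ?r}"
    unfolding S3.independent_explicit_module
  proof (intro allI impI)
    fix T u v assume T: "finite T" "T \<subseteq> {?s, ?r}" "(\<Sum>v\<in>T. smult3 (u v) v) = 0" "v \<in> T"
    define u' where "u' v = (if v \<in> T then u v else 0)" for v
    have "(\<Sum>v\<in>{?s, ?r}. smult3 (u' v) v) = (\<Sum>v\<in>T. smult3 (u v) v)"
      using T(2) by (intro sum.mono_neutral_cong_right) (auto simp: u'_def)
    then have "smult3 (u' ?s) ?s + smult3 (u' ?r) ?r = 0" using T(3) ne by simp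
    from ind[OF this] have "u' ?s = 0" "u' ?r = 0" by simp_all
    then show "u v = 0" using T(2,4) by (auto simp: u'_def split: if_splits)
  qed
  moreover have "S3.span {?s, ?r} = AR f"
  proof
    show "S3.span {?s, ?r} \<subseteq> AR f" by (rule S3.span_minimal[OF _ subspace_AR]) (use s r in auto)
    have homog_case: "x \<in> S3.span {?s, ?r}" if x: "x \<in> AR f \<inter> homog_triples m" for x m
    proof -
      obtain x0 x1 x2 where x012: "x = (x0, x1, x2)" by (cases x)
      note x' = x[unfolded x012]
      obtain h where h: "s1 * x2 - s2 * x1 = h * pd 0 f" "s2 * x0 - s0 * x2 = h * pd 1 f" "s0 * x1 - s1 * x0 = h * pd 2 f"
        using cross_gradient[OF s x'] by metis
      obtain h' where h': "x1 * r2 - x2 * r1 = h' * pd 0 f" "x2 * r0 - x0 * r2 = h' * pd 1 f" "x0 * r1 - x1 * r0 = h' * pd 2 f"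
        using cross_gradient[OF x' r] by metis
      \<comment> \<open>Cramer's rule suggests t x = h' s + h r, and \<delta> is the error. Each
        entry is annihilated by the other two partial derivatives and \<delta> is a syzygy, so one
        nonzero partial derivative forces \<delta> = 0.\<close>
      define \<delta> where "\<delta> i = coord i (const3 t * x0 - h' * s0 - h * r0, const3 t * x1 - h' * s1 - h * r1, const3 t * x2 - h' * s2 - h * r2)" for i
      have "x0 * (s2 * r0 - s0 * r2) - s0 * (x2 * r0 - x0 * r2) - r0 * (s2 * x0 - s0 * x2) = 0"
        "x0 * (s0 * r1 - s1 * r0) - s0 * (x0 * r1 - x1 * r0) - r0 * (s0 * x1 - s1 * x0) = 0"
        "x1 * (s1 * r2 - s2 * r1) - s1 * (x1 * r2 - x2 * r1) - r1 * (s1 * x2 - s2 * x1) = 0"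
        "x1 * (s0 * r1 - s1 * r0) - s1 * (x0 * r1 - x1 * r0) - r1 * (s0 * x1 - s1 * x0) = 0"
        "x2 * (s1 * r2 - s2 * r1) - s2 * (x1 * r2 - x2 * r1) - r2 * (s1 * x2 - s2 * x1) = 0"
        "x2 * (s2 * r0 - s0 * r2) - s2 * (x2 * r0 - x0 * r2) - r2 * (s2 * x0 - s0 * x2) = 0"
        by (simp_all add: algebra_simps)
      then have z: "\<delta> 0 * pd 1 f = 0" "\<delta> 0 * pd 2 f = 0" "\<delta> 1 * pd 0 f = 0" "\<delta> 1 * pd 2 f = 0" "\<delta> 2 * pd 0 f = 0" "\<delta> 2 * pd 1 f = 0"
        unfolding h h' t(2-4) \<delta>_def coord_simps by (simp_all only: algebra_simps)
      have "\<delta> 0 * pd 0 f + \<delta> 1 * pd 1 f + \<delta> 2 * pd 2 f = const3 t * (x0 * pd 0 f + x1 * pd 1 f + x2 * pd 2 f)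
        - h' * (s0 * pd 0 f + s1 * pd 1 f + s2 * pd 2 f) - h * (r0 * pd 0 f + r1 * pd 1 f + r2 * pd 2 f)"
        unfolding \<delta>_def coord_simps by (simp add: algebra_simps)
      also have "\<dots> = 0" using s r x' by (simp add: AR_def)
      finally have zs: "\<delta> 0 * pd 0 f + \<delta> 1 * pd 1 f + \<delta> 2 * pd 2 f = 0" .
      obtain i where "pd i f \<noteq> 0" using exists_pd_neq_0 by blast
      then have "\<delta> 0 = 0" "\<delta> 1 = 0" "\<delta> 2 = 0" using z zs exhaust_3[of i] by auto
      then have tx: "const3 t * x0 = h' * s0 + h * r0" "const3 t * x1 = h' * s1 + h * r1" "const3 t * x2 = h' * s2 + h * r2"
        unfolding \<delta>_def coord_simps by (simp_all add: algebra_simps)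
      have "x = smult3 (const3 (inverse t)) (smult3 h' ?s + smult3 h ?r)"
        unfolding x012 using const3_inverse[OF t(1)] by (simp add: smult3_def tx[symmetric] flip: mult.assoc)
      also have "\<dots> \<in> S3.span {?s, ?r}"
        by (intro S3.span_scale S3.span_add) (auto intro: S3.span_base)
      finally show ?thesis .
    qed
    show "AR f \<subseteq> S3.span {?s, ?r}"
    proof
      fix x assume x: "x \<in> AR f"
      obtain x0 x1 x2 where x012: "x = (x0, x1, x2)" by (cases x)
      define K where "K = (\<lambda>m. int (mono_deg m)) ` (Poly_Mapping.keys x0 \<union> Poly_Mapping.keys x1 \<union> Poly_Mapping.keys x2)"
      have K: "finite K" by (simp add: K_def)
      have "x0 = (\<Sum>m\<in>K. hcomp m x0)" "x1 = (\<Sum>m\<in>K. hcomp m x1)" "x2 = (\<Sum>m\<in>K. hcomp m x2)"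
        by (rule poly3_eq_sum_hcomp[OF K]; auto simp: K_def)+
      moreover have "(\<Sum>m\<in>K. (hcomp m x0, hcomp m x1, hcomp m x2)) = (\<Sum>m\<in>K. hcomp m x0, \<Sum>m\<in>K. hcomp m x1, \<Sum>m\<in>K. hcomp m x2)"
        by (induction K rule: infinite_finite_induct) (auto simp: zero_prod_def)
      ultimately have "x = (\<Sum>m\<in>K. (hcomp m x0, hcomp m x1, hcomp m x2))" by (simp add: x012)
      also have "\<dots> \<in> S3.span {?s, ?r}"
        using homog_case[OF hcomp_AR[OF f_homog]] x by (intro S3.span_sum) (simp add: x012)
      finally show "x \<in> S3.span {?s, ?r}" .
    qed
  qed
  ultimately show ?thesis
    unfolding free_curve_def graded_free_def using ne s r by (intro exI[of _ "{?s, ?r}"]) auto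
qed

end

section \<open>Numerical characterizations of freeness\<close>

text \<open>The value at \<open>k\<close> of the Hilbert polynomial of \<open>S\<close>, doubled.\<close>

abbreviation hpoly :: "int \<Rightarrow> int" where
  "hpoly k \<equiv> (k + 1) * (k + 2)"

text \<open>The Euler characteristic of the line bundle of degree k on the plane: its middle
  cohomology is zero, and its top cohomology is dual to the forms of degree - 3 - k. The formula
  removes case distinctions on the sign of k.\<close>

lemma sdim_reflect: "2 * (sdim k + sdim (- 3 - k)) = hpoly k"
proof (cases "k < 0")
  case True
  then show ?thesis using sdim_neg[of k] sdim_double[of "- 3 - k"] sdim_double[of k] sdim_neg[of "- 3 - k"]
    by (cases "k \<ge> - 2") (auto simp: algebra_simps)
next
  case False
  then show ?thesis using sdim_neg[of "- 3 - k"] sdim_double[of k] by simp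
qed

text \<open>For a free curve with exponents r and D - r this is the equality of (ii) in degree j,
  with \<open>sdim\<close> replaced by the Hilbert polynomial. Being an identity in r, it also
  serves curves not yet known to be free.\<close>

lemma hpoly_identity:
  "2 * (D ^ 2 - r * (D - r)) - hpoly (2 * D - 3 - j) + 3 * hpoly (D - 3 - j) = hpoly (j - r) + hpoly (j - (D - r))"
  for D r j :: int
  by (simp add: power2_eq_square algebra_simps)

text \<open>A homogeneous basis splits AR(f) into two shifted copies of S; taking components of the
  coefficients gives the splitting in each degree.\<close>

lemma free_curve_ar:
  assumes "free_curve f"
  obtains d1 d2 where "0 \<le> d1" "d1 \<le> d2" "\<And>k. int (ar f k) = sdim (k - d1) + sdim (k - d2)"
proof -
  obtain B where B: "finite B" "card B = 2" "\<forall>b\<in>B. \<exists>k. b \<in> homog_triples k" "S3.independent B" "S3.span B = AR f"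
    using assms unfolding free_curve_def graded_free_def by blast
  obtain s r where sr: "B = {s, r}" "s \<noteq> r" using B(2) by (metis card_2_iff)
  obtain d1 d2 where h: "s \<in> homog_triples d1" "r \<in> homog_triples d2" using B(3) sr(1) by blast
  have indep: "p = 0 \<and> q = 0" if pq: "smult3 p s + smult3 q r = 0" for p q
  proof -
    define u where "u v = (if v = s then p else q)" for v
    have e: "(\<Sum>v\<in>B. smult3 (u v) v) = 0" using pq sr by (simp add: u_def)
    have "u s = 0" by (rule S3.independentD[OF B(4,1) order_refl e]) (simp add: sr)
    moreover have "u r = 0" by (rule S3.independentD[OF B(4,1) order_refl e]) (simp add: sr)
    ultimately show ?thesis using sr(2) by (simp add: u_def)
  qed
  have s0: "s \<noteq> 0" and r0: "r \<noteq> 0" using indep[of 1 0] indep[of 0 1] by (auto simp: smult3_eq_0_iff)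
  have nonneg: "0 \<le> k" if "t \<in> homog_triples k" "t \<noteq> 0" for t k
    using that homog_neg[of k] by (cases "k < 0") (auto simp: homog_triples_def zero_prod_def)
  have inAR: "s \<in> AR f" "r \<in> AR f" using B(5) sr(1) S3.span_base by blast+
  have ar: "int (ar f k) = sdim (k - d1) + sdim (k - d2)" for k
  proof -
    interpret ls: Vector_Spaces.linear scale3 "\<lambda>c. smult3 (const3 c)" "\<lambda>q. smult3 q s" by (rule linear_smult3)
    interpret lr: Vector_Spaces.linear scale3 "\<lambda>c. smult3 (const3 c)" "\<lambda>q. smult3 q r" by (rule linear_smult3)
    let ?W = "(\<lambda>q. smult3 q r) ` homog (k - d2)"
    have W: "S3C.subspace ?W" by (rule lr.subspace_image[OF subspace_homog])
    have Wf: "fin_dim (\<lambda>c. smult3 (const3 c)) ?W" by (rule lr.fin_dim_image[OF fin_dim_homog])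
    have dW: "S3C.dim ?W = S.dim (homog (k - d2))"
      by (rule lr.dim_image_inj[OF subspace_homog fin_dim_homog]) (use r0 in \<open>simp add: smult3_eq_0_iff\<close>)
    have ker: "{q \<in> homog (k - d1). smult3 q s \<in> ?W} = {0}"
    proof (intro equalityI subsetI)
      fix q assume "q \<in> {q \<in> homog (k - d1). smult3 q s \<in> ?W}"
      then obtain p where "smult3 q s = smult3 p r" by auto
      then have "smult3 q s + smult3 (- p) r = 0" by (simp add: S3.scale_minus_left)
      from indep[OF this] show "q \<in> {0}" by simp
    next
      fix q :: poly3 assume "q \<in> {0}"
      moreover have "smult3 0 s \<in> ?W" using homog_zero by (intro image_eqI[of _ _ 0]) simp_all
      ultimately show "q \<in> {q \<in> homog (k - d1). smult3 q s \<in> ?W}" by simp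
    qed
    have eq: "AR f \<inter> homog_triples k = {smult3 q s + w | q w. q \<in> homog (k - d1) \<and> w \<in> ?W}"
    proof (intro equalityI subsetI)
      fix x assume x: "x \<in> AR f \<inter> homog_triples k"
      have "x \<in> S3.span {s, r}" using x B(5) sr(1) by simp
      then obtain p q where pq: "x = smult3 p s + smult3 q r"
        unfolding S3.span_insert S3.span_empty by (auto simp: algebra_simps)
      obtain s0 s1 s2 r0 r1 r2 where c: "s = (s0, s1, s2)" "r = (r0, r1, r2)" by (cases s, cases r) auto
      have sh: "s0 \<in> homog d1" "s1 \<in> homog d1" "s2 \<in> homog d1" "r0 \<in> homog d2" "r1 \<in> homog d2" "r2 \<in> homog d2"
        using h by (auto simp: c homog_triples_def)
      have xe: "x = (p * s0 + q * r0, p * s1 + q * r1, p * s2 + q * r2)" by (simp add: pq c smult3_def)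
      then have "p * s0 + q * r0 \<in> homog k" "p * s1 + q * r1 \<in> homog k" "p * s2 + q * r2 \<in> homog k"
        using x by (auto simp: homog_triples_def)
      then have "x = (hcomp k (p * s0 + q * r0), hcomp k (p * s1 + q * r1), hcomp k (p * s2 + q * r2))"
        unfolding xe by (simp add: hcomp_homog_id)
      also have "\<dots> = smult3 (hcomp (k - d1) p) s + smult3 (hcomp (k - d2) q) r"
        by (simp add: c smult3_def hcomp_add hcomp_mult_homog[OF sh(1)] hcomp_mult_homog[OF sh(2)] hcomp_mult_homog[OF sh(3)]
          hcomp_mult_homog[OF sh(4)] hcomp_mult_homog[OF sh(5)] hcomp_mult_homog[OF sh(6)])
      finally show "x \<in> {smult3 q s + w | q w. q \<in> homog (k - d1) \<and> w \<in> ?W}" using hcomp_homog by blast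
    next
      fix x assume "x \<in> {smult3 q s + w | q w. q \<in> homog (k - d1) \<and> w \<in> ?W}"
      then obtain q p where qp: "q \<in> homog (k - d1)" "p \<in> homog (k - d2)" "x = smult3 q s + smult3 p r" by auto
      have "smult3 q s \<in> homog_triples k" "smult3 p r \<in> homog_triples k"
        using smult3_homog[OF qp(1) h(1)] smult3_homog[OF qp(2) h(2)] by simp_all
      then have "x \<in> homog_triples k" unfolding qp(3) by (rule S3C.subspace_add[OF subspace_homog_triples])
      moreover have "x \<in> AR f" unfolding qp(3) by (intro S3.subspace_add[OF subspace_AR] S3.subspace_scale[OF subspace_AR] inAR)
      ultimately show "x \<in> AR f \<inter> homog_triples k" by blast
    qed
    show ?thesis
      using ls.dim_image_plus[OF subspace_homog fin_dim_homog W Wf, of "k - d1"] unfolding ker eq[symmetric] dW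
      by (simp add: ar_def)
  qed
  have "0 \<le> d1" "0 \<le> d2" using nonneg h s0 r0 by blast+
  then show ?thesis
    using that[of d1 d2] that[of d2 d1] ar by (cases "d1 \<le> d2") (auto simp: add.commute)
qed

context transversal_line
begin

text \<open>For large k the value m(f)_k is a polynomial in k that equals the constant \<tau>: its
  linear coefficient gives d1 + d2 = D, its constant one \<tau>.\<close>

lemma free_curve_exponents:
  assumes "free_curve f"
  obtains d1 d2 where "0 \<le> d1" "d1 \<le> d2" "d1 + d2 = D" "\<And>k. int (ar f k) = sdim (k - d1) + sdim (k - d2)"
    "int (total_tjurina f) = D ^ 2 - d1 * (D - d1)"
proof -
  obtain d1 d2 where d: "0 \<le> d1" "d1 \<le> d2" "\<And>k. int (ar f k) = sdim (k - d1) + sdim (k - d2)"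
    using free_curve_ar[OF assms] by metis
  obtain k0 where k0: "\<And>k. k \<ge> k0 \<Longrightarrow> milnor_dim f k = total_tjurina f" using milnor_dim_eventually_tjurina by metis
  let ?\<tau> = "int (total_tjurina f)"
  define n where "n = max k0 (D + d1 + d2)"
  have \<tau>: "2 * ?\<tau> = hpoly k - 3 * hpoly (k - D) + hpoly (k - D - d1) + hpoly (k - D - d2)" if k: "k \<ge> n" for k
  proof -
    have "?\<tau> = sdim k - 3 * sdim (k - D) + (sdim (k - D - d1) + sdim (k - D - d2))"
      using k0[of k] k milnor_dim_eq[OF f_homog, of k, folded D_def] d(3)[of "k - D"] by (simp add: n_def)
    then show ?thesis
      using sdim_double[of k] sdim_double[of "k - D"] sdim_double[of "k - D - d1"] sdim_double[of "k - D - d2"] k d D_ge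
      by (simp add: n_def)
  qed
  \<comment> \<open>The quadratic terms cancel, so two consecutive degrees determine the linear
    coefficient.\<close>
  have sum: "d1 + d2 = D"
    using \<tau>[of n] \<tau>[of "n + 1"] by (simp add: algebra_simps)
  then have d2: "d2 = D - d1" by simp
  have "?\<tau> = D ^ 2 - d1 * (D - d1)"
    using \<tau>[of n] unfolding d2 by (simp add: power2_eq_square algebra_simps)
  then show ?thesis using that[of d1 d2] d sum by blast
qed

text \<open>Since d1 + d2 = D, the degrees j - d1 and D - 3 - j - d2 are exchanged by k -> - 3 - k,
  so the terms of both values of ar(f) pair up under \<open>sdim_reflect\<close>, and
  \<open>hpoly_identity\<close> applies.\<close>

lemma milnor_ar_of_exponents:
  assumes d: "d1 + d2 = D" and ar: "\<And>k. int (ar f k) = sdim (k - d1) + sdim (k - d2)"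
    and \<tau>: "\<tau> = D ^ 2 - d1 * (D - d1)" and j: "j \<le> D - 1"
  shows "int (milnor_dim f (2 * D - 3 - j)) + int (ar f j) = \<tau>"
proof -
  have d2: "d2 = D - d1" using d by simp
  have "int (milnor_dim f (2 * D - 3 - j)) = sdim (2 * D - 3 - j) - 3 * sdim (D - 3 - j) + int (ar f (D - 3 - j))"
    using milnor_dim_eq[OF f_homog, of "2 * D - 3 - j", folded D_def] by (simp add: algebra_simps)
  moreover have "int (ar f (D - 3 - j)) = sdim (- 3 - (j - d2)) + sdim (- 3 - (j - d1))"
  proof -
    have e: "D - 3 - j - d1 = - 3 - (j - d2)" "D - 3 - j - d2 = - 3 - (j - d1)" using d by simp_all
    show ?thesis using ar[of "D - 3 - j"] unfolding e .
  qed
  ultimately have "2 * (int (milnor_dim f (2 * D - 3 - j)) + int (ar f j)) =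
      2 * sdim (2 * D - 3 - j) - 3 * (2 * sdim (D - 3 - j)) + 2 * (sdim (j - d1) + sdim (- 3 - (j - d1))) + 2 * (sdim (j - d2) + sdim (- 3 - (j - d2)))"
    using ar[of j] by simp
  \<comment> \<open>Here j \<le> D - 1 enters, in the form D - 3 - j \<ge> - 2.\<close>
  also have "\<dots> = hpoly (2 * D - 3 - j) - 3 * hpoly (D - 3 - j) + hpoly (j - d1) + hpoly (j - d2)"
    unfolding sdim_reflect using j D_ge by (simp only: sdim_double)
  also have "\<dots> = 2 * \<tau>" using hpoly_identity[of D d1 j] unfolding \<tau> d2 by simp
  finally show ?thesis by simp
qed

text \<open>A lower bound for the Tjurina number in terms of the minimal degree \<open>r\<close> of a syzygy makes the
  syzygies of degree \<open>D - r\<close> too many to be all multiples of the minimal one.\<close>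

lemma free_of_tjurina_ge:
  assumes D3: "D \<ge> 3" and r: "0 \<le> r" "2 * r \<le> D" and nz: "ar f r \<noteq> 0" and min: "\<And>j. j < r \<Longrightarrow> ar f j = 0"
    and \<tau>: "int (total_tjurina f) \<ge> D ^ 2 - r * (D - r)"
  shows "free_curve f"
proof -
  obtain k0 where k0: "\<And>k. k \<ge> k0 \<Longrightarrow> milnor_dim f k = total_tjurina f" using milnor_dim_eventually_tjurina by metis
  let ?j = "D - r"
  have "int (milnor_dim f (2 * D - 3 - ?j)) = sdim (2 * D - 3 - ?j) - 3 * sdim (r - 3) + int (ar f (r - 3))"
    using milnor_dim_eq[OF f_homog, of "2 * D - 3 - ?j", folded D_def] by (simp add: algebra_simps)
  moreover have "ar f (r - 3) = 0" by (rule min) simp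
  moreover have "int (ar f ?j) - 3 * sdim (?j - D) + sdim (?j - 2 * D) + int (milnor_dim f (2 * D - 3 - ?j)) \<ge> int (total_tjurina f)"
    by (rule ar_milnor_ge[OF k0]) (use D3 r in simp_all)
  moreover have "sdim (?j - 2 * D) = 0" using r D3 by (intro sdim_neg) simp
  moreover have "?j - D = - 3 - (r - 3)" by simp
  ultimately have "2 * int (ar f ?j) \<ge> 2 * (D ^ 2 - r * (D - r)) - 2 * sdim (2 * D - 3 - ?j) + 3 * (2 * (sdim (r - 3) + sdim (- 3 - (r - 3))))"
    using \<tau> by simp
  also have "2 * sdim (2 * D - 3 - ?j) = hpoly (2 * D - 3 - ?j)" using r D3 by (intro sdim_double) simp
  also have "2 * (sdim (r - 3) + sdim (- 3 - (r - 3))) = hpoly (D - 3 - ?j)" unfolding sdim_reflect by simp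
  also have "2 * (D ^ 2 - r * (D - r)) - hpoly (2 * D - 3 - ?j) + 3 * hpoly (D - 3 - ?j) = hpoly (D - 2 * r) + 2"
    unfolding hpoly_identity by simp
  \<comment> \<open>The summand 1 is half of \<open>hpoly 0\<close>. It goes beyond the multiples of
    the minimal syzygy, which span only the dimension \<open>sdim (D - 2 * r)\<close>.\<close>
  finally have big: "int (ar f ?j) \<ge> sdim (D - 2 * r) + 1"
    using sdim_double[of "D - 2 * r"] r by simp
  obtain t where t: "t \<in> AR f \<inter> homog_triples r" "t \<noteq> 0"
    using nz S3C.subspace_0[OF subspace_AR_homog, of f r] unfolding ar_eq_0_iff by blast
  obtain a0 a1 a2 where ta: "t = (a0, a1, a2)" by (cases t)
  note ta' = t[unfolded ta]
  have min': "AR f \<inter> homog_triples j = {0}" if "j < r" for j using min[OF that] ar_eq_0_iff by blast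
  have "\<exists>s0 s1 s2. (s0, s1, s2) \<in> AR f \<inter> homog_triples ?j \<and> \<not> (a1 * s2 = a2 * s1 \<and> a2 * s0 = a0 * s2 \<and> a0 * s1 = a1 * s0)"
  proof (rule ccontr)
    assume no: "\<not> ?thesis"
    have "AR f \<inter> homog_triples ?j \<subseteq> (\<lambda>q. smult3 q t) ` homog (D - 2 * r)"
    proof
      fix s assume s: "s \<in> AR f \<inter> homog_triples ?j"
      obtain s0 s1 s2 where s012: "s = (s0, s1, s2)" by (cases s)
      have "a1 * s2 = a2 * s1 \<and> a2 * s0 = a0 * s2 \<and> a0 * s1 = a1 * s0" using no s unfolding s012 by blast
      then have p: "s1 * a2 = s2 * a1" "s2 * a0 = s0 * a2" "s0 * a1 = s1 * a0" by (simp_all add: ac_simps)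
      have "(s0, s1, s2) \<in> homog_triples ?j" using s s012 by blast
      from parallel_to_minimal_syzygy[OF ta' min' this p] obtain q where "q \<in> homog (?j - r)" "s = smult3 q t"
        unfolding s012 ta by blast
      then show "s \<in> (\<lambda>q. smult3 q t) ` homog (D - 2 * r)" by simp
    qed
    note sub = this
    interpret lt: Vector_Spaces.linear scale3 "\<lambda>c. smult3 (const3 c)" "\<lambda>q. smult3 q t" by (rule linear_smult3)
    have "S3C.dim ((\<lambda>q. smult3 q t) ` homog (D - 2 * r)) = S.dim (homog (D - 2 * r))"
      by (rule lt.dim_image_inj[OF subspace_homog fin_dim_homog]) (use t(2) in \<open>simp add: smult3_eq_0_iff\<close>)
    then have "ar f ?j \<le> S.dim (homog (D - 2 * r))"
      unfolding ar_def using S3C.dim_mono_finite[OF lt.fin_dim_image[OF fin_dim_homog] sub] by simp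
    then show False using big by simp
  qed
  then obtain s0 s1 s2 where s: "(s0, s1, s2) \<in> AR f \<inter> homog_triples ?j"
    and np: "\<not> (a1 * s2 = a2 * s1 \<and> a2 * s0 = a0 * s2 \<and> a0 * s1 = a1 * s0)" by blast
  obtain h where h: "h \<in> homog (r + ?j - D)" "a1 * s2 - a2 * s1 = h * pd 0 f" "a2 * s0 - a0 * s2 = h * pd 1 f" "a0 * s1 - a1 * s0 = h * pd 2 f"
    using cross_gradient[OF ta'(1) s] by metis
  have h0: "h \<noteq> 0" using np h(2-4) by auto
  \<comment> \<open>The degrees r and D - r add up to D, so h is a constant.\<close>
  have "h \<in> homog (0 + 0)" using h(1) by simp
  then have "h = const3 (Poly_Mapping.lookup h 0)" by (intro homog_0_const) simp
  moreover from this have "Poly_Mapping.lookup h 0 \<noteq> 0" using h0 by auto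
  ultimately show ?thesis using free_of_cross[OF ta'(1) s, of "Poly_Mapping.lookup h 0"] h(2-4) by simp
qed

text \<open>The given equality expresses \<tau> by ar(f) in the degrees j0 and j1 = D - 3 - j0,
  which are equal or adjacent. If the least degree r of a syzygy is at most j1, the multiples of
  that syzygy bound \<tau> below. If there is no syzygy up to j1, \<tau> is known exactly, and the
  duality inequality produces a syzygy of degree j1 + 1.\<close>

lemma free_of_middle:
  assumes D3: "D \<ge> 3" and j0: "j0 = (D - 3) div 2"
    and eq: "int (ar f j0) + int (milnor_dim f (2 * D - 3 - j0)) = int (total_tjurina f)"
  shows "free_curve f"
proof -
  let ?\<tau> = "int (total_tjurina f)"
  obtain k0 where k0: "\<And>k. k \<ge> k0 \<Longrightarrow> milnor_dim f k = total_tjurina f" using milnor_dim_eventually_tjurina by metis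
  define j1 where "j1 = D - 3 - j0"
  have j: "j0 \<ge> 0" "j1 = j0 \<or> j1 = j0 + 1" using D3 unfolding j0 j1_def by presburger+
  have D: "D = j0 + j1 + 3" by (simp add: j1_def)
  have "int (milnor_dim f (2 * D - 3 - j0)) = sdim (2 * D - 3 - j0) - 3 * sdim j1 + int (ar f j1)"
    using milnor_dim_eq[OF f_homog, of "2 * D - 3 - j0", folded D_def] by (simp add: j1_def algebra_simps)
  moreover have "2 * sdim (2 * D - 3 - j0) = hpoly (2 * D - 3 - j0)" "2 * sdim j1 = hpoly j1"
    using j D3 D by (intro sdim_double; linarith)+
  ultimately have \<tau>: "2 * ?\<tau> = 2 * int (ar f j0) + 2 * int (ar f j1) + hpoly (2 * D - 3 - j0) - 3 * hpoly j1"
    using eq by linarith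
  note hpoly_j0 = hpoly_identity[of D _ j0, folded j1_def]
  show ?thesis
  proof (cases "\<exists>i\<le>j1. ar f i \<noteq> 0")
    case True
    then obtain i where i: "i \<le> j1" "ar f i \<noteq> 0" by blast
    then have "i \<ge> 0" using ar_neg[of i f] by (cases "i < 0") auto
    then obtain n where n: "i = int n" using nonneg_int_cases by blast
    define m where "m = (LEAST m. ar f (int m) \<noteq> 0)"
    have m: "ar f (int m) \<noteq> 0" unfolding m_def by (rule LeastI[of _ n]) (use i n in simp)
    have "m \<le> n" unfolding m_def by (rule Least_le) (use i n in simp)
    define r where "r = int m"
    have r: "0 \<le> r" "r \<le> j1" "ar f r \<noteq> 0" using m \<open>m \<le> n\<close> i n by (simp_all add: r_def)
    have min: "ar f k = 0" if k: "k < r" for k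
    proof (cases "k < 0")
      case False
      then have "nat k < m" using k by (simp add: r_def)
      then have "ar f (int (nat k)) = 0" using not_less_Least unfolding m_def by blast
      then show ?thesis using False by simp
    qed (rule ar_neg)
    obtain t where t: "t \<in> AR f \<inter> homog_triples r" "t \<noteq> 0"
      using r(3) S3C.subspace_0[OF subspace_AR_homog, of f r] unfolding ar_eq_0_iff by blast
    have "2 * sdim (j0 - r) = hpoly (j0 - r)" "2 * sdim (j1 - r) = hpoly (j1 - r)"
      using r j by (intro sdim_double; linarith)+
    then have "2 * int (ar f j0) \<ge> hpoly (j0 - r)" "2 * int (ar f j1) \<ge> hpoly (j1 - r)"
      using ar_ge_of_syzygy[OF t, of j0] ar_ge_of_syzygy[OF t, of j1] by linarith+
    \<comment> \<open>The arguments are exchanged by k -> - 3 - k, under which \<open>hpoly\<close>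
      is symmetric.\<close>
    moreover have "hpoly (j0 - (D - r)) = hpoly (j1 - r)" unfolding D by (simp add: algebra_simps)
    \<comment> \<open>The bounds are combined with all products abstracted to variables, which makes
      the problem linear.\<close>
    moreover have "F \<le> t" if "x \<le> 2 * p" "y \<le> 2 * q" "z = y" "2 * t = 2 * p + 2 * q + P - 3 * Q" "2 * F - P + 3 * Q = x + z"
      for F t x y z p q P Q :: int using that by linarith
    ultimately have "?\<tau> \<ge> D ^ 2 - r * (D - r)" using \<tau> hpoly_j0[of r] by blast
    moreover have "2 * r \<le> D" using r j D by linarith
    ultimately show ?thesis using free_of_tjurina_ge[OF D3 r(1) _ r(3) min] by blast
  next
    case False
    \<comment> \<open>With this r both j0 - r and j0 - (D - r) are - 1 or - 2, the zeros of
      \<open>hpoly\<close>, so \<tau> is exactly D^2 - r (D - r).\<close>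
    define r where "r = j1 + 1"
    have min: "ar f k = 0" if "k < r" for k using False that by (simp add: r_def)
    have h0: "hpoly (j0 - r) = 0" "hpoly (j0 - (D - r)) = 0" using j unfolding D r_def by auto
    have "ar f j0 = 0" "ar f j1 = 0" using j by (auto intro!: min simp: r_def)
    moreover have "2 * (D ^ 2 - r * (D - r)) - hpoly (2 * D - 3 - j0) + 3 * hpoly j1 = 0"
      by (simp only: hpoly_j0 h0)
    ultimately have \<tau>r: "2 * ?\<tau> = 2 * (D ^ 2 - r * (D - r))" using \<tau> by linarith
    have r: "0 \<le> r" "2 * r = D \<or> 2 * r = D - 1" using j unfolding D r_def by auto
    have "int (ar f r) - 3 * sdim (r - D) + sdim (r - 2 * D) + int (milnor_dim f (2 * D - 3 - r)) \<ge> ?\<tau>"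
      by (rule ar_milnor_ge[OF k0]) (use D3 r in auto)
    moreover have "sdim (r - D) = 0" "sdim (r - 2 * D) = 0" using r D3 by (intro sdim_neg; linarith)+
    moreover have "int (milnor_dim f (2 * D - 3 - r)) = sdim (2 * D - 3 - r) - 3 * sdim (D - 3 - r) + int (ar f (D - 3 - r))"
      using milnor_dim_eq[OF f_homog, of "2 * D - 3 - r", folded D_def] by (simp add: algebra_simps)
    moreover have "ar f (D - 3 - r) = 0" using r by (intro min) auto
    moreover have "2 * sdim (2 * D - 3 - r) = hpoly (2 * D - 3 - r)" "2 * sdim (D - 3 - r) = hpoly (D - 3 - r)"
      using r D3 by (intro sdim_double; linarith)+
    \<comment> \<open>\<open>hpoly 0\<close> is 2, and 2 r - D is 0 or - 1, where
      \<open>hpoly\<close> is nonnegative; this surplus is the syzygy of degree r.\<close>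
    moreover have "hpoly (r - r) + hpoly (r - (D - r)) \<ge> 2" using r(2) by auto
    ultimately have "2 * int (ar f r) \<ge> 2" using \<tau>r hpoly_identity[of D r r] by linarith
    then have "ar f r \<noteq> 0" by simp
    moreover have "2 * r \<le> D" using r by auto
    ultimately show ?thesis using free_of_tjurina_ge[OF D3 r(1) _ _ min] \<tau>r by simp
  qed
qed

text \<open>The partial derivatives have degree D, so the entries of a boundary have no components
  of degree less than D.\<close>

lemma koszul_H2_low:
  assumes "q < D"
  shows "koszul_H2_nonzero f (q + 2) \<longleftrightarrow> ar f q \<noteq> 0"
proof -
  have "koszul_cycles2 f (q + 2) = AR f \<inter> homog_triples q"
    by (auto simp: koszul_cycles2_def koszul_d2_def AR_def mult.commute)
  moreover have "koszul_boundaries2 f (q + 2) = {0}"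
  proof (intro equalityI subsetI)
    fix x assume x: "x \<in> koszul_boundaries2 f (q + 2)"
    then obtain w where w: "x = koszul_d1 f w" "x \<in> homog_triples q" by (auto simp: koszul_boundaries2_def)
    obtain x0 x1 x2 w0 w1 w2 where c: "x = (x0, x1, x2)" "w = (w0, w1, w2)" by (cases x, cases w) auto
    have xe: "x0 = pd 1 f * w2 - pd 2 f * w1" "x1 = pd 2 f * w0 - pd 0 f * w2" "x2 = pd 0 f * w1 - pd 1 f * w0"
      using w(1) by (simp_all add: c koszul_d1_def)
    have "hcomp (q - D) v = 0" for v using hcomp_homog[of "q - D" v] homog_neg[of "q - D"] assms by simp
    then have "hcomp q x0 = 0" "hcomp q x1 = 0" "hcomp q x2 = 0"
      unfolding xe by (simp_all add: hcomp_diff hcomp_homog_mult[OF pd_f_homog])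
    moreover have "x0 \<in> homog q" "x1 \<in> homog q" "x2 \<in> homog q" using w(2) by (auto simp: c homog_triples_def)
    ultimately have "x0 = 0" "x1 = 0" "x2 = 0" by (simp_all add: hcomp_homog_id)
    then show "x \<in> {0}" by (simp add: c zero_prod_def)
  next
    fix x :: triple3 assume "x \<in> {0}"
    then have "x = koszul_d1 f 0" "x \<in> homog_triples q" by (simp_all add: koszul_d1_def zero_prod_def homog_triples_def)
    then show "x \<in> koszul_boundaries2 f (q + 2)" by (simp add: koszul_boundaries2_def)
  qed
  ultimately show ?thesis
    using S3C.subspace_0[OF subspace_AR_homog, of f q] unfolding koszul_H2_nonzero_def ar_eq_0_iff by auto
qed

end

theorem theorem2p3:
  fixes f fs :: poly3 and d :: nat and T :: int
  assumes "d \<ge> 4"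
    and "f \<in> homog (int d)" and "squarefree f"
    and "fs \<in> homog (int d)" and "smooth_curve fs"
    and "T = 3 * (int d - 2)"
  shows "let
      cond_i = free_curve f;
      cond_ii =
        ((\<forall>j::int. -1 \<le> j \<and> j \<le> int d - 2 \<longrightarrow>
            milnor_dim f (2 * int d - 5 - j) + ar f j = total_tjurina f)
         \<and> ar f (int d - 2) \<noteq> 0);
      cond_iii =
        (int (milnor_dim f (T div 2)) + int (milnor_dim f (T - T div 2))
           - int (milnor_dim fs (T div 2)) = int (total_tjurina f))
    in (cond_i \<longleftrightarrow> cond_ii) \<and> (cond_ii \<longleftrightarrow> cond_iii) \<and>
       (cond_ii \<longrightarrow> st f = 2 * int d - 4 - mdr f \<and> 2 * int d - 4 - mdr f = T - ct f fs)"
proof -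
  have "d \<ge> 2" using assms(1) by simp
  then obtain \<alpha> \<gamma> a c where "transversal_line f d \<alpha> \<gamma> a c"
    using transversal_line_exists[OF assms(2,3)] by metis
  then interpret transversal_line f d \<alpha> \<gamma> a c .
  have dD: "int d = D + 1" by (simp add: D_def)
  have D3: "D \<ge> 3" using assms(1) by (simp add: D_def)
  have T: "T = 3 * D - 3" using assms(6) by (simp add: dD)
  have ar_fs: "ar fs j = 0" if "j < D" for j
    using ar_smooth[OF assms(4,5) \<open>d \<ge> 2\<close>] that by (simp add: D_def)
  have m_diff: "int (milnor_dim f k) - int (milnor_dim fs k) = int (ar f (k - D)) - int (ar fs (k - D))" for k
    using milnor_dim_eq[OF assms(2), of k] milnor_dim_eq[OF assms(4), of k] by (simp add: dD)
  define i where "i \<longleftrightarrow> free_curve f"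
  define ii where "ii \<longleftrightarrow> (\<forall>j::int. -1 \<le> j \<and> j \<le> int d - 2 \<longrightarrow>
            milnor_dim f (2 * int d - 5 - j) + ar f j = total_tjurina f) \<and> ar f (int d - 2) \<noteq> 0"
  define iii where "iii \<longleftrightarrow> int (milnor_dim f (T div 2)) + int (milnor_dim f (T - T div 2))
           - int (milnor_dim fs (T div 2)) = int (total_tjurina f)"
  have deg: "2 * int d - 5 - j = 2 * D - 3 - j" "int d - 2 = D - 1" for j by (simp_all add: dD)
  \<comment> \<open>Half of T = 3 D - 3, shifted by D, the degree from which on m(f) depends on
    syzygies; T - [T/2] then becomes the degree 2 D - 3 - j0 dual to j0.\<close>
  define j0 where "j0 = (D - 3) div 2"
  have j0: "T div 2 - D = j0" "T - T div 2 = 2 * D - 3 - j0" "-1 \<le> j0" "j0 \<le> D - 1"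
    using D3 unfolding T j0_def by presburger+
  \<comment> \<open>The smooth curve has no syzygies of degree less than D, so m(f) and m(fs) differ
    in degree [T/2] by ar(f) in degree j0.\<close>
  have iii_eq: "iii \<longleftrightarrow> int (ar f j0) + int (milnor_dim f (2 * D - 3 - j0)) = int (total_tjurina f)"
  proof -
    have "ar fs j0 = 0" using j0(4) by (intro ar_fs) simp
    then show ?thesis unfolding iii_def j0(2) using m_diff[of "T div 2"] unfolding j0(1) by auto
  qed
  have i_ii: "ii" and i_st: "st f = 2 * int d - 4 - mdr f" "2 * int d - 4 - mdr f = T - ct f fs" if "i"
  proof -
    obtain d1 d2 where d: "0 \<le> d1" "d1 \<le> d2" "d1 + d2 = D" "\<And>k. int (ar f k) = sdim (k - d1) + sdim (k - d2)"
      "int (total_tjurina f) = D ^ 2 - d1 * (D - d1)"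
      using free_curve_exponents \<open>i\<close> unfolding i_def by metis
    have d1: "d1 < D" "d1 \<le> D - 1" using d D3 by linarith+
    note m = milnor_ar_of_exponents[OF d(3,4,5)]
    have ar_pos: "ar f k \<noteq> 0" if "k \<ge> d1" for k
    proof -
      have "sdim (k - d1) \<ge> sdim 0" using that by (intro sdim_mono) simp
      moreover have "sdim 0 = 1" using sdim_double[of 0] by simp
      ultimately show ?thesis using d(4)[of k] by linarith
    qed
    have ar_low: "ar f k = 0" if "k < d1" for k
      using d(4)[of k] sdim_neg[of "k - d1"] sdim_neg[of "k - d2"] that d(2) by simp
    show ii unfolding ii_def deg
    proof (intro conjI allI impI)
      fix j assume "- 1 \<le> j \<and> j \<le> D - 1"
      then have "int (milnor_dim f (2 * D - 3 - j)) + int (ar f j) = int (total_tjurina f)" by (intro m) simp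
      then show "milnor_dim f (2 * D - 3 - j) + ar f j = total_tjurina f" by linarith
    qed (use ar_pos d1 in simp)
    \<comment> \<open>As d1 < D, the Koszul homology in question is AR(f) itself in all degrees up
      to d1.\<close>
    have mdr: "mdr f = d1"
      unfolding mdr_def
    proof (rule Least_equality)
      show "koszul_H2_nonzero f (d1 + 2)" using koszul_H2_low[OF d1(1)] ar_pos[of d1] by simp
      fix q assume q: "koszul_H2_nonzero f (q + 2)"
      show "d1 \<le> q"
      proof (rule ccontr)
        assume "\<not> d1 \<le> q"
        then show False using q koszul_H2_low[of q] ar_low[of q] d1 by simp
      qed
    qed
    \<comment> \<open>For k < 2 D the difference of m(f) and m(fs) in degree k is ar(f) in degree k
      - D, which is first nonzero at k = D + d1.\<close>
    have ct: "ct f fs = D + d1 - 1"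
      unfolding ct_def
    proof (rule Greatest_equality)
      show "\<forall>k\<le>D + d1 - 1. milnor_dim f k = milnor_dim fs k"
      proof (intro allI impI)
        fix k assume "k \<le> D + d1 - 1"
        then show "milnor_dim f k = milnor_dim fs k" using m_diff[of k] ar_low[of "k - D"] ar_fs[of "k - D"] d1 by simp
      qed
      fix y assume y: "\<forall>k\<le>y. milnor_dim f k = milnor_dim fs k"
      show "y \<le> D + d1 - 1"
      proof (rule ccontr)
        assume "\<not> ?thesis"
        then have "milnor_dim f (D + d1) = milnor_dim fs (D + d1)" using y by simp
        then show False using m_diff[of "D + d1"] ar_pos[of d1] ar_fs[of d1] d1 by simp
      qed
    qed
    \<comment> \<open>By the equality of (ii), m(f) differs from \<tau> in degree 2 D - 3 - j
      exactly if ar(f) is nonzero in degree j; the highest such degree belongs to j = d1.\<close>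
    have st: "st f = 2 * D - 2 - d1"
      unfolding st_def
    proof (rule Least_equality)
      show "\<forall>k\<ge>2 * D - 2 - d1. milnor_dim f k = total_tjurina f"
      proof (intro allI impI)
        fix k assume k: "k \<ge> 2 * D - 2 - d1"
        \<comment> \<open>Degrees above 2 D - 3 are covered too, as \<open>m\<close> holds for all
          negative j.\<close>
        show "milnor_dim f k = total_tjurina f"
          using m[of "2 * D - 3 - k"] ar_low[of "2 * D - 3 - k"] k d1 by simp
      qed
      fix y assume y: "\<forall>k\<ge>y. milnor_dim f k = total_tjurina f"
      show "2 * D - 2 - d1 \<le> y"
      proof (rule ccontr)
        assume "\<not> ?thesis"
        then have "milnor_dim f (2 * D - 3 - d1) = total_tjurina f" using y by simp
        then show False using m[of d1] ar_pos[of d1] d1 by simp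
      qed
    qed
    show "st f = 2 * int d - 4 - mdr f" "2 * int d - 4 - mdr f = T - ct f fs"
      unfolding st mdr ct T dD by simp_all
  qed
  have ii_iii: "iii" if "ii"
  proof -
    have "milnor_dim f (2 * D - 3 - j0) + ar f j0 = total_tjurina f"
      using that j0 unfolding ii_def deg by blast
    then show ?thesis unfolding iii_eq by linarith
  qed
  have iii_i: "i" if "iii"
    using free_of_middle[OF D3 j0_def] that unfolding iii_eq i_def by blast
  have "(i \<longleftrightarrow> ii) \<and> (ii \<longleftrightarrow> iii) \<and> (ii \<longrightarrow> st f = 2 * int d - 4 - mdr f \<and> 2 * int d - 4 - mdr f = T - ct f fs)"
    using i_ii ii_iii iii_i i_st by blast
  then show ?thesis unfolding Let_def i_def ii_def iii_def .
qed

end
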